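(* Let $n\ge 2$ and let $\lambda=(\lambda_1,\dots,\lambda_k)$ be a partition of $n$ of hook shape, i.e. $\lambda_1\ge 1$ and $\lambda_2=\cdots=\lambda_k=1$. Then the poset $\Pi_n/S_\lambda$ of partitions of the multiset $\{1^{\lambda_1},\dots,k^{\lambda_k}\}$ ordered by refinement is either collapsible or has the homotopy type of a wedge of spheres concentrated in top dimension (that is, of spheres of dimension $n-3$).
   Context: $\Pi_n$ is the poset of set partitions of $\{1,\dots,n\}$ ordered by refinement. For a partition $\lambda=(\lambda_1\ge\cdots\ge\lambda_k>0)$ of $n$, $S_\lambda=S_{\lambda_1}\times\cdots\times S_{\lambda_k}\le S_n$ is the Young subgroup in which $S_{\lambda_i}$ permutes $\{\lambda_1+\cdots+\lambda_{i-1}+1,\dots,\lambda_1+\cdots+\lambda_i\}$. It acts on $\Pi_n$ by order-preserving maps, and $\Pi_n/S_\lambda$ is the quotient poset of orbits, where one orbit is below another if some representative of the first is below some representative of the second. Equivalently, its elements are the partitions of the multiset $\{1^{\lambda_1},\dots,k^{\lambda_k}\}$ (with $\lambda_i$ copies of $i$) into unordered nonempty multisets (blocks), ordered by refinement; it has a unique minimal and a unique maximal element (the one-block partition and the partition into singletons, in one order or the other). Topological statements about a poset $P$ with $\hat 0$ and $\hat 1$ refer to its order complex $\Delta(P)$, the simplicial complex of chains of $P\setminus\{\hat 0,\hat 1\}$. Here $\Delta(\Pi_n/S_\lambda)$ has dimension $n-3$; for $n=2$ it is the complex $\{\emptyset\}$, regarded as the $(-1)$-sphere. *)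

theory Defs
  imports
    "HOL-Analysis.Analysis"
    "HOL-Library.Disjoint_Sets"
    "HOL-Combinatorics.Permutations"
begin

section \<open>Quotients of the partition lattice by Young subgroups\<close>

definition number_partition :: "nat \<Rightarrow> nat list \<Rightarrow> bool" where
  "number_partition n ls \<longleftrightarrow> sorted_wrt (\<ge>) ls \<and> (\<forall>l\<in>set ls. 0 < l) \<and> sum_list ls = n"

definition hook_shape :: "nat list \<Rightarrow> bool" where
  "hook_shape ls \<longleftrightarrow> ls \<noteq> [] \<and> ls ! 0 \<ge> 1 \<and> (\<forall>i. 1 \<le> i \<and> i < length ls \<longrightarrow> ls ! i = 1)"

text \<open>Parts are numbered from 0, so part \<open>i\<close> below is the part usually written with index \<open>i + 1\<close>.\<close>

definition young_block :: "nat list \<Rightarrow> nat \<Rightarrow> nat set" where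
  "young_block ls i = {sum_list (take i ls) + 1 .. sum_list (take (Suc i) ls)}"

definition young_subgroup :: "nat list \<Rightarrow> (nat \<Rightarrow> nat) set" where
  "young_subgroup ls =
     {\<pi>. \<pi> permutes {1..sum_list ls} \<and> (\<forall>i<length ls. \<pi> ` young_block ls i = young_block ls i)}"

definition set_partitions :: "nat \<Rightarrow> nat set set set" where
  "set_partitions n = {P. partition_on {1..n} P}"

definition partition_act :: "(nat \<Rightarrow> nat) \<Rightarrow> nat set set \<Rightarrow> nat set set" where
  "partition_act \<pi> P = (\<lambda>B. \<pi> ` B) ` P"

definition young_orbit :: "nat list \<Rightarrow> nat set set \<Rightarrow> nat set set set" where
  "young_orbit ls P = {partition_act \<pi> P | \<pi>. \<pi> \<in> young_subgroup ls}"

definition quotient_carrier :: "nat \<Rightarrow> nat list \<Rightarrow> nat set set set set" where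
  "quotient_carrier n ls = young_orbit ls ` set_partitions n"

definition quotient_le :: "nat \<Rightarrow> nat set set set \<Rightarrow> nat set set set \<Rightarrow> bool" where
  "quotient_le n X Y \<longleftrightarrow> (\<exists>P\<in>X. \<exists>Q\<in>Y. refines {1..n} P Q)"


section \<open>Order complexes, collapsibility and realization\<close>

text \<open>Abstract simplicial complexes are sets of finite sets that contain the empty face.\<close>

definition proper_part :: "'a set \<Rightarrow> ('a \<Rightarrow> 'a \<Rightarrow> bool) \<Rightarrow> 'a set" where
  "proper_part A le = {x \<in> A. \<not> (\<forall>y\<in>A. le x y) \<and> \<not> (\<forall>y\<in>A. le y x)}"

definition order_complex :: "'a set \<Rightarrow> ('a \<Rightarrow> 'a \<Rightarrow> bool) \<Rightarrow> 'a set set" where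
  "order_complex A le =
     {\<sigma>. finite \<sigma> \<and> \<sigma> \<subseteq> proper_part A le \<and> Complete_Partial_Order.chain le \<sigma>}"

text \<open>The free face has to be nonempty: otherwise a single vertex could be removed
  together with the empty face.\<close>

definition elementary_collapse :: "'v set set \<Rightarrow> 'v set set \<Rightarrow> bool" where
  "elementary_collapse K L \<longleftrightarrow>
     (\<exists>\<sigma> \<tau>. \<sigma> \<in> K \<and> \<tau> \<in> K \<and> \<sigma> \<noteq> {} \<and> \<sigma> \<subset> \<tau> \<and> card \<tau> = Suc (card \<sigma>) \<and>
        (\<forall>\<rho>\<in>K. \<sigma> \<subset> \<rho> \<longrightarrow> \<rho> = \<tau>) \<and> L = K - {\<sigma>, \<tau>})"

definition collapsible :: "'v set set \<Rightarrow> bool" where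
  "collapsible K \<longleftrightarrow> (\<exists>v. elementary_collapse\<^sup>*\<^sup>* K {{}, {v}})"

text \<open>Points of the realization are given by barycentric coordinates. The topology is
  that of pointwise convergence, which for a finite complex (the only case used here) agrees
  with the weak topology. The complex \<open>{{}}\<close> has empty realization.\<close>

definition geometric_realization :: "'v set set \<Rightarrow> ('v \<Rightarrow> real) topology" where
  "geometric_realization K =
     top_of_set {a. (\<forall>v. 0 \<le> a v) \<and> {v. a v \<noteq> 0} \<in> K \<and> (\<Sum>v | a v \<noteq> 0. a v) = 1}"


section \<open>Wedges of spheres\<close>

definition quotient_topology :: "'a topology \<Rightarrow> ('a \<Rightarrow> 'b) \<Rightarrow> 'b topology" where
  "quotient_topology X q =
     topology (\<lambda>U. U \<subseteq> q ` topspace X \<and> openin X {x \<in> topspace X. q x \<in> U})"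

lemma openin_quotient_topology:
  "openin (quotient_topology X q) U \<longleftrightarrow>
     U \<subseteq> q ` topspace X \<and> openin X {x \<in> topspace X. q x \<in> U}"
proof -
  have "istopology (\<lambda>U. U \<subseteq> q ` topspace X \<and> openin X {x \<in> topspace X. q x \<in> U})"
    unfolding istopology_def
  proof (intro conjI allI impI)
    fix S T
    assume S: "S \<subseteq> q ` topspace X \<and> openin X {x \<in> topspace X. q x \<in> S}"
      and T: "T \<subseteq> q ` topspace X \<and> openin X {x \<in> topspace X. q x \<in> T}"
    have "{x \<in> topspace X. q x \<in> S \<inter> T} =
        {x \<in> topspace X. q x \<in> S} \<inter> {x \<in> topspace X. q x \<in> T}" by blast
    then show "openin X {x \<in> topspace X. q x \<in> S \<inter> T}"
      using openin_Int[OF conjunct2[OF S] conjunct2[OF T]] by (simp only:)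
    show "S \<inter> T \<subseteq> q ` topspace X" using S by (meson le_infI1)
  next
    fix \<K>
    assume K: "\<forall>S\<in>\<K>. S \<subseteq> q ` topspace X \<and> openin X {x \<in> topspace X. q x \<in> S}"
    show "\<Union>\<K> \<subseteq> q ` topspace X" using K by (meson Sup_least)
    have eq: "{x \<in> topspace X. q x \<in> \<Union>\<K>} = \<Union>((\<lambda>S. {x \<in> topspace X. q x \<in> S}) ` \<K>)"
      by blast
    show "openin X {x \<in> topspace X. q x \<in> \<Union>\<K>}"
      unfolding eq
    proof (rule openin_Union)
      fix V
      assume "V \<in> (\<lambda>S. {x \<in> topspace X. q x \<in> S}) ` \<K>"
      then obtain S where "S \<in> \<K>" and V: "V = {x \<in> topspace X. q x \<in> S}"
        by (rule imageE)
      show "openin X V"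
        unfolding V by (rule conjunct2[OF bspec[OF K \<open>S \<in> \<K>\<close>]])
    qed
  qed
  then show ?thesis
    unfolding quotient_topology_def by (rule fun_cong[OF topology_inverse'])
qed

lemma topspace_quotient_topology [simp]:
  "topspace (quotient_topology X q) = q ` topspace X"
proof (rule subset_antisym)
  show "topspace (quotient_topology X q) \<subseteq> q ` topspace X"
    using openin_topspace[of "quotient_topology X q"] by (simp only: openin_quotient_topology)
  have "{x \<in> topspace X. q x \<in> q ` topspace X} = topspace X" by blast
  then have "openin (quotient_topology X q) (q ` topspace X)"
    by (simp only: openin_quotient_topology openin_topspace order_refl simp_thms)
  then show "q ` topspace X \<subseteq> topspace (quotient_topology X q)"
    by (rule openin_subset)
qed

lemma quotient_map_quotient_topology: "quotient_map X (quotient_topology X q) q"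
  unfolding quotient_map_def topspace_quotient_topology openin_quotient_topology
  by (intro conjI allI impI refl iffI) simp_all

text \<open>The wedge of the pointed spaces \<open>(X i, b i)\<close>: all base points \<open>(i, b i)\<close> of the disjoint
  union are glued to the one point \<open>None\<close>.\<close>

definition wedge_sum :: "('i \<Rightarrow> 'a topology) \<Rightarrow> ('i \<Rightarrow> 'a) \<Rightarrow> 'i set \<Rightarrow> ('i \<times> 'a) option topology" where
  "wedge_sum X b I =
     quotient_topology (sum_topology X I) (\<lambda>(i, x). if x = b i then None else Some (i, x))"

text \<open>The \<open>d\<close>-sphere for \<open>d \<ge> -1\<close>; the \<open>(-1)\<close>-sphere is the empty space.\<close>

definition sphere_space :: "int \<Rightarrow> (nat \<Rightarrow> real) topology" where
  "sphere_space d = (if d < 0 then trivial_topology else nsphere (nat d))"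

definition sphere_base :: "nat \<Rightarrow> real" where
  "sphere_base = (\<lambda>i. if i = 0 then 1 else 0)"

text \<open>The wedge of \<open>m \<ge> 1\<close> spheres of dimension \<open>d\<close>. For \<open>d = -1\<close> there is no base point and
  the result is empty, that is, the \<open>(-1)\<close>-sphere itself.\<close>

definition wedge_of_spheres :: "nat \<Rightarrow> int \<Rightarrow> (nat \<times> (nat \<Rightarrow> real)) option topology" where
  "wedge_of_spheres m d = wedge_sum (\<lambda>_. sphere_space d) (\<lambda>_. sphere_base) {..<m}"

end

theory Submission
  imports Defs
begin

text \<open>If the shape is not \<open>(n)\<close>, the element \<open>n\<close> is fixed by the Young subgroup, so an orbit of
  partitions amounts to a pair \<open>(B, M)\<close> of the multiset of the companions of \<open>n\<close> and the
  partition of the remaining multiset. The atoms in which \<open>n\<close> has a single companion \<open>y\<close> are pairwise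
  incomparable, and above such an atom the poset is of the same form with one \<open>y\<close> less. Without
  these atoms, isolating \<open>n\<close> is a closure operator whose image has a maximum, so the rest is
  collapsible. By induction, the order complex collapses to a point after the removal of some
  facets of top dimension: the facets are those of the links of the atoms, joined with the atom. A
  complex with this property is a contractible space with simplices attached along their
  boundaries, hence a wedge of spheres. For the shape \<open>(n)\<close> with \<open>n \<ge> 3\<close> there is only
  one atom, and the order complex is a cone.\<close>

section \<open>Collapses of simplicial complexes\<close>

text \<open>Two obstacles shape the argument. The order on orbits is given by the existence of
  comparable representatives, so not even antisymmetry is evident; for the shapes in which
  \<open>n\<close> is fixed the work is therefore done on pairs of multisets, where comparisons are
  explicit and the number of blocks is a strict rank. Moreover, the homotopy types of the links
  alone would not tell how the pieces fit together, so the induction carries a combinatorial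
  statement about removable facets. It is inherited because a facet of the link of an atom, with the
  atom added, is again a facet, and because incomparable atoms can be deleted independently. Tracing
  the construction, one facet is removed for each distinct arrangement of the letters of the
  multiset: the block of \<open>n\<close> swallows them one at a time. On the topological side, no
  theory of cell complexes enters: a contraction of what remains is extended over each attached
  simplex by an explicit radial stretching, which shows that crushing the contractible part to a
  point is a homotopy equivalence.\<close>

abbreviation collapses :: "'v set set \<Rightarrow> 'v set set \<Rightarrow> bool" where
  "collapses \<equiv> elementary_collapse\<^sup>*\<^sup>*"

definition complex :: "'v set set \<Rightarrow> bool" where
  "complex K \<longleftrightarrow> finite (\<Union>K) \<and> {} \<in> K \<and> (\<forall>\<sigma>\<in>K. \<forall>\<rho>\<subseteq>\<sigma>. \<rho> \<in> K)"

text \<open>For a complex the link is \<open>{}\<close>, not \<open>{{}}\<close>, when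
  \<open>v\<close> is not a vertex. This void case occurs when every face at \<open>v\<close> has
  been removed.\<close>

definition link :: "'v set set \<Rightarrow> 'v \<Rightarrow> 'v set set" where
  "link K v = {\<sigma>. v \<notin> \<sigma> \<and> insert v \<sigma> \<in> K}"

definition deletion :: "'v set set \<Rightarrow> 'v \<Rightarrow> 'v set set" where
  "deletion K v = {\<sigma> \<in> K. v \<notin> \<sigma>}"

section \<open>Links, deletions and collapses\<close>

lemma complex_face: "complex K \<Longrightarrow> \<sigma> \<in> K \<Longrightarrow> \<rho> \<subseteq> \<sigma> \<Longrightarrow> \<rho> \<in> K"
  unfolding complex_def by blast

lemma complex_finite_face: "complex K \<Longrightarrow> \<sigma> \<in> K \<Longrightarrow> finite \<sigma>"
  unfolding complex_def by (meson Sup_upper finite_subset)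

lemma complex_finite: "complex K \<Longrightarrow> finite K"
  unfolding complex_def by (meson finite_Pow_iff finite_subset subset_Pow_Union)

lemma deletion_Un_link: "K = deletion K v \<union> insert v ` link K v"
proof -
  have "\<sigma> \<in> insert v ` link K v" if "\<sigma> \<in> K" "v \<in> \<sigma>" for \<sigma>
    using that by (intro image_eqI[of _ _ "\<sigma> - {v}"]) (auto simp: link_def insert_absorb)
  then show ?thesis by (auto simp: deletion_def link_def)
qed

text \<open>Adding \<open>v\<close> to both faces of a collapsing pair of the link gives a
  collapsing pair of \<open>K\<close>, because every face above the smaller one contains
  \<open>v\<close>. The two faces of the link that are left over become \<open>{v}\<close> and
  \<open>{v, w}\<close>, which form one more pair, and with it all faces at \<open>v\<close> are
  gone.\<close>

lemma collapses_link:
  assumes "collapses (link K v) {{}, {w}}"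
  shows "collapses K (deletion K v)"
proof -
  have *: "L \<subseteq> link K v \<and> collapses K (deletion K v \<union> insert v ` L)"
    if "collapses (link K v) L" for L
    using that
  proof induction
    case base
    then show ?case using deletion_Un_link[of K v] by simp
  next
    case (step L L')
    then obtain \<sigma> \<tau> where s: "\<sigma> \<in> L" "\<tau> \<in> L" "\<sigma> \<noteq> {}" "\<sigma> \<subset> \<tau>" "card \<tau> = Suc (card \<sigma>)"
      and m: "\<And>\<rho>. \<rho> \<in> L \<Longrightarrow> \<sigma> \<subset> \<rho> \<Longrightarrow> \<rho> = \<tau>" and L': "L' = L - {\<sigma>, \<tau>}"
      unfolding elementary_collapse_def by blast
    have v: "v \<notin> \<rho>" if "\<rho> \<in> L" for \<rho> using that step.IH by (auto simp: link_def)
    have fin: "finite \<tau>" using s(5) by (metis card.infinite nat.distinct(1))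
    then have fin': "finite \<sigma>" using s(4) by (meson finite_subset psubset_imp_subset)
    have inj: "insert v \<rho> = insert v \<rho>' \<longleftrightarrow> \<rho> = \<rho>'" if "\<rho> \<in> L" "\<rho>' \<in> L" for \<rho> \<rho>'
      using v that by (metis insert_ident)
    have "elementary_collapse (deletion K v \<union> insert v ` L) (deletion K v \<union> insert v ` L')"
      unfolding elementary_collapse_def
    proof (rule exI[of _ "insert v \<sigma>"], rule exI[of _ "insert v \<tau>"], intro conjI ballI impI)
      show "insert v \<sigma> \<subset> insert v \<tau>" using s(4) inj[OF s(1,2)] by (metis insert_mono psubset_eq)
      show "card (insert v \<tau>) = Suc (card (insert v \<sigma>))"
        using s v fin fin' by simp
      fix \<rho> assume "\<rho> \<in> deletion K v \<union> insert v ` L" "insert v \<sigma> \<subset> \<rho>"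
      then obtain \<rho>' where \<rho>': "\<rho>' \<in> L" "\<rho> = insert v \<rho>'" by (auto simp: deletion_def)
      then have "\<sigma> \<subset> \<rho>'" using \<open>insert v \<sigma> \<subset> \<rho>\<close> v s(1) by (auto simp: psubset_eq)
      then show "\<rho> = insert v \<tau>" using m[OF \<rho>'(1)] \<rho>'(2) by simp
    next
      have "deletion K v \<inter> insert v ` L = {}" by (auto simp: deletion_def)
      moreover have "insert v ` (L - {\<sigma>, \<tau>}) = insert v ` L - {insert v \<sigma>, insert v \<tau>}"
        using inj s(1,2) by auto
      ultimately show "deletion K v \<union> insert v ` L' =
          deletion K v \<union> insert v ` L - {insert v \<sigma>, insert v \<tau>}"
        unfolding L' by (simp only: Un_Diff) (use s(1,2) in \<open>auto simp: deletion_def\<close>)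
    qed (use s in auto)
    with step.IH show ?case using L' by (auto intro: rtranclp.rtrancl_into_rtrancl)
  qed
  from *[OF assms] have vw: "v \<noteq> w" and c: "collapses K (deletion K v \<union> {{v}, {v, w}})"
    by (auto simp: link_def)
  \<comment> \<open>This last pair accounts for the empty face of the link, which no collapse of the
    link removes; in \<open>K\<close> it has become the nonempty face \<open>{v}\<close>.\<close>
  have "elementary_collapse (deletion K v \<union> {{v}, {v, w}}) (deletion K v)"
    unfolding elementary_collapse_def
    by (rule exI[of _ "{v}"], rule exI[of _ "{v, w}"]) (use vw in \<open>auto simp: deletion_def\<close>)
  with c show ?thesis by (rule rtranclp.rtrancl_into_rtrancl)
qed

lemma complex_deletion: "complex K \<Longrightarrow> complex (deletion K v)"
  unfolding complex_def deletion_def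
  by (auto intro: finite_subset[of _ "\<Union>K"])

lemma complex_link: "complex K \<Longrightarrow> {v} \<in> K \<Longrightarrow> complex (link K v)"
  unfolding complex_def link_def
  by (auto intro: finite_subset[of _ "\<Union>K"])
    (meson insert_mono)

text \<open>The link of a vertex \<open>u\<close> other than the apex is itself a cone with apex
  \<open>v\<close>, hence collapsible by induction on the number of vertices, so \<open>u\<close>
  can be deleted; the deletion is again a cone.\<close>

lemma collapses_cone:
  assumes "complex K" "\<And>\<sigma>. \<sigma> \<in> K \<Longrightarrow> insert v \<sigma> \<in> K"
  shows "collapses K {{}, {v}}"
  using assms
proof (induction "card (\<Union>K)" arbitrary: K rule: less_induct)
  case less
  note K = less.prems
  have v: "{v} \<in> K" using K unfolding complex_def by blast
  show ?case
  proof (cases "\<Union>K \<subseteq> {v}")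
    case True
    have "K = {{}, {v}}" using True v K(1) unfolding complex_def by blast
    then show ?thesis by simp
  next
    case False
    then obtain u where u: "u \<in> \<Union>K" "u \<noteq> v" by blast
    have "{u} \<in> K" using u K(1) unfolding complex_def by (metis Union_iff bot.extremum insert_subset)
    have fin: "finite (\<Union>K)" using K(1) unfolding complex_def by blast
    have "card (\<Union>(deletion K u)) < card (\<Union>K)" "card (\<Union>(link K u)) < card (\<Union>K)"
      by (intro psubset_card_mono fin; use u in \<open>auto simp: deletion_def link_def\<close>)+
    note lt = this
    have "collapses (link K u) {{}, {v}}"
      using K u by (intro less.hyps[OF lt(2)] complex_link \<open>{u} \<in> K\<close>)
        (auto simp: link_def insert_commute[of u v])
    then have "collapses K (deletion K u)" by (rule collapses_link)
    also have "collapses (deletion K u) {{}, {v}}"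
      using K u by (intro less.hyps[OF lt(1)] complex_deletion) (auto simp: deletion_def)
    finally show ?thesis .
  qed
qed

lemma elementary_collapse_image:
  assumes "inj_on h (\<Union>K)" "elementary_collapse K L"
  shows "elementary_collapse (image h ` K) (image h ` L)"
proof -
  obtain \<sigma> \<tau> where s: "\<sigma> \<in> K" "\<tau> \<in> K" "\<sigma> \<noteq> {}" "\<sigma> \<subset> \<tau>" "card \<tau> = Suc (card \<sigma>)"
    and m: "\<And>\<rho>. \<rho> \<in> K \<Longrightarrow> \<sigma> \<subset> \<rho> \<Longrightarrow> \<rho> = \<tau>" and L: "L = K - {\<sigma>, \<tau>}"
    using assms(2) unfolding elementary_collapse_def by blast
  have sub: "h ` \<rho> \<subseteq> h ` \<rho>' \<longleftrightarrow> \<rho> \<subseteq> \<rho>'" if "\<rho> \<in> K" "\<rho>' \<in> K" for \<rho> \<rho>'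
    using assms(1) that by (intro inj_on_image_subset_iff) auto
  then have eq: "h ` \<rho> = h ` \<rho>' \<longleftrightarrow> \<rho> = \<rho>'" if "\<rho> \<in> K" "\<rho>' \<in> K" for \<rho> \<rho>'
    using that by (metis set_eq_subset)
  have card: "card (h ` \<rho>) = card \<rho>" if "\<rho> \<in> K" for \<rho>
    using assms(1) that by (intro card_image) (meson Sup_upper inj_on_subset)
  show ?thesis
    unfolding elementary_collapse_def
  proof (rule exI[of _ "h ` \<sigma>"], rule exI[of _ "h ` \<tau>"], intro conjI ballI impI)
    show "h ` \<sigma> \<subset> h ` \<tau>" using s sub[OF s(1,2)] eq[OF s(1,2)] by (simp add: psubset_eq)
    show "card (h ` \<tau>) = Suc (card (h ` \<sigma>))" using card[OF s(1)] card[OF s(2)] s(5) by simp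
    show "h ` \<sigma> \<noteq> {}" using s(3) by simp
    fix \<rho>' assume "\<rho>' \<in> image h ` K" and less: "h ` \<sigma> \<subset> \<rho>'"
    then obtain \<rho> where \<rho>: "\<rho> \<in> K" "\<rho>' = h ` \<rho>" by blast
    have "\<sigma> \<subset> \<rho>" using less sub[OF s(1) \<rho>(1)] \<rho>(2) by (auto simp only: psubset_eq)
    then show "\<rho>' = h ` \<tau>" using m[OF \<rho>(1)] \<rho>(2) by simp
  next
    show "image h ` L = image h ` K - {h ` \<sigma>, h ` \<tau>}"
      unfolding L using eq s(1,2) by (auto simp only: image_iff)
  qed (use s in simp_all)
qed

lemma elementary_collapse_subset: "elementary_collapse K L \<Longrightarrow> L \<subseteq> K"
  unfolding elementary_collapse_def by blast

lemma collapses_image: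
  assumes "collapses K L" "inj_on h (\<Union>K)"
  shows "collapses (image h ` K) (image h ` L)"
proof -
  have "L \<subseteq> K \<and> collapses (image h ` K) (image h ` L)"
    using assms(1)
  proof induction
    case (step L L')
    then have "inj_on h (\<Union>L)" using assms(2) by (meson Union_mono inj_on_subset)
    with step show ?case
      by (meson elementary_collapse_image elementary_collapse_subset order_trans
          rtranclp.rtrancl_into_rtrancl)
  qed simp
  then show ?thesis ..
qed

text \<open>Since no face contains two vertices of \<open>A\<close>, deleting one of them leaves the
  links of the others unchanged, and the deletions can be made one after another. At a vertex with
  void link there is nothing to delete.\<close>

lemma collapses_delete_vertices:
  assumes "finite A"
    and "\<And>v. v \<in> A \<Longrightarrow> link K v = {} \<or> (\<exists>w. collapses (link K v) {{}, {w}})"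
    and "\<And>\<sigma> v w. \<sigma> \<in> K \<Longrightarrow> v \<in> \<sigma> \<Longrightarrow> w \<in> \<sigma> \<Longrightarrow> v \<in> A \<Longrightarrow> w \<in> A \<Longrightarrow> v = w"
  shows "collapses K {\<sigma> \<in> K. \<sigma> \<inter> A = {}}"
  using assms
proof (induction A)
  case empty
  then show ?case by simp
next
  case (insert v A)
  let ?L = "{\<sigma> \<in> K. \<sigma> \<inter> A = {}}"
  have "collapses K ?L" using insert.prems by (intro insert.IH) blast+
  moreover have "link ?L v = link K v"
    using insert.prems(2) insert.hyps by (fastforce simp: link_def)
  moreover have "deletion ?L v = {\<sigma> \<in> K. \<sigma> \<inter> insert v A = {}}"
    by (auto simp: deletion_def)
  moreover have "deletion ?L v = ?L" if "link ?L v = {}"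
    using deletion_Un_link[of ?L v] that by simp
  ultimately show ?case
    using insert.prems(1)[of v] collapses_link[of ?L v]
    by (metis (no_types, lifting) insertI1 rtranclp_trans)
qed

section \<open>Complexes that collapse after the removal of top faces\<close>

text \<open>Here \<open>k\<close> is the number of vertices of the top faces, so the spheres have dimension \<open>k - 1\<close>;
  for \<open>k = 0\<close> the complex is \<open>{{}}\<close>.\<close>

definition spherical :: "nat \<Rightarrow> 'v set set \<Rightarrow> bool" where
  "spherical k K \<longleftrightarrow> (\<exists>T. T \<subseteq> K \<and> T \<noteq> {} \<and>
     (\<forall>\<tau>\<in>T. card \<tau> = k \<and> (\<forall>\<rho>\<in>K. \<tau> \<subseteq> \<rho> \<longrightarrow> \<rho> = \<tau>)) \<and>
     (k = 0 \<and> K = T \<or> k > 0 \<and> (\<exists>w. collapses (K - T) {{}, {w}})))"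

lemma spherical_image:
  assumes "spherical k K" "inj_on h (\<Union>K)"
  shows "spherical k (image h ` K)"
proof -
  obtain T where T: "T \<subseteq> K" "T \<noteq> {}"
    and *: "\<forall>\<tau>\<in>T. card \<tau> = k \<and> (\<forall>\<rho>\<in>K. \<tau> \<subseteq> \<rho> \<longrightarrow> \<rho> = \<tau>)"
    and col: "k = 0 \<and> K = T \<or> k > 0 \<and> (\<exists>w. collapses (K - T) {{}, {w}})"
    using assms(1) unfolding spherical_def by (elim exE conjE)
  have T3: "card \<tau> = k" if "\<tau> \<in> T" for \<tau> using * that by simp
  have max: "\<rho> = \<tau>" if "\<tau> \<in> T" "\<rho> \<in> K" "\<tau> \<subseteq> \<rho>" for \<tau> \<rho> using * that by simp
  have sub: "h ` \<rho> \<subseteq> h ` \<rho>' \<longleftrightarrow> \<rho> \<subseteq> \<rho>'" if "\<rho> \<in> K" "\<rho>' \<in> K" for \<rho> \<rho>'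
    using assms(2) that by (intro inj_on_image_subset_iff) auto
  have "inj_on (image h) K"
    using sub by (intro inj_onI) (metis set_eq_subset)
  then have eq: "image h ` K - image h ` T = image h ` (K - T)"
    using T(1) by (simp add: inj_on_image_set_diff)
  show ?thesis
    unfolding spherical_def
  proof (intro exI[of _ "image h ` T"] conjI ballI impI)
    fix \<tau>' assume "\<tau>' \<in> image h ` T"
    then obtain \<tau> where \<tau>: "\<tau> \<in> T" "\<tau>' = h ` \<tau>" by blast
    have "inj_on h \<tau>" using \<tau> T(1) assms(2) by (meson Sup_upper inj_on_subset subsetD)
    then show "card \<tau>' = k" using \<tau> T3 by (simp add: card_image)
    fix \<rho>' assume "\<rho>' \<in> image h ` K" "\<tau>' \<subseteq> \<rho>'"
    then obtain \<rho> where \<rho>: "\<rho> \<in> K" "\<rho>' = h ` \<rho>" by blast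
    have "\<tau> \<subseteq> \<rho>" using sub[of \<tau> \<rho>] \<rho> \<tau> T(1) \<open>\<tau>' \<subseteq> \<rho>'\<close> by auto
    then show "\<rho>' = \<tau>'" using max[OF \<tau>(1) \<rho>(1)] \<rho>(2) \<tau>(2) by simp
  next
    show "k = 0 \<and> image h ` K = image h ` T \<or>
      k > 0 \<and> (\<exists>w. collapses (image h ` K - image h ` T) {{}, {w}})"
      using col
    proof (elim disjE conjE exE)
      fix w assume "k > 0" "collapses (K - T) {{}, {w}}"
      moreover have "inj_on h (\<Union>(K - T))" using assms(2) by (rule inj_on_subset) blast
      ultimately have "collapses (image h ` (K - T)) (image h ` {{}, {w}})"
        by (intro collapses_image)
      then show ?thesis using \<open>k > 0\<close> eq by auto
    qed simp
  qed (use T in auto)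
qed

text \<open>Removing the top faces supplied by the links of the vertices in \<open>A\<close> makes these links
  collapsible, so that the vertices themselves can be collapsed away.\<close>

lemma spherical_step:
  assumes K: "complex K" and A: "finite A" "A \<noteq> {}"
    and indep: "\<And>\<sigma> v w. \<sigma> \<in> K \<Longrightarrow> v \<in> \<sigma> \<Longrightarrow> w \<in> \<sigma> \<Longrightarrow> v \<in> A \<Longrightarrow> w \<in> A \<Longrightarrow> v = w"
    and link: "\<And>v. v \<in> A \<Longrightarrow> spherical k (link K v)"
    and rest: "collapses {\<sigma> \<in> K. \<sigma> \<inter> A = {}} {{}, {w}}"
  shows "spherical (Suc k) K"
proof -
  have "\<exists>T. \<forall>v\<in>A. T v \<subseteq> link K v \<and> T v \<noteq> {} \<and>
     (\<forall>\<tau>\<in>T v. card \<tau> = k \<and> (\<forall>\<rho>\<in>link K v. \<tau> \<subseteq> \<rho> \<longrightarrow> \<rho> = \<tau>)) \<and>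
     (k = 0 \<and> link K v = T v \<or> k > 0 \<and> (\<exists>w. collapses (link K v - T v) {{}, {w}}))"
    using link unfolding spherical_def by (intro bchoice) simp
  then obtain T where *: "\<forall>v\<in>A. T v \<subseteq> link K v \<and> T v \<noteq> {} \<and>
     (\<forall>\<tau>\<in>T v. card \<tau> = k \<and> (\<forall>\<rho>\<in>link K v. \<tau> \<subseteq> \<rho> \<longrightarrow> \<rho> = \<tau>)) \<and>
     (k = 0 \<and> link K v = T v \<or> k > 0 \<and> (\<exists>w. collapses (link K v - T v) {{}, {w}}))" ..
  have T: "T v \<subseteq> link K v" "T v \<noteq> {}" "\<tau> \<in> T v \<Longrightarrow> card \<tau> = k" if "v \<in> A" for v \<tau>
    using * that by simp_all
  have max: "\<rho> = \<tau>" if "v \<in> A" "\<tau> \<in> T v" "\<rho> \<in> link K v" "\<tau> \<subseteq> \<rho>" for v \<tau> \<rho>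
    using * that by simp
  have col: "k = 0 \<and> link K v = T v \<or> k > 0 \<and> (\<exists>w. collapses (link K v - T v) {{}, {w}})"
    if "v \<in> A" for v
    using * that by simp
  \<comment> \<open>With \<open>v\<close> added, a maximal face of the link of \<open>v\<close> is a
    maximal face of \<open>K\<close>. No face contains two elements of \<open>A\<close>, so each
    removed face is charged to a single link.\<close>
  define TT where "TT = (\<Union>v\<in>A. insert v ` T v)"
  have sub: "TT \<subseteq> K" using T(1) by (auto simp: TT_def link_def)
  have lk: "link (K - TT) v = link K v - T v" if "v \<in> A" for v
  proof -
    have "\<sigma> \<in> T v" if \<sigma>: "v \<notin> \<sigma>" "insert v \<sigma> \<in> TT" for \<sigma>
    proof -
      obtain u \<tau> where u: "u \<in> A" "\<tau> \<in> T u" "insert v \<sigma> = insert u \<tau>"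
        using \<sigma>(2) unfolding TT_def by blast
      have "insert v \<sigma> \<in> K" using \<sigma>(2) sub by (rule subsetD[rotated])
      moreover have "u \<in> insert v \<sigma>" unfolding u(3) by simp
      ultimately have "v = u" using indep[of "insert v \<sigma>" v u] u(1) \<open>v \<in> A\<close> by simp
      moreover have "u \<notin> \<tau>" using T(1)[OF u(1)] u(2) by (auto simp: link_def)
      ultimately show ?thesis using u(2,3) \<sigma>(1) by (metis insert_ident)
    qed
    moreover have "insert v \<sigma> \<in> TT" if "\<sigma> \<in> T v" for \<sigma>
      using that \<open>v \<in> A\<close> unfolding TT_def by blast
    ultimately show ?thesis unfolding link_def by blast
  qed
  have "collapses (K - TT) {\<sigma> \<in> K - TT. \<sigma> \<inter> A = {}}"
  proof (rule collapses_delete_vertices[OF A(1)])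
    fix v assume "v \<in> A"
    then show "link (K - TT) v = {} \<or> (\<exists>w. collapses (link (K - TT) v) {{}, {w}})"
      using col[of v] lk[of v] by auto
  next
    fix \<sigma> v w assume "\<sigma> \<in> K - TT" "v \<in> \<sigma>" "w \<in> \<sigma>" "v \<in> A" "w \<in> A"
    then show "v = w" using indep[of \<sigma>] by simp
  qed
  \<comment> \<open>Every removed face contains an element of \<open>A\<close>, so the part off
    \<open>A\<close> is untouched.\<close>
  moreover have "{\<sigma> \<in> K - TT. \<sigma> \<inter> A = {}} = {\<sigma> \<in> K. \<sigma> \<inter> A = {}}"
    by (auto simp: TT_def)
  ultimately have c: "collapses (K - TT) {{}, {w}}" using rest by simp
  have max': "\<rho> = \<tau>" if \<tau>: "\<tau> \<in> TT" and that: "\<rho> \<in> K" "\<tau> \<subseteq> \<rho>" for \<tau> \<rho>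
  proof -
    obtain v \<tau>' where v: "v \<in> A" "\<tau>' \<in> T v" "\<tau> = insert v \<tau>'"
      using \<tau> unfolding TT_def by blast
    have "v \<notin> \<tau>'" using T(1)[OF v(1)] v(2) by (auto simp: link_def)
    have "v \<in> \<rho>" using v(3) that(2) by blast
    then have "\<rho> - {v} \<in> link K v" using that(1) by (simp add: link_def insert_absorb)
    moreover have "\<tau>' \<subseteq> \<rho> - {v}" using v(3) that(2) \<open>v \<notin> \<tau>'\<close> by blast
    ultimately have "\<rho> - {v} = \<tau>'" using max[OF v(1,2)] by simp
    then show ?thesis using v(3) \<open>v \<in> \<rho>\<close> by blast
  qed
  have "card \<tau> = Suc k" if \<tau>: "\<tau> \<in> TT" for \<tau>
  proof -
    obtain v \<tau>' where v: "v \<in> A" "\<tau>' \<in> T v" "\<tau> = insert v \<tau>'"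
      using \<tau> unfolding TT_def by blast
    have "v \<notin> \<tau>'" using T(1)[OF v(1)] v(2) by (auto simp: link_def)
    moreover have "finite \<tau>" using complex_finite_face[OF K] \<tau> sub by blast
    ultimately show ?thesis using v T(3)[OF v(1,2)] by simp
  qed
  moreover have "TT \<noteq> {}" using A T(2) by (auto simp: TT_def)
  ultimately show ?thesis unfolding spherical_def using sub max' c
    by (intro exI[of _ TT]) (simp, metis)
qed

section \<open>Complexes of chains and closure operators\<close>

text \<open>\<open>order_complex\<close> is tied to \<open>proper_part\<close>, whose meaning
  changes when elements are deleted. Here the vertex set is a parameter that can be shrunk
  freely.\<close>

definition chain_complex :: "'a set \<Rightarrow> ('a \<Rightarrow> 'a \<Rightarrow> bool) \<Rightarrow> 'a set set" where
  "chain_complex S le = {\<sigma>. finite \<sigma> \<and> \<sigma> \<subseteq> S \<and> (\<forall>x\<in>\<sigma>. \<forall>y\<in>\<sigma>. le x y \<or> le y x)}"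

lemma order_complex_eq: "order_complex A le = chain_complex (proper_part A le) le"
  unfolding order_complex_def chain_complex_def Complete_Partial_Order.chain_def by simp

lemma complex_chain_complex: "finite S \<Longrightarrow> complex (chain_complex S le)"
  unfolding complex_def chain_complex_def
  by (auto intro: finite_subset[of _ S] finite_subset)

lemma chain_complex_cone:
  assumes "finite S" "c \<in> S" "\<And>x. x \<in> S \<Longrightarrow> le c x \<or> le x c"
  shows "collapses (chain_complex S le) {{}, {c}}"
  using assms by (intro collapses_cone complex_chain_complex) (auto simp: chain_complex_def)

text \<open>The closure operator argument, carried out with collapses. When \<open>q\<close> is
  minimal in \<open>R\<close>, whatever lies strictly below \<open>q\<close> is outside
  \<open>R\<close> and hence below \<open>f q\<close>, while whatever lies above \<open>q\<close> is
  above \<open>f q\<close>. So the link of \<open>q\<close> is a cone with apex \<open>f q\<close>,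
  and \<open>q\<close> can be deleted.\<close>

lemma chain_complex_dismantle:
  fixes rank :: "'a \<Rightarrow> nat"
  assumes "finite S" "R \<subseteq> S"
    and refl: "\<And>p. p \<in> S \<Longrightarrow> le p p"
    and trans: "\<And>p q r. p \<in> S \<Longrightarrow> q \<in> S \<Longrightarrow> r \<in> S \<Longrightarrow> le p q \<Longrightarrow> le q r \<Longrightarrow> le p r"
    and rank: "\<And>p q. p \<in> S \<Longrightarrow> q \<in> S \<Longrightarrow> le p q \<Longrightarrow> p \<noteq> q \<Longrightarrow> rank q < rank p"
    and f: "\<And>q. q \<in> R \<Longrightarrow> f q \<in> S - R" "\<And>q. q \<in> R \<Longrightarrow> le (f q) q"
      "\<And>p q. q \<in> R \<Longrightarrow> p \<in> S - R \<Longrightarrow> le p q \<Longrightarrow> le p (f q)"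
  shows "collapses (chain_complex S le) (chain_complex (S - R) le)"
  using assms
proof (induction "card R" arbitrary: S R)
  case 0
  have "R = {}" using finite_subset[OF 0(3,2)] 0(1) by simp
  then show ?case by simp
next
  case (Suc k)
  have fin: "finite R" using Suc.prems(1,2) by (rule finite_subset[rotated])
  have ne: "R \<noteq> {}" using Suc.hyps(2) by auto
  \<comment> \<open>The rank decreases along the order, so an element of greatest rank is minimal in
    \<open>R\<close>.\<close>
  have "Max (rank ` R) \<in> rank ` R" using fin ne by (intro Max_in) auto
  then obtain q where "q \<in> R" "Max (rank ` R) = rank q" by blast
  then have q: "q \<in> R" "\<And>p. p \<in> R \<Longrightarrow> rank p \<le> rank q"
    using fin by (simp, metis Max_ge finite_imageI image_eqI)
  then have qS: "q \<in> S" using Suc.prems(2) by blast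
  have fq: "f q \<in> S" "f q \<notin> R" "le (f q) q" using Suc.prems(6,7) q by auto
  have cmp: "le (f q) p \<or> le p (f q)" if "p \<in> S" "p \<noteq> q" "le p q \<or> le q p" for p
  proof (cases "le q p")
    case True
    then show ?thesis using Suc.prems(4)[OF fq(1) qS that(1)] fq by blast
  next
    case False
    then have "le p q" using that by blast
    then have "p \<notin> R" using Suc.prems(5)[OF that(1) qS] that(2) q(2) by fastforce
    then show ?thesis using Suc.prems(8)[OF q(1)] that \<open>le p q\<close> by blast
  qed
  have comp: "complex (chain_complex S le)" by (intro complex_chain_complex Suc.prems)
  have "collapses (link (chain_complex S le) q) {{}, {f q}}"
  proof (rule collapses_cone)
    show "complex (link (chain_complex S le) q)"
      using qS Suc.prems(3) by (intro complex_link comp) (auto simp: chain_complex_def)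
    fix \<sigma> assume \<sigma>: "\<sigma> \<in> link (chain_complex S le) q"
    then have "p \<in> S" "p \<noteq> q" "le p q \<or> le q p" if "p \<in> \<sigma>" for p
      using that by (auto simp: link_def chain_complex_def)
    then have "le (f q) p \<or> le p (f q)" if "p \<in> \<sigma>" for p
      using that cmp by blast
    then show "insert (f q) \<sigma> \<in> link (chain_complex S le) q"
      using \<sigma> fq q(1) Suc.prems(3)[OF fq(1)] by (auto simp: link_def chain_complex_def)
  qed
  then have "collapses (chain_complex S le) (deletion (chain_complex S le) q)"
    by (rule collapses_link)
  also have "deletion (chain_complex S le) q = chain_complex (S - {q}) le"
    by (auto simp: deletion_def chain_complex_def)
  also have "collapses \<dots> (chain_complex (S - {q} - (R - {q})) le)"
  proof (rule Suc.hyps(1))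
    show "k = card (R - {q})" using Suc.hyps(2) q fin by simp
    show "le p r" if "p \<in> S - {q}" "r' \<in> S - {q}" "r \<in> S - {q}" "le p r'" "le r' r" for p r' r
      using that Suc.prems(4) by (meson DiffD1)
    show "le p (f r)" if "r \<in> R - {q}" "p \<in> S - {q} - (R - {q})" "le p r" for p r
      using that Suc.prems(8)[of r p] by blast
    show "f r \<in> S - {q} - (R - {q})" if "r \<in> R - {q}" for r
      using that Suc.prems(6)[of r] q(1) by blast
  qed (use Suc.prems(1,2,3,5,7) in auto)
  also have "S - {q} - (R - {q}) = S - R" using q by blast
  finally show ?case .
qed

subsection \<open>Pointed multiset partitions\<close>

text \<open>\<open>C\<close> collects the blocks of \<open>M\<close> into groups, and
  \<open>N\<close> consists of the merged groups. Empty groups are permitted; they would produce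
  empty blocks of \<open>N\<close>, so there are none as soon as \<open>N\<close> has no empty
  block.\<close>

definition mrefines :: "'a multiset multiset \<Rightarrow> 'a multiset multiset \<Rightarrow> bool" where
  "mrefines M N \<longleftrightarrow> (\<exists>C. \<Sum>\<^sub># C = M \<and> image_mset sum_mset C = N)"

text \<open>A pointed partition \<open>(B, M)\<close> of \<open>Y\<close> stands for the partition of \<open>Y\<close> plus one
  distinguished letter in which \<open>B\<close> is the rest of the block of the distinguished letter.\<close>

definition pparts :: "'a multiset \<Rightarrow> ('a multiset \<times> 'a multiset multiset) set" where
  "pparts Y = {(B, M). B + \<Sum>\<^sub># M = Y \<and> {#} \<notin># M}"

text \<open>\<open>D\<close> holds the blocks absorbed by the block of the distinguished letter; the
  other blocks \<open>M\<close> are merged among themselves. Larger elements are coarser.\<close>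

definition ple :: "'a multiset \<times> 'a multiset multiset \<Rightarrow> 'a multiset \<times> 'a multiset multiset \<Rightarrow> bool" where
  "ple p q \<longleftrightarrow> (\<exists>D M. snd p = D + M \<and> fst q = fst p + \<Sum>\<^sub># D \<and> mrefines M (snd q))"

definition singles :: "'a multiset \<Rightarrow> 'a multiset multiset" where
  "singles Y = image_mset (\<lambda>y. {#y#}) Y"

lemma sum_mset_sum_mset: "\<Sum>\<^sub># (\<Sum>\<^sub># C) = \<Sum>\<^sub># (image_mset sum_mset C)"
  by (induction C) simp_all

lemma image_mset_sum_mset: "image_mset f (\<Sum>\<^sub># C) = \<Sum>\<^sub># (image_mset (image_mset f) C)"
  by (induction C) simp_all

text \<open>Composing two refinements means grouping the groups: a grouping of merged blocks has to
  be pulled back to the groups from which they came.\<close>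

lemma image_mset_eq_sum_msetD:
  "image_mset f C = \<Sum>\<^sub># D \<Longrightarrow> \<exists>E. \<Sum>\<^sub># E = C \<and> image_mset (image_mset f) E = D"
proof (induction D arbitrary: C)
  case empty
  then show ?case by (intro exI[of _ "{#}"]) simp
next
  case (add x D)
  then obtain C1 C2 where C: "C = C1 + C2" "x = image_mset f C1" "\<Sum>\<^sub># D = image_mset f C2"
    using image_mset_eq_plusD[of f C x "\<Sum>\<^sub># D"] by auto
  obtain E where "\<Sum>\<^sub># E = C2" "image_mset (image_mset f) E = D" using add.IH C(3) by metis
  then show ?case using C by (intro exI[of _ "add_mset C1 E"]) simp
qed

lemma mrefines_refl: "mrefines M M"
  unfolding mrefines_def by (intro exI[of _ "image_mset (\<lambda>B. {#B#}) M"]) (simp add: multiset.map_comp comp_def)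

lemma mrefines_trans:
  assumes "mrefines M N" "mrefines N R" shows "mrefines M R"
proof -
  obtain C D where C: "\<Sum>\<^sub># C = M" "image_mset sum_mset C = \<Sum>\<^sub># D" and D: "image_mset sum_mset D = R"
    using assms unfolding mrefines_def by metis
  obtain E where E: "\<Sum>\<^sub># E = C" "image_mset (image_mset sum_mset) E = D"
    using image_mset_eq_sum_msetD[OF C(2)] by blast
  show ?thesis unfolding mrefines_def
  proof (intro exI conjI)
    show "\<Sum>\<^sub># (image_mset sum_mset E) = M" using E C by (simp flip: sum_mset_sum_mset)
    show "image_mset sum_mset (image_mset sum_mset E) = R"
      using E(2) D by (auto simp: multiset.map_comp comp_def sum_mset_sum_mset)
  qed
qed

lemma mrefines_union: "mrefines M N \<Longrightarrow> mrefines M' N' \<Longrightarrow> mrefines (M + M') (N + N')"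
  unfolding mrefines_def by (metis image_mset_union sum_mset.union)

lemma size_le_sum_size: "{#} \<notin># C \<Longrightarrow> size C \<le> size (\<Sum>\<^sub># C)"
proof (induction C)
  case (add c C)
  then have "size c > 0" by (auto simp: nonempty_has_size[symmetric])
  with add show ?case by (simp del: size_mset_sum_mset_conv)
qed simp

lemma size_eq_sum_size:
  assumes "{#} \<notin># C" "size (\<Sum>\<^sub># C) = size C" shows "image_mset sum_mset C = \<Sum>\<^sub># C"
  using assms
proof (induction C)
  case (add c C)
  have c: "size c > 0" and C: "size C \<le> size (\<Sum>\<^sub># C)"
    using add.prems size_le_sum_size[of C] by (auto simp: nonempty_has_size[symmetric])
  then have "size c = 1" "size (\<Sum>\<^sub># C) = size C"
    using add.prems(2) by (auto simp del: size_mset_sum_mset_conv)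
  moreover then obtain x where "c = {#x#}" using size_1_singleton_mset by metis
  ultimately show ?case using add by simp
qed simp

text \<open>All groups are nonempty when \<open>N\<close> has no empty block, so there are at most
  as many groups as blocks of \<open>M\<close>, and equality forces every group to be a single
  block.\<close>

lemma mrefines_size:
  assumes "mrefines M N" "{#} \<notin># N"
  shows "size N \<le> size M" "size N = size M \<Longrightarrow> M = N"
proof -
  obtain C where C: "\<Sum>\<^sub># C = M" "image_mset sum_mset C = N" using assms unfolding mrefines_def by blast
  have e: "{#} \<notin># C"
  proof
    assume "{#} \<in># C"
    then have "sum_mset {#} \<in># image_mset sum_mset C" by (simp only: set_image_mset image_eqI)
    then show False using C(2) assms(2) by simp
  qed
  show "size N \<le> size M" using size_le_sum_size[OF e] C by (metis size_image_mset)
  show "M = N" if "size N = size M" using size_eq_sum_size[OF e] C that by (metis size_image_mset)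
qed

lemma ple_refl: "ple p p"
  unfolding ple_def by - (rule exI[of _ "{#}"], rule exI[of _ "snd p"], simp add: mrefines_refl)

lemma ple_trans:
  assumes "ple p q" "ple q r" shows "ple p r"
proof -
  obtain D M where 1: "snd p = D + M" "fst q = fst p + \<Sum>\<^sub># D" "mrefines M (snd q)"
    using assms(1) unfolding ple_def by blast
  obtain E N where 2: "snd q = E + N" "fst r = fst q + \<Sum>\<^sub># E" "mrefines N (snd r)"
    using assms(2) unfolding ple_def by blast
  obtain C where C: "\<Sum>\<^sub># C = M" "image_mset sum_mset C = E + N" using 1(3) 2(1) unfolding mrefines_def by auto
  \<comment> \<open>\<open>C1\<close> are the groups whose merged block is absorbed in the second
    step; their original blocks join \<open>D\<close>.\<close>
  obtain C1 C2 where C12: "C = C1 + C2" "E = image_mset sum_mset C1" "N = image_mset sum_mset C2"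
    using image_mset_eq_plusD[OF C(2)] by blast
  have "mrefines (\<Sum>\<^sub># C2) N" using C12(3) unfolding mrefines_def by blast
  then have "mrefines (\<Sum>\<^sub># C2) (snd r)" using 2(3) by (rule mrefines_trans)
  then show ?thesis
    unfolding ple_def using 1 2 C12 C(1)
    by - (rule exI[of _ "D + \<Sum>\<^sub># C1"], rule exI[of _ "\<Sum>\<^sub># C2"], simp add: sum_mset_sum_mset add.assoc)
qed

text \<open>Serves both as antisymmetry and as the rank for dismantling: each absorbed block and
  each proper merger lowers the number of undistinguished blocks.\<close>

lemma ple_size:
  assumes "ple p q" "q \<in> pparts Y"
  shows "size (snd q) \<le> size (snd p)" "size (snd q) = size (snd p) \<Longrightarrow> p = q"
proof -
  obtain D M where 1: "snd p = D + M" "fst q = fst p + \<Sum>\<^sub># D" "mrefines M (snd q)"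
    using assms(1) unfolding ple_def by blast
  have q: "{#} \<notin># snd q" using assms(2) by (auto simp: pparts_def)
  note s = mrefines_size[OF 1(3) q]
  show "size (snd q) \<le> size (snd p)" using s 1 by simp
  assume "size (snd q) = size (snd p)"
  then have "D = {#}" "M = snd q" using s 1 by auto
  then show "p = q" using 1 by (simp add: prod_eq_iff)
qed

lemma ple_rank: "ple p q \<Longrightarrow> q \<in> pparts Y \<Longrightarrow> p \<noteq> q \<Longrightarrow> size (snd q) < size (snd p)"
  using ple_size by (metis le_neq_implies_less)

lemma pparts_bot: "({#}, singles Y) \<in> pparts Y"
  by (auto simp: pparts_def singles_def)

lemma pparts_top: "(Y, {#}) \<in> pparts Y"
  by (simp add: pparts_def)

lemma mrefines_singles: "mrefines (singles (\<Sum>\<^sub># M)) M"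
  unfolding mrefines_def singles_def
  by (intro exI[of _ "image_mset (image_mset (\<lambda>y. {#y#})) M"])
    (simp add: image_mset_sum_mset multiset.map_comp comp_def)

lemma ple_bot: "p \<in> pparts Y \<Longrightarrow> ple ({#}, singles Y) p"
  unfolding ple_def
  by - (rule exI[of _ "singles (fst p)"], rule exI[of _ "singles (\<Sum>\<^sub># (snd p))"], auto simp: pparts_def mrefines_singles, auto simp: singles_def)

lemma ple_top: "p \<in> pparts Y \<Longrightarrow> ple p (Y, {#})"
  unfolding ple_def
  by - (rule exI[of _ "snd p"], rule exI[of _ "{#}"], auto simp: pparts_def mrefines_refl)

lemma proper_part_pparts:
  "proper_part (pparts Y) ple = pparts Y - {({#}, singles Y), (Y, {#})}"
proof -
  have "p = ({#}, singles Y)" if "p \<in> pparts Y" "\<forall>q\<in>pparts Y. ple p q" for p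
    using that ple_bot[OF that(1)] pparts_bot[of Y] ple_rank by (metis order_less_asym)
  moreover have "p = (Y, {#})" if "p \<in> pparts Y" "\<forall>q\<in>pparts Y. ple q p" for p
    using that ple_top[OF that(1)] pparts_top[of Y] ple_rank by (metis order_less_asym)
  ultimately show ?thesis
    unfolding proper_part_def using ple_bot ple_top by blast
qed

lemma finite_bounded_multisets: "finite A \<Longrightarrow> finite {M. set_mset M \<subseteq> A \<and> size M \<le> n}"
proof (rule finite_subset[of _ "\<Union>m\<le>n. multisets_of_size A m"])
  show "{M. set_mset M \<subseteq> A \<and> size M \<le> n} \<subseteq> (\<Union>m\<le>n. multisets_of_size A m)"
    by (auto simp: multisets_of_size_def)
qed auto

lemma finite_pparts: "finite (pparts Y)"
proof -
  let ?F = "{B. set_mset B \<subseteq> set_mset Y \<and> size B \<le> size Y}"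
  have "pparts Y \<subseteq> ?F \<times> {M. set_mset M \<subseteq> ?F \<and> size M \<le> size Y}"
  proof (rule subsetI)
    fix p assume "p \<in> pparts Y"
    then have Y: "Y = fst p + \<Sum>\<^sub># (snd p)" and M: "{#} \<notin># snd p" by (auto simp: pparts_def)
    have "set_mset c \<subseteq> set_mset Y \<and> size c \<le> size Y" if "c \<in># snd p" for c
      using multi_member_split[OF that] Y by auto
    then have "set_mset (snd p) \<subseteq> ?F" by blast
    moreover have "size (snd p) \<le> size Y"
      using size_le_sum_size[OF M] Y by (simp del: size_mset_sum_mset_conv)
    moreover have "fst p \<in> ?F" using Y by simp
    ultimately show "p \<in> ?F \<times> {M. set_mset M \<subseteq> ?F \<and> size M \<le> size Y}"
      by (simp only: mem_Times_iff mem_Collect_eq simp_thms)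
  qed
  then show ?thesis by (rule finite_subset) (intro finite_cartesian_product finite_bounded_multisets finite_set_mset)
qed

section \<open>The atoms and the intervals above them\<close>

text \<open>Putting \<open>y\<close> into the block of the distinguished letter identifies the poset
  with one \<open>y\<close> less with the interval above the atom of \<open>y\<close>.\<close>

definition pshift :: "'a \<Rightarrow> 'a multiset \<times> 'a multiset multiset \<Rightarrow> 'a multiset \<times> 'a multiset multiset" where
  "pshift y p = (add_mset y (fst p), snd p)"

lemma inj_pshift: "inj (pshift y)"
  by (rule injI) (simp add: pshift_def prod_eq_iff)

lemma ple_pshift: "ple (pshift y p) (pshift y q) \<longleftrightarrow> ple p q"
  by (simp add: ple_def pshift_def)

lemma pshift_pparts: "y \<in># Y \<Longrightarrow> pshift y p \<in> pparts Y \<longleftrightarrow> p \<in> pparts (Y - {#y#})"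
  by (cases p) (auto simp: pshift_def pparts_def)

definition patom :: "'a multiset \<Rightarrow> 'a \<Rightarrow> 'a multiset \<times> 'a multiset multiset" where
  "patom Y y = pshift y ({#}, singles (Y - {#y#}))"

lemma patom_proper:
  assumes y: "y \<in># Y" and size: "size Y \<ge> 2"
  shows "patom Y y \<in> proper_part (pparts Y) ple"
proof -
  have "size (Y - {#y#}) \<noteq> 0" using assms by (simp add: size_Diff_singleton)
  then have "Y - {#y#} \<noteq> {#}" by (simp del: size_Diff_singleton_if)
  then show ?thesis
    using y by (simp add: proper_part_pparts patom_def pshift_pparts pparts_bot)
      (simp add: pshift_def singles_def)
qed

lemma ple_patomD:
  assumes "ple (patom Y y) p"
  shows "\<exists>q. p = pshift y q"
proof -
  obtain D where "fst p = add_mset y (\<Sum>\<^sub># D)"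
    using assms by (auto simp: ple_def patom_def pshift_def)
  then show ?thesis by (intro exI[of _ "(\<Sum>\<^sub># D, snd p)"]) (simp add: pshift_def prod_eq_iff)
qed

text \<open>Within the proper part, only elements above the atom are comparable to it, and in all of
  these the distinguished block contains \<open>y\<close>. Taking out that \<open>y\<close> sends
  the atom to the bottom of the smaller poset and the top to the top, so the chains through the atom
  correspond to chains of the smaller proper part.\<close>

lemma link_patom:
  assumes y: "y \<in># Y" and size: "size Y \<ge> 2"
  shows "link (order_complex (pparts Y) ple) (patom Y y) =
    image (pshift y) ` order_complex (pparts (Y - {#y#})) ple"
proof -
  let ?S = "proper_part (pparts Y) ple" and ?S' = "proper_part (pparts (Y - {#y#})) ple"
  let ?a = "patom Y y"
  obtain Y' where Y: "Y = add_mset y Y'" using y by (metis insert_DiffM)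
  have S: "p \<in> pshift y ` ?S'" if p: "p \<in> ?S" "p \<noteq> ?a" "ple ?a p \<or> ple p ?a" for p
  proof -
    have pp: "p \<in> pparts Y" "p \<noteq> ({#}, singles Y)" "p \<noteq> (Y, {#})"
      using p(1) by (simp_all add: proper_part_pparts)
    have "?a \<in> pparts Y" by (simp add: patom_def pshift_pparts y pparts_bot)
    have "size (snd p) < size Y"
      using ple_rank[OF ple_bot[OF pp(1)] pp(1)] pp(2) by (simp add: singles_def)
    \<comment> \<open>An element strictly below the atom would have more than
      \<open>size Y - 1\<close> and fewer than \<open>size Y\<close> undistinguished blocks.\<close>
    then have "\<not> ple p ?a"
      using ple_rank[OF _ \<open>?a \<in> pparts Y\<close> p(2)] Y by (force simp add: patom_def pshift_def singles_def)
    then obtain q where q: "p = pshift y q" using p(3) ple_patomD[of Y y p] by blast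
    then have "q \<in> pparts (Y - {#y#})" using pp(1) pshift_pparts[OF y, of q] by simp
    moreover have "q \<noteq> ({#}, singles (Y - {#y#}))" using p(2) q by (auto simp: patom_def)
    moreover have "q \<noteq> (Y - {#y#}, {#})" using q pp(3) y by (auto simp: pshift_def)
    ultimately show ?thesis using q by (simp add: proper_part_pparts)
  qed
  have S': "pshift y q \<in> ?S \<and> pshift y q \<noteq> ?a \<and> ple ?a (pshift y q)" if q: "q \<in> ?S'" for q
  proof -
    have qq: "q \<in> pparts (Y - {#y#})" "q \<noteq> ({#}, singles (Y - {#y#}))" "q \<noteq> (Y - {#y#}, {#})"
      using q by (simp_all add: proper_part_pparts)
    have "pshift y q \<noteq> (Y, {#})" using qq(3) y by (auto simp: pshift_def prod_eq_iff)
    moreover have "pshift y q \<noteq> ({#}, singles Y)" by (simp add: pshift_def)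
    moreover have "pshift y q \<noteq> ?a" using qq(2) inj_pshift by (metis injD patom_def)
    moreover have "ple ?a (pshift y q)" unfolding patom_def ple_pshift by (rule ple_bot[OF qq(1)])
    ultimately show ?thesis using qq(1) y by (simp add: proper_part_pparts pshift_pparts)
  qed
  have a: "?a \<in> ?S"
    using patom_proper[OF assms] .
  show ?thesis
  proof (intro set_eqI iffI)
    fix \<sigma> assume "\<sigma> \<in> link (order_complex (pparts Y) ple) ?a"
    then have \<sigma>: "finite \<sigma>" "?a \<notin> \<sigma>" "\<sigma> \<subseteq> ?S" "\<And>p. p \<in> \<sigma> \<Longrightarrow> ple ?a p \<or> ple p ?a"
      "\<And>p q. p \<in> \<sigma> \<Longrightarrow> q \<in> \<sigma> \<Longrightarrow> ple p q \<or> ple q p"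
      by (auto simp: link_def order_complex_eq chain_complex_def)
    have "\<sigma> \<subseteq> pshift y ` ?S'"
    proof
      fix p assume "p \<in> \<sigma>"
      with \<sigma> show "p \<in> pshift y ` ?S'" by (intro S) blast+
    qed
    then obtain \<sigma>' where \<sigma>': "\<sigma>' \<subseteq> ?S'" "\<sigma> = pshift y ` \<sigma>'" by (auto simp: subset_image_iff)
    have "inj_on (pshift y) \<sigma>'" by (rule inj_on_subset[OF inj_pshift]) simp
    then have "finite \<sigma>'" using \<sigma>(1) \<sigma>'(2) by (simp add: finite_image_iff)
    moreover have "ple p q \<or> ple q p" if "p \<in> \<sigma>'" "q \<in> \<sigma>'" for p q
      using \<sigma>(5)[of "pshift y p" "pshift y q"] \<sigma>'(2) that by (simp add: ple_pshift)
    ultimately have "\<sigma>' \<in> chain_complex ?S' ple" using \<sigma>'(1) by (simp add: chain_complex_def)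
    then show "\<sigma> \<in> image (pshift y) ` order_complex (pparts (Y - {#y#})) ple"
      using \<sigma>' by (simp add: order_complex_eq)
  next
    fix \<sigma> assume "\<sigma> \<in> image (pshift y) ` order_complex (pparts (Y - {#y#})) ple"
    then obtain \<sigma>' where \<sigma>': "\<sigma>' \<in> chain_complex ?S' ple" "\<sigma> = pshift y ` \<sigma>'"
      by (auto simp: order_complex_eq)
    have p: "p \<in> ?S \<and> p \<noteq> ?a \<and> ple ?a p" if "p \<in> \<sigma>" for p
      using that \<sigma>' S' by (auto simp: chain_complex_def)
    have "\<forall>p\<in>\<sigma>'. \<forall>q\<in>\<sigma>'. ple p q \<or> ple q p" using \<sigma>'(1) by (simp add: chain_complex_def)
    then have "\<forall>p\<in>\<sigma>. \<forall>q\<in>\<sigma>. ple p q \<or> ple q p" unfolding \<sigma>'(2) by (simp add: ple_pshift)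
    moreover have "finite \<sigma>" using \<sigma>' by (simp add: chain_complex_def)
    moreover have "?a \<notin> \<sigma>" "\<sigma> \<subseteq> ?S" using p by blast+
    ultimately show "\<sigma> \<in> link (order_complex (pparts Y) ple) ?a"
      using p a ple_refl[of ?a] by (simp add: link_def order_complex_eq chain_complex_def)
  qed
qed

lemma proper_part_pparts_size:
  assumes "p \<in> proper_part (pparts Y) ple"
  shows "0 < size (snd p)" "size (snd p) < size Y"
proof -
  have p: "p \<in> pparts Y" "p \<noteq> ({#}, singles Y)" "p \<noteq> (Y, {#})"
    using assms by (simp_all add: proper_part_pparts)
  show "0 < size (snd p)" using ple_rank[OF ple_top[OF p(1)] pparts_top p(3)] by simp
  show "size (snd p) < size Y"
    using ple_rank[OF ple_bot[OF p(1)] p(1)] p(2) by (simp add: singles_def)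
qed

text \<open>Isolating the distinguished letter is a closure operator on what remains when the
  atoms are removed.\<close>

lemma collapses_without_patoms:
  fixes Y :: "'a multiset"
  assumes size: "size Y \<ge> 2"
  defines "S \<equiv> proper_part (pparts Y) ple - patom Y ` set_mset Y"
  shows "collapses (chain_complex S ple) {{}, {({#}, {#Y#})}}"
proof -
  define R where "R = {p \<in> S. fst p \<noteq> {#}}"
  define f where "f p = ({#} :: 'a multiset, add_mset (fst p) (snd p))" for p :: "'a multiset \<times> 'a multiset multiset"
  have S: "S \<subseteq> pparts Y" by (auto simp: S_def proper_part_def)
  have fin: "finite S" using finite_subset[OF S finite_pparts] .
  have isolated: "({#}, M) \<in> S" if "\<Sum>\<^sub># M = Y" "{#} \<notin># M" "M \<noteq> singles Y" for M
  proof -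
    have "({#}, M) \<notin> patom Y ` set_mset Y" by (auto simp: patom_def pshift_def)
    moreover have "Y \<noteq> {#}" using size by auto
    moreover have "({#}, M) \<in> pparts Y" using that(1,2) by (simp add: pparts_def)
    ultimately show ?thesis using that(3) by (simp add: S_def proper_part_pparts)
  qed
  have fR: "f q \<in> S - R" if "q \<in> R" for q
  proof -
    have q: "q \<in> pparts Y" "fst q \<noteq> {#}" "q \<in> S" using that S by (auto simp: R_def)
    \<comment> \<open>Isolating the letter leads to the bottom only if the letter had one companion
      and all other blocks were singletons, that is, from an atom, and the atoms have been
      removed.\<close>
    have "add_mset (fst q) (snd q) \<noteq> singles Y"
    proof
      assume eq: "add_mset (fst q) (snd q) = singles Y"
      then have "fst q \<in># singles Y" by (metis union_single_eq_member)
      then obtain y where y: "y \<in># Y" "fst q = {#y#}" by (auto simp: singles_def)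
      then have "singles Y = add_mset {#y#} (singles (Y - {#y#}))"
        by (metis image_mset_add_mset insert_DiffM singles_def)
      then have "q = patom Y y" using eq y by (simp add: patom_def pshift_def prod_eq_iff)
      then show False using q(3) y by (auto simp: S_def)
    qed
    then have "f q \<in> S" unfolding f_def using q(1,2) by (intro isolated) (auto simp: pparts_def)
    then show ?thesis by (simp add: R_def f_def)
  qed
  have fle: "ple (f q) q" for q
    unfolding ple_def f_def
    by - (rule exI[of _ "{#fst q#}"], rule exI[of _ "snd q"], simp add: mrefines_refl)
  \<comment> \<open>In \<open>p\<close> the letter is isolated, so the blocks absorbed on the way to
    \<open>q\<close> merge exactly to the block that \<open>f q\<close> splits off.\<close>
  have fR': "ple p (f q)" if "q \<in> R" "p \<in> S - R" and le: "ple p q" for p q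
  proof -
    have p: "fst p = {#}" using that(2) by (simp add: R_def)
    obtain D M where D: "snd p = D + M" "fst q = fst p + \<Sum>\<^sub># D" "mrefines M (snd q)"
      using le unfolding ple_def by blast
    have "mrefines D {#\<Sum>\<^sub># D#}" unfolding mrefines_def by (intro exI[of _ "{#D#}"]) simp
    then have "mrefines (D + M) ({#\<Sum>\<^sub># D#} + snd q)" using D(3) by (rule mrefines_union)
    then show ?thesis unfolding ple_def f_def
      using p D by - (rule exI[of _ "{#}"], rule exI[of _ "D + M"], simp)
  qed
  have rank: "size (snd q) < size (snd p)" if "p \<in> S" "q \<in> S" "ple p q" "p \<noteq> q" for p q
    using ple_rank[OF that(3) subsetD[OF S that(2)] that(4)] .
  have "R \<subseteq> S" by (auto simp: R_def)
  with fin have "collapses (chain_complex S ple) (chain_complex (S - R) ple)"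
    using ple_refl ple_trans rank fR fle fR'
    by (rule chain_complex_dismantle[where f = f and rank = "\<lambda>p. size (snd p)"])
  also have "collapses (chain_complex (S - R) ple) {{}, {({#}, {#Y#})}}"
  proof (rule chain_complex_cone)
    \<comment> \<open>The maximum of the isolated elements must differ from the bottom; this uses
      that \<open>Y\<close> has at least two letters.\<close>
    have "{#Y#} \<noteq> singles Y"
    proof
      assume "{#Y#} = singles Y"
      then have "size {#Y#} = size (singles Y)" by (rule arg_cong)
      then show False using size by (simp add: singles_def)
    qed
    moreover have "Y \<noteq> {#}" using size by auto
    ultimately show "({#}, {#Y#}) \<in> S - R" using isolated[of "{#Y#}"] by (simp add: R_def)
    fix p assume p: "p \<in> S - R"
    then have "\<Sum>\<^sub># (snd p) = Y" "fst p = {#}"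
      using subsetD[OF S, of p] by (auto simp: R_def pparts_def)
    moreover have "mrefines (snd p) {#\<Sum>\<^sub># (snd p)#}" unfolding mrefines_def by (intro exI[of _ "{#snd p#}"]) simp
    ultimately have "ple p ({#}, {#Y#})" unfolding ple_def by - (rule exI[of _ "{#}"], rule exI[of _ "snd p"], simp)
    then show "ple ({#}, {#Y#}) p \<or> ple p ({#}, {#Y#})" ..
  qed (use fin in simp)
  finally show ?thesis .
qed

text \<open>\<open>Y\<close> has \<open>k + 1\<close> letters and the distinguished letter comes on
  top, so maximal chains of the proper part have \<open>k\<close> elements. Multiplicities in
  \<open>Y\<close> are arbitrary: the step passes from \<open>Y\<close> to \<open>Y\<close> with one
  letter less, and equal letters share one atom.\<close>

theorem spherical_pparts:
  "size Y = Suc k \<Longrightarrow> spherical k (order_complex (pparts Y) ple)"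
proof (induction k arbitrary: Y)
  case 0
  then have "proper_part (pparts Y) ple = {}"
    using proper_part_pparts_size[of _ Y] by fastforce
  then have "order_complex (pparts Y) ple = {{}}"
    by (auto simp: order_complex_eq chain_complex_def)
  then show ?case by (auto simp: spherical_def)
next
  case (Suc k)
  let ?K = "order_complex (pparts Y) ple" and ?A = "patom Y ` set_mset Y"
  have size: "size Y \<ge> 2" using Suc.prems by simp
  show ?case
  proof (rule spherical_step)
    show "complex ?K"
      unfolding order_complex_eq
      by (intro complex_chain_complex finite_subset[OF _ finite_pparts]) (auto simp: proper_part_def)
    show "finite ?A" by simp
    show "?A \<noteq> {}" using size by auto
    show "collapses {\<sigma> \<in> ?K. \<sigma> \<inter> ?A = {}} {{}, {({#}, {#Y#})}}"
    proof -
      have "{\<sigma> \<in> ?K. \<sigma> \<inter> ?A = {}} = chain_complex (proper_part (pparts Y) ple - ?A) ple"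
        unfolding order_complex_eq chain_complex_def by blast
      then show ?thesis using collapses_without_patoms[OF size] by simp
    qed
  next
    fix v assume "v \<in> ?A"
    then obtain y where y: "y \<in># Y" "v = patom Y y" by blast
    have "size (Y - {#y#}) = Suc k" using Suc.prems y by (simp add: size_Diff_singleton)
    then have "spherical k (order_complex (pparts (Y - {#y#})) ple)" by (rule Suc.IH)
    then show "spherical k (link ?K v)"
      unfolding y(2) link_patom[OF y(1) size]
      by (rule spherical_image) (rule inj_on_subset[OF inj_pshift], simp)
  next
    fix \<sigma> v w assume *: "\<sigma> \<in> ?K" "v \<in> \<sigma>" "w \<in> \<sigma>" "v \<in> ?A" "w \<in> ?A"
    \<comment> \<open>All atoms have the same number of undistinguished blocks, so distinct ones are
      incomparable.\<close>
    have same: "p = q" if "ple p q" "p \<in> ?A" "q \<in> ?A" for p q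
    proof -
      have "q \<in> pparts Y" using that(3) by (auto simp: patom_def pshift_pparts pparts_bot)
      moreover have "size (snd p) = size (snd q)"
        using that(2,3) by (auto simp: patom_def pshift_def singles_def size_Diff_singleton)
      ultimately show ?thesis using ple_size(2)[OF that(1)] by metis
    qed
    have "ple v w \<or> ple w v" using * by (auto simp: order_complex_eq chain_complex_def)
    then show "v = w" using same * by metis
  qed
qed

section \<open>Orbits of set partitions\<close>

text \<open>Colours stand for the letters of the multiset: the colour classes are to be the sets
  permuted by the Young subgroup, so that the multiset of colours records a set up to the group
  action.\<close>

definition colours :: "('a \<Rightarrow> 'c) \<Rightarrow> 'a set \<Rightarrow> 'c multiset" where
  "colours col S = image_mset col (mset_set S)"

definition block_colours :: "('a \<Rightarrow> 'c) \<Rightarrow> 'a set set \<Rightarrow> 'c multiset multiset" where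
  "block_colours col P = image_mset (colours col) (mset_set P)"

lemma colours_Un: "finite S \<Longrightarrow> finite T \<Longrightarrow> S \<inter> T = {} \<Longrightarrow> colours col (S \<union> T) = colours col S + colours col T"
  by (simp add: colours_def mset_set_Union)

lemma colours_insert: "finite S \<Longrightarrow> x \<notin> S \<Longrightarrow> colours col (insert x S) = add_mset (col x) (colours col S)"
  by (simp add: colours_def)

lemma block_colours_Un: "finite P \<Longrightarrow> finite Q \<Longrightarrow> P \<inter> Q = {} \<Longrightarrow>
    block_colours col (P \<union> Q) = block_colours col P + block_colours col Q"
  by (simp add: block_colours_def mset_set_Union)

lemma block_colours_insert: "finite P \<Longrightarrow> B \<notin> P \<Longrightarrow>
    block_colours col (insert B P) = add_mset (colours col B) (block_colours col P)"
  by (simp add: block_colours_def)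

lemma colours_eq_empty: "finite S \<Longrightarrow> colours col S = {#} \<longleftrightarrow> S = {}"
  by (simp add: colours_def mset_set_empty_iff)

lemma colours_image:
  assumes "inj_on f S" "\<And>x. x \<in> S \<Longrightarrow> col (f x) = col x"
  shows "colours col (f ` S) = colours col S"
proof -
  have "colours col (f ` S) = image_mset (\<lambda>x. col (f x)) (mset_set S)"
    using image_mset_mset_set[OF assms(1)] by (simp add: colours_def multiset.map_comp comp_def flip: image_mset_mset_set[OF assms(1)])
  also have "\<dots> = colours col S"
  proof (cases "finite S")
    case True
    then show ?thesis unfolding colours_def using assms(2) by (intro image_mset_cong) simp
  qed (simp add: colours_def)
  finally show ?thesis .
qed

lemma finite_block: "finite S \<Longrightarrow> partition_on S P \<Longrightarrow> B \<in> P \<Longrightarrow> finite B"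
  by (metis Sup_upper finite_subset partition_onD1)

lemma finite_blocks: "finite S \<Longrightarrow> partition_on S P \<Longrightarrow> finite P"
  by (rule finite_elements)

lemma partition_on_remove:
  assumes "partition_on S P" "B \<in> P"
  shows "partition_on (S - B) (P - {B})"
proof -
  have "\<Union>(P - {B}) = S - B"
  proof (intro set_eqI iffI)
    fix x assume "x \<in> \<Union>(P - {B})"
    then obtain C where "C \<in> P" "C \<noteq> B" "x \<in> C" by blast
    then show "x \<in> S - B" using assms by (auto simp: partition_on_def disjoint_def)
  qed (use assms in \<open>auto simp: partition_on_def\<close>)
  then show ?thesis using assms by (auto simp: partition_on_def disjoint_def)
qed

lemma partition_on_join:
  assumes "partition_on S P" "partition_on T Q" "S \<inter> T = {}"
  shows "partition_on (S \<union> T) (P \<union> Q)" "P \<inter> Q = {}"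
proof -
  have "B \<inter> C = {}" if "B \<in> P" "C \<in> Q" for B C
    using that assms by (auto simp: partition_on_def)
  note PQ = this
  show "partition_on (S \<union> T) (P \<union> Q)"
  proof (rule partition_onI)
    fix B C assume "B \<in> P \<union> Q" "C \<in> P \<union> Q" "B \<noteq> C"
    then consider "B \<in> P" "C \<in> P" | "B \<in> Q" "C \<in> Q" | "B \<in> P" "C \<in> Q" | "B \<in> Q" "C \<in> P"
      by blast
    then show "disjnt B C"
      using assms(1,2) PQ[of B C] PQ[of C B] \<open>B \<noteq> C\<close>
      by cases (auto simp: disjnt_def partition_on_def disjoint_def)
  qed (use assms(1,2) in \<open>auto simp: partition_on_def\<close>)
  have "B \<notin> Q" if "B \<in> P" for B
    using PQ[of B B] that partition_onD3[OF assms(1)] by auto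
  then show "P \<inter> Q = {}" by blast
qed

lemma sum_block_colours:
  assumes "finite S" "partition_on S P"
  shows "\<Sum>\<^sub># (block_colours col P) = colours col S"
  using finite_blocks[OF assms] assms
proof (induction P arbitrary: S rule: finite_induct)
  case empty
  then show ?case by (auto simp: block_colours_def colours_def partition_on_def)
next
  case (insert B P)
  have BS: "B \<subseteq> S" using insert.prems by (auto simp: partition_on_def)
  have "partition_on (S - B) P" using partition_on_remove[OF insert.prems(2), of B] insert.hyps by simp
  then have "\<Sum>\<^sub># (block_colours col P) = colours col (S - B)" using insert.prems by (intro insert.IH) simp
  moreover have "colours col (B \<union> (S - B)) = colours col B + colours col (S - B)"
    using insert.prems(1) BS by (intro colours_Un) (auto intro: finite_subset)
  moreover have "B \<union> (S - B) = S" using BS by blast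
  ultimately show ?case using insert.hyps by (simp add: block_colours_insert)
qed

lemma empty_notin_block_colours:
  assumes "finite S" "partition_on S P"
  shows "{#} \<notin># block_colours col P"
proof
  assume "{#} \<in># block_colours col P"
  then obtain B where "B \<in> P" "colours col B = {#}"
    using finite_blocks[OF assms] by (auto simp: block_colours_def)
  then show False using assms colours_eq_empty finite_block by (metis partition_onD3)
qed

section \<open>Realising prescribed colours by subsets, partitions and bijections\<close>

lemma colours_split:
  assumes "finite S" "colours col S = c + d"
  shows "\<exists>T\<subseteq>S. colours col T = c \<and> colours col (S - T) = d"
  using assms
proof (induction S arbitrary: c d rule: finite_induct)
  case empty
  then show ?case by (simp add: colours_def)
next
  case (insert x S)
  have eq: "add_mset (col x) (colours col S) = c + d" using insert.prems insert.hyps by (simp add: colours_insert)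
  show ?case
  proof (cases "col x \<in># c")
    case True
    then obtain c' where c: "c = add_mset (col x) c'" by (metis insert_DiffM)
    then obtain T where T: "T \<subseteq> S" "colours col T = c'" "colours col (S - T) = d"
      using insert.IH[of c' d] eq by auto
    have "finite T" "x \<notin> T" using T(1) insert.hyps finite_subset by blast+
    then have "colours col (insert x T) = c" using T c by (simp add: colours_insert)
    moreover have "insert x S - insert x T = S - T" using insert.hyps by blast
    ultimately show ?thesis using T by (intro exI[of _ "insert x T"]) auto
  next
    case False
    then have "col x \<in># d" using eq by (metis union_iff union_single_eq_member)
    then obtain d' where d: "d = add_mset (col x) d'" by (metis insert_DiffM)
    then obtain T where T: "T \<subseteq> S" "colours col T = c" "colours col (S - T) = d'"
      using insert.IH[of c d'] eq by auto
    have "insert x S - T = insert x (S - T)" using insert.hyps T by blast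
    then have "colours col (insert x S - T) = d" using T d insert.hyps by (simp add: colours_insert)
    then show ?thesis using T by (intro exI[of _ T]) auto
  qed
qed

lemma partition_with_block_colours:
  assumes "finite S" "colours col S = \<Sum>\<^sub># M" "{#} \<notin># M"
  shows "\<exists>P. partition_on S P \<and> block_colours col P = M"
  using assms
proof (induction M arbitrary: S)
  case empty
  then have "S = {}" by (simp add: colours_eq_empty)
  then show ?case by (intro exI[of _ "{}"]) (simp add: partition_on_def block_colours_def)
next
  case (add c M)
  obtain T where T: "T \<subseteq> S" "colours col T = c" "colours col (S - T) = \<Sum>\<^sub># M"
    using colours_split[of S col c "\<Sum>\<^sub># M"] add.prems by auto
  obtain P where P: "partition_on (S - T) P" "block_colours col P = M"
    using add.IH[of "S - T"] T add.prems by auto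
  have "T \<noteq> {}" using T(2) add.prems by (auto simp: colours_def)
  then have "partition_on T {T}" by (rule partition_on_space)
  note J = partition_on_join[OF this P(1)]
  have "partition_on S (insert T P)" "T \<notin> P" using J T(1) by (auto simp: Un_absorb1)
  moreover have "finite P" using finite_blocks[OF _ P(1)] add.prems(1) by simp
  ultimately show ?case using T P by (intro exI[of _ "insert T P"]) (simp add: block_colours_insert)
qed

lemma colours_eq_bij:
  assumes "finite S" "finite T" "colours col S = colours col T"
  shows "\<exists>f. bij_betw f S T \<and> (\<forall>x\<in>S. col (f x) = col x)"
  using assms
proof (induction S arbitrary: T rule: finite_induct)
  case empty
  then have "T = {}" using colours_eq_empty by (metis finite.emptyI)
  then show ?case by (simp add: bij_betw_def)
next
  case (insert x S)
  have "col x \<in># colours col T" using insert.prems insert.hyps by (metis colours_insert union_single_eq_member)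
  then obtain y where y: "y \<in> T" "col y = col x" using insert.prems by (auto simp: colours_def)
  have "T = insert y (T - {y})" using y by blast
  then have "colours col T = add_mset (col y) (colours col (T - {y}))"
    using colours_insert[of "T - {y}" y col] insert.prems(1) by simp
  then have "colours col S = colours col (T - {y})"
    using insert.prems insert.hyps y by (simp add: colours_insert)
  then obtain f where f: "bij_betw f S (T - {y})" "\<forall>x\<in>S. col (f x) = col x"
    using insert.IH[of "T - {y}"] insert.prems by auto
  let ?g = "f(x := y)"
  have "bij_betw ?g S (T - {y})" using f(1) insert.hyps by (subst bij_betw_cong[of S ?g f]) auto
  then have "bij_betw ?g (insert x S) (insert y (T - {y}))"
    using notIn_Un_bij_betw3[of x S ?g "T - {y}"] insert.hyps by simp
  then show ?case using f(2) y insert.hyps by (intro exI[of _ ?g]) (auto simp: insert_absorb fun_upd_def)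
qed

text \<open>Blocks with equal colours are paired off one by one, and colour-preserving bijections
  between paired blocks are glued. Thus the colours of the blocks determine a partition up to
  colour-preserving relabelling.\<close>

lemma block_colours_eq_bij:
  assumes "finite S" "finite S'" "partition_on S P" "partition_on S' P'"
    and "block_colours col P = block_colours col P'"
  shows "\<exists>f. bij_betw f S S' \<and> (\<forall>x\<in>S. col (f x) = col x) \<and> P' = image f ` P"
  using finite_blocks[OF assms(1,3)] assms
proof (induction P arbitrary: S S' P' rule: finite_induct)
  case empty
  have "finite P'" using finite_blocks empty by blast
  then have "P' = {}" using empty by (simp add: block_colours_def mset_set_empty_iff)
  then show ?case using empty by (auto simp: partition_on_def bij_betw_def)
next
  case (insert B P)
  have fin: "finite P'" using finite_blocks insert.prems by blast
  have "colours col B \<in># block_colours col P'"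
    using insert.prems insert.hyps by (metis block_colours_insert union_single_eq_member)
  then obtain B' where B': "B' \<in> P'" "colours col B' = colours col B" using fin by (auto simp: block_colours_def)
  have "block_colours col (insert B' (P' - {B'})) = add_mset (colours col B') (block_colours col (P' - {B'}))"
    using fin by (intro block_colours_insert) auto
  then have eq: "block_colours col P = block_colours col (P' - {B'})"
    using insert.prems(5) insert.hyps B' by (simp add: block_colours_insert insert_absorb)
  have fB: "finite B" "finite B'" using finite_block insert.prems B'(1) by blast+
  obtain g where g: "bij_betw g B B'" "\<forall>x\<in>B. col (g x) = col x"
    using colours_eq_bij[OF fB] B'(2) by metis
  have P: "partition_on (S - B) P" using partition_on_remove[OF insert.prems(3), of B] insert.hyps by simp
  obtain f where f: "bij_betw f (S - B) (S' - B')" "\<forall>x\<in>S - B. col (f x) = col x" "P' - {B'} = image f ` P"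
    using insert.IH[OF _ _ P partition_on_remove[OF insert.prems(4) B'(1)] eq] insert.prems(1,2) by auto
  define h where "h x = (if x \<in> B then g x else f x)" for x
  have sub: "B \<subseteq> S" "B' \<subseteq> S'" using insert.prems(3,4) B'(1) by (auto simp: partition_on_def)
  have "bij_betw h B B'" using g(1) by (subst bij_betw_cong[of B h g]) (auto simp: h_def)
  moreover have "bij_betw h (S - B) (S' - B')" using f(1) by (subst bij_betw_cong[of "S - B" h f]) (auto simp: h_def)
  ultimately have "bij_betw h (B \<union> (S - B)) (B' \<union> (S' - B'))" by (rule bij_betw_combine) blast
  then have "bij_betw h S S'" using sub by (simp add: Un_absorb1)
  moreover have "\<forall>x\<in>S. col (h x) = col x" using g(2) f(2) by (auto simp: h_def)
  moreover have "P' = image h ` insert B P"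
  proof -
    have "h ` B = B'" using \<open>bij_betw h B B'\<close> by (simp add: bij_betw_def)
    moreover have "h ` C = f ` C" if "C \<in> P" for C
    proof (rule image_cong[OF refl])
      fix x assume "x \<in> C"
      then have "x \<notin> B" using P that by (auto simp: partition_on_def)
      then show "h x = f x" by (simp add: h_def)
    qed
    ultimately have "image h ` insert B P = insert B' (P' - {B'})" using f(3) by auto
    then show ?thesis using B'(1) by (simp add: insert_absorb)
  qed
  ultimately show ?case by blast
qed

section \<open>Refinement in terms of colours\<close>

lemma mrefines_block_colours:
  assumes "finite S" "refines S P Q"
  shows "mrefines (block_colours col P) (block_colours col Q)"
proof -
  have P: "partition_on S P" and Q: "partition_on S Q" using assms(2) by (auto simp: refines_def)
  have fin: "finite P" "finite Q" using finite_blocks assms(1) P Q by blast+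
  have sum: "block_colours col R = (\<Sum>B\<in>R. {#colours col B#})" for R
    by (simp add: block_colours_def sum_unfold_sum_mset)
  \<comment> \<open>One group for each block of \<open>Q\<close>, formed by the blocks of
    \<open>P\<close> inside it.\<close>
  let ?C = "image_mset (\<lambda>q. block_colours col {p \<in> P. p \<subseteq> q}) (mset_set Q)"
  have "P = (\<Union>q\<in>Q. {p \<in> P. p \<subseteq> q})" using assms(2) by (auto simp: refines_def)
  then have "block_colours col P = (\<Sum>B\<in>(\<Union>q\<in>Q. {p \<in> P. p \<subseteq> q}). {#colours col B#})"
    unfolding sum by simp
  also have "\<dots> = (\<Sum>q\<in>Q. \<Sum>B\<in>{p \<in> P. p \<subseteq> q}. {#colours col B#})"
  proof (rule sum.UNION_disjoint)
    have "q = q'" if "p \<in> P" "p \<subseteq> q" "p \<subseteq> q'" "q \<in> Q" "q' \<in> Q" for p q q'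
    proof -
      have "p \<noteq> {}" using that(1) P by (auto simp: partition_on_def)
      then have "q \<inter> q' \<noteq> {}" using that by blast
      then show ?thesis using Q that(4,5) by (auto simp: partition_on_def disjoint_def)
    qed
    then show "\<forall>q\<in>Q. \<forall>q'\<in>Q. q \<noteq> q' \<longrightarrow> {p \<in> P. p \<subseteq> q} \<inter> {p \<in> P. p \<subseteq> q'} = {}" by blast
  qed (use fin in auto)
  also have "\<dots> = \<Sum>\<^sub># ?C" by (simp only: sum_unfold_sum_mset[of _ Q] flip: sum)
  finally have "\<Sum>\<^sub># ?C = block_colours col P" ..
  moreover have "image_mset sum_mset ?C = block_colours col Q"
    unfolding block_colours_def[of col Q] multiset.map_comp
  proof (rule image_mset_cong)
    fix q assume "q \<in># mset_set Q"
    then have q: "q \<in> Q" using fin by simp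
    then show "(sum_mset \<circ> (\<lambda>q. block_colours col {p \<in> P. p \<subseteq> q})) q = colours col q"
      using sum_block_colours[OF finite_block[OF assms(1) Q q] refines_obtains_subset[OF assms(2) q]] by simp
  qed
  ultimately show ?thesis unfolding mrefines_def by blast
qed

text \<open>The coarse partition is kept, and each of its blocks is cut according to a group of
  \<open>C\<close>; the colours of the block are the sum of that group, so the cut exists.\<close>

lemma refinement_with_block_colours:
  assumes "finite S" "partition_on S Q" "block_colours col Q = image_mset sum_mset C" "{#} \<notin># \<Sum>\<^sub># C"
  shows "\<exists>P. refines S P Q \<and> block_colours col P = \<Sum>\<^sub># C"
  using assms
proof (induction C arbitrary: S Q)
  case empty
  then have "Q = {}" using finite_blocks[OF empty(1,2)] by (simp add: block_colours_def mset_set_empty_iff)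
  then show ?case using empty.prems by (intro exI[of _ "{}"]) (auto simp: refines_def block_colours_def)
next
  case (add c C)
  have fin: "finite Q" using finite_blocks add.prems by blast
  have "\<Sum>\<^sub># c \<in># block_colours col Q" using add.prems by simp
  then obtain B where B: "B \<in> Q" "colours col B = \<Sum>\<^sub># c" using fin by (auto simp: block_colours_def)
  have "block_colours col (insert B (Q - {B})) = add_mset (colours col B) (block_colours col (Q - {B}))"
    using fin by (intro block_colours_insert) auto
  then have eq: "block_colours col (Q - {B}) = image_mset sum_mset C"
    using add.prems(3) B by (simp add: insert_absorb)
  obtain P where P: "refines (S - B) P (Q - {B})" "block_colours col P = \<Sum>\<^sub># C"
    using add.IH[OF _ partition_on_remove[OF add.prems(2) B(1)] eq] add.prems(1,4) by auto
  have fB: "finite B" using finite_block add.prems(1,2) B(1) by blast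
  obtain R where R: "partition_on B R" "block_colours col R = c"
    using partition_with_block_colours[OF fB B(2)] add.prems(4) by auto
  have BS: "B \<subseteq> S" using add.prems(2) B by (auto simp: partition_on_def)
  have P': "partition_on (S - B) P" using P(1) by (simp add: refines_def)
  note J = partition_on_join[OF R(1) P'] 
  have "partition_on S (R \<union> P)" using J(1) BS by (simp add: Un_absorb1)
  moreover have "\<exists>Y\<in>Q. X \<subseteq> Y" if "X \<in> R \<union> P" for X
    using that P(1) R(1) B(1) by (fastforce simp: refines_def partition_on_def)
  ultimately have "refines S (R \<union> P) Q" using add.prems(2) by (simp add: refines_def)
  moreover have "block_colours col (R \<union> P) = \<Sum>\<^sub># (add_mset c C)"
    using R P J(2) finite_blocks[OF fB R(1)] finite_blocks[OF _ P'] add.prems(1)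
    by (simp add: block_colours_Un)
  ultimately show ?case by blast
qed

subsection \<open>Orbits as pointed multiset partitions\<close>

text \<open>Only one block of a partition contains \<open>z\<close>, so the union is that block;
  writing it as a union avoids a choice.\<close>

definition pointed_colours :: "('a \<Rightarrow> 'c) \<Rightarrow> 'a \<Rightarrow> 'a set set \<Rightarrow> 'c multiset \<times> 'c multiset multiset" where
  "pointed_colours col z P =
     (colours col (\<Union>{B \<in> P. z \<in> B} - {z}), block_colours col {B \<in> P. z \<notin> B})"

lemma pointed_colours_insert:
  assumes "z \<in> B" "z \<notin> \<Union>P"
  shows "pointed_colours col z (insert B P) = (colours col (B - {z}), block_colours col P)"
proof -
  have "{C \<in> insert B P. z \<in> C} = {B}" "{C \<in> insert B P. z \<notin> C} = P" using assms by auto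
  then show ?thesis by (simp add: pointed_colours_def)
qed

lemma partition_on_pointed:
  assumes "partition_on A P" "z \<in> A"
  obtains B Q where "P = insert B Q" "B \<notin> Q" "z \<in> B" "B \<subseteq> A" "partition_on (A - B) Q" "z \<notin> \<Union>Q"
proof -
  obtain B where B: "B \<in> P" "z \<in> B" using assms by (auto simp: partition_on_def)
  have Q: "partition_on (A - B) (P - {B})" using partition_on_remove[OF assms(1) B(1)] .
  show thesis
  proof (rule that[of B "P - {B}"])
    show "P = insert B (P - {B})" using B by blast
    show "B \<subseteq> A" using B assms by (auto simp: partition_on_def)
    show "z \<notin> \<Union>(P - {B})" using Q B(2) by (metis DiffD2 partition_onD1)
  qed (use B Q in auto)
qed

lemma partition_on_insert_block:
  assumes "partition_on (A - B) Q" "B \<subseteq> A" "B \<noteq> {}"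
  shows "partition_on A (insert B Q)" "B \<notin> Q"
  using partition_on_join[OF partition_on_space[OF assms(3)] assms(1)] assms(2)
  by (auto simp: Un_absorb1)

lemma pointed_colours_in_pparts:
  assumes A: "finite A" "z \<in> A" and P: "partition_on A P"
  shows "pointed_colours col z P \<in> pparts (colours col (A - {z}))"
proof -
  obtain B Q where Q: "P = insert B Q" "z \<in> B" "B \<subseteq> A" "partition_on (A - B) Q" "z \<notin> \<Union>Q"
    using partition_on_pointed[OF P A(2)] by metis
  have fin: "finite (A - B)" "finite B" using A Q(3) finite_subset by auto
  have "A - {z} = (B - {z}) \<union> (A - B)" using Q by blast
  then have "colours col (A - {z}) = colours col (B - {z}) + colours col (A - B)"
    using fin by (metis Diff_disjoint colours_Un finite_Diff Diff_Int_distrib2 Int_Diff Int_commute empty_Diff)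
  then show ?thesis
    using sum_block_colours[OF fin(1) Q(4), of col] empty_notin_block_colours[OF fin(1) Q(4), of col]
    unfolding Q(1) pointed_colours_insert[OF Q(2,5)] by (simp add: pparts_def)
qed

lemma pointed_colours_surj:
  assumes A: "finite A" "z \<in> A" and p: "(b, M) \<in> pparts (colours col (A - {z}))"
  obtains B Q where "z \<in> B" "B \<subseteq> A" "partition_on (A - B) Q" "z \<notin> \<Union>Q"
    "colours col (B - {z}) = b" "block_colours col Q = M"
proof -
  have "colours col (A - {z}) = b + \<Sum>\<^sub># M" and M: "{#} \<notin># M" using p by (auto simp: pparts_def)
  then obtain T where T: "T \<subseteq> A - {z}" "colours col T = b" "colours col (A - {z} - T) = \<Sum>\<^sub># M"
    using colours_split[of "A - {z}" col b "\<Sum>\<^sub># M"] A(1) by auto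
  obtain Q where Q: "partition_on (A - {z} - T) Q" "block_colours col Q = M"
    using partition_with_block_colours[OF _ T(3) M] A(1) by auto
  show thesis
  proof (rule that[of "insert z T" Q])
    have "A - {z} - T = A - insert z T" by blast
    then show "partition_on (A - insert z T) Q" using Q by simp
    then show "z \<notin> \<Union>Q" by (metis DiffD2 insertI1 partition_onD1)
    have "insert z T - {z} = T" using T(1) by blast
    then show "colours col (insert z T - {z}) = b" using T by simp
  qed (use A T Q in auto)
qed

lemma block_colours_image:
  assumes "inj_on f (\<Union>P)" "\<And>x. x \<in> \<Union>P \<Longrightarrow> col (f x) = col x"
  shows "block_colours col (image f ` P) = block_colours col P"
proof -
  have "colours col (f ` B) = colours col B" if "B \<in> P" for B
    using that assms by (intro colours_image) (auto intro: inj_on_subset)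
  moreover have "inj_on (image f) P"
    using assms(1) by (meson inj_on_image)
  ultimately show ?thesis
    using colours_image[of "image f" P "colours col"] by (simp add: block_colours_def colours_def)
qed

lemma pointed_colours_image:
  assumes P: "partition_on A P" and z: "z \<in> A" "\<pi> z = z"
    and \<pi>: "inj_on \<pi> A" "\<And>x. x \<in> A \<Longrightarrow> col (\<pi> x) = col x"
  shows "pointed_colours col z (image \<pi> ` P) = pointed_colours col z P"
proof -
  obtain B Q where Q: "P = insert B Q" "z \<in> B" "B \<subseteq> A" "partition_on (A - B) Q" "z \<notin> \<Union>Q"
    using partition_on_pointed[OF P z(1)] by metis
  have U: "\<Union>Q \<subseteq> A" using Q(4) by (auto simp: partition_on_def)
  have "z \<in> \<pi> ` B" using Q(2) z(2) by (metis imageI)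
  moreover have "z \<notin> \<Union>(image \<pi> ` Q)"
  proof
    assume "z \<in> \<Union>(image \<pi> ` Q)"
    then obtain x where x: "x \<in> \<Union>Q" "z = \<pi> x" by blast
    then have "x = z" using \<pi>(1) z U by (metis inj_onD subsetD)
    then show False using x Q(5) by simp
  qed
  ultimately have "pointed_colours col z (image \<pi> ` P) =
      (colours col (\<pi> ` B - {z}), block_colours col (image \<pi> ` Q))"
    using Q(1) by (simp add: pointed_colours_insert)
  also have "\<pi> ` B - {z} = \<pi> ` (B - {z})"
    using inj_on_image_set_diff[OF \<pi>(1), of B "{z}"] Q(3) z by auto
  also have "colours col \<dots> = colours col (B - {z})"
    using \<pi> Q(3) by (intro colours_image) (auto intro: inj_on_subset)
  also have "block_colours col (image \<pi> ` Q) = block_colours col Q"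
    using \<pi> U by (intro block_colours_image) (auto intro: inj_on_subset)
  finally show ?thesis using Q by (simp add: pointed_colours_insert)
qed

lemma block_colours_pointed:
  assumes "finite A" "partition_on A P" "z \<in> A"
  shows "block_colours col P =
    add_mset (add_mset (col z) (fst (pointed_colours col z P))) (snd (pointed_colours col z P))"
proof -
  obtain B Q where Q: "P = insert B Q" "B \<notin> Q" "z \<in> B" "B \<subseteq> A" "partition_on (A - B) Q" "z \<notin> \<Union>Q"
    using partition_on_pointed[OF assms(2,3)] by metis
  have fin: "finite Q" "finite B"
    using finite_blocks[OF _ Q(5)] assms(1) Q(4) finite_subset by auto
  have "colours col B = add_mset (col z) (colours col (B - {z}))"
    using colours_insert[of "B - {z}" z col] fin Q(3) by (simp add: insert_absorb)
  then show ?thesis unfolding Q(1) using Q fin by (simp add: pointed_colours_insert block_colours_insert)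
qed

text \<open>Equal pointed colours give equal colours of all blocks, and hence a colour-preserving
  permutation. It need not fix \<open>z\<close> here; when \<open>z\<close> is alone in its colour,
  preserving colours forces this.\<close>

lemma pointed_colours_eq_permutes:
  assumes A: "finite A" "z \<in> A" and P: "partition_on A P" "partition_on A P'"
    and eq: "pointed_colours col z P = pointed_colours col z P'"
  shows "\<exists>\<pi>. \<pi> permutes A \<and> (\<forall>x\<in>A. col (\<pi> x) = col x) \<and> P' = image \<pi> ` P"
proof -
  have "block_colours col P = block_colours col P'"
    using block_colours_pointed[OF A(1) _ A(2)] P eq by metis
  then obtain f where f: "bij_betw f A A" "\<forall>x\<in>A. col (f x) = col x" "P' = image f ` P"
    using block_colours_eq_bij[OF A(1) A(1) P, of col] by blast
  define \<pi> where "\<pi> x = (if x \<in> A then f x else x)" for x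
  have "bij_betw \<pi> A A" using f(1) by (subst bij_betw_cong[of A \<pi> f]) (auto simp: \<pi>_def)
  then have "\<pi> permutes A" by (rule bij_imp_permutes) (simp add: \<pi>_def)
  moreover have im: "\<pi> ` B = f ` B" if "B \<in> P" for B
    using that P(1) by (intro image_cong) (auto simp: \<pi>_def partition_on_def)
  have "P' = image \<pi> ` P" unfolding f(3) by (rule image_cong) (simp_all add: im)
  ultimately show ?thesis using f(2) by (intro exI[of _ \<pi>]) (auto simp: \<pi>_def)
qed

lemma ple_pointed_colours:
  assumes A: "finite A" "z \<in> A" and le: "refines A P Q"
  shows "ple (pointed_colours col z P) (pointed_colours col z Q)"
proof -
  have P: "partition_on A P" and Q: "partition_on A Q" using le by (auto simp: refines_def)
  obtain B R where R: "P = insert B R" "B \<notin> R" "z \<in> B" "B \<subseteq> A" "partition_on (A - B) R" "z \<notin> \<Union>R"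
    using partition_on_pointed[OF P A(2)] by metis
  obtain C T where T: "Q = insert C T" "C \<notin> T" "z \<in> C" "C \<subseteq> A" "partition_on (A - C) T" "z \<notin> \<Union>T"
    using partition_on_pointed[OF Q A(2)] by metis
  \<comment> \<open>\<open>?D\<close> are the other blocks of \<open>P\<close> that vanish in the
    block of \<open>z\<close> in \<open>Q\<close>; \<open>?M\<close> are the blocks that stay apart
    from it.\<close>
  let ?D = "{X \<in> R. X \<subseteq> C}" and ?M = "{X \<in> R. \<not> X \<subseteq> C}"
  have "\<exists>Y\<in>Q. B \<subseteq> Y" using le R(1) by (auto simp: refines_def)
  then have BC: "B \<subseteq> C" using R(3) T(1,6) by blast
  have CD: "partition_on C (insert B ?D)"
  proof -
    have "{X \<in> P. X \<subseteq> C} = insert B ?D" using R(1) BC by auto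
    then show ?thesis using refines_obtains_subset[OF le, of C] T(1) by simp
  qed
  then have D: "partition_on (C - B) ?D"
    using partition_on_remove[OF CD, of B] R(2) by simp
  have inT: "\<exists>Y\<in>T. X \<subseteq> Y" if "X \<in> ?M" for X
    using that le R(1) T(1) by (auto simp: refines_def)
  have disj: "X \<inter> C = {}" if "X \<in> ?M" for X
    using inT[OF that] T(5) by (auto simp: partition_on_def)
  have UR: "\<Union>R = A - B" using R(5) by (simp add: partition_on_def)
  have "\<Union>?M = A - C"
  proof (intro set_eqI iffI)
    fix x assume "x \<in> A - C"
    then obtain X where "X \<in> R" "x \<in> X" using UR BC by blast
    then show "x \<in> \<Union>?M" using \<open>x \<in> A - C\<close> by blast
  next
    fix x assume "x \<in> \<Union>?M"
    then obtain X where X: "X \<in> ?M" "x \<in> X" by blast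
    then have "x \<in> A" using UR by blast
    then show "x \<in> A - C" using disj[OF X(1)] X(2) by blast
  qed
  then have "partition_on (A - C) ?M" using R(5) by (auto simp: partition_on_def disjoint_def)
  then have "refines (A - C) ?M T" using T(5) inT by (simp add: refines_def)
  then have M: "mrefines (block_colours col ?M) (block_colours col T)"
    using A(1) by (intro mrefines_block_colours) simp_all
  have finR: "finite R" using finite_blocks[OF _ R(5)] A(1) by simp
  have "block_colours col (?D \<union> ?M) = block_colours col ?D + block_colours col ?M"
    using finR by (intro block_colours_Un) auto
  moreover have "?D \<union> ?M = R" by blast
  ultimately have RM: "block_colours col R = block_colours col ?D + block_colours col ?M" by simp
  have finC: "finite C" using A(1) T(4) finite_subset by blast
  have "colours col ((B - {z}) \<union> (C - B)) = colours col (B - {z}) + colours col (C - B)"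
    using finC BC by (intro colours_Un) (auto intro: finite_subset)
  moreover have "(B - {z}) \<union> (C - B) = C - {z}" using BC R(3) by blast
  ultimately have "colours col (C - {z}) = colours col (B - {z}) + \<Sum>\<^sub># (block_colours col ?D)"
    using sum_block_colours[OF _ D, of col] finC by simp
  with RM M show ?thesis
    unfolding R(1) T(1) pointed_colours_insert[OF R(3,6)] pointed_colours_insert[OF T(3,6)] ple_def by auto
qed

text \<open>The comparison is realised from the coarse side: in a representative of
  \<open>q\<close>, the block of \<open>z\<close> is cut into the part kept by \<open>p\<close> and
  the absorbed blocks \<open>D\<close>, and the other blocks are cut along \<open>C\<close>. A
  comparable pair of representatives is exactly what the order on orbits asks for.\<close>

lemma ple_refines:
  assumes A: "finite A" "z \<in> A" and le: "ple p q"
    and pq: "p \<in> pparts (colours col (A - {z}))" "q \<in> pparts (colours col (A - {z}))"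
  shows "\<exists>P Q. refines A P Q \<and> pointed_colours col z P = p \<and> pointed_colours col z Q = q"
proof -
  obtain D M where D: "snd p = D + M" "fst q = fst p + \<Sum>\<^sub># D" "mrefines M (snd q)"
    using le unfolding ple_def by blast
  obtain C where C: "\<Sum>\<^sub># C = M" "image_mset sum_mset C = snd q" using D(3) unfolding mrefines_def by blast
  have ne: "{#} \<notin># D" "{#} \<notin># M" using pq(1) D(1) by (auto simp: pparts_def)
  obtain B T where T: "z \<in> B" "B \<subseteq> A" "partition_on (A - B) T" "z \<notin> \<Union>T"
    "colours col (B - {z}) = fst q" "block_colours col T = snd q"
    using pointed_colours_surj[OF A, of "fst q" "snd q" col] pq(2) by auto
  have finB: "finite B" using A(1) T(2) finite_subset by blast
  obtain S where S: "S \<subseteq> B - {z}" "colours col S = fst p" "colours col (B - {z} - S) = \<Sum>\<^sub># D"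
    using colours_split[of "B - {z}" col "fst p" "\<Sum>\<^sub># D"] finB T(5) D(2) by auto
  obtain E where E: "partition_on (B - {z} - S) E" "block_colours col E = D"
    using partition_with_block_colours[OF _ S(3) ne(1)] finB by auto
  obtain F where F: "refines (A - B) F T" "block_colours col F = M"
    using refinement_with_block_colours[OF _ T(3), of col C] T(6) C ne(2) A(1) by auto
  have F': "partition_on (A - B) F" using F(1) by (simp add: refines_def)
  note J = partition_on_join[OF E(1) F']
  have disj: "(B - {z} - S) \<inter> (A - B) = {}" by blast
  have eqA: "(B - {z} - S) \<union> (A - B) = A - insert z S" using T(1,2) S(1) by blast
  have R: "partition_on (A - insert z S) (E \<union> F)" using J(1)[OF disj] eqA by simp
  have sub: "insert z S \<subseteq> A" using S(1) T(2) A(2) by blast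
  let ?P = "insert (insert z S) (E \<union> F)" and ?Q = "insert B T"
  have zP: "z \<notin> \<Union>(E \<union> F)" using R by (metis DiffD2 insertI1 partition_onD1)
  have "pointed_colours col z ?P = (colours col S, block_colours col (E \<union> F))"
  proof -
    have "insert z S - {z} = S" using S(1) by blast
    then show ?thesis using zP by (simp add: pointed_colours_insert)
  qed
  moreover have "block_colours col (E \<union> F) = D + M"
    using E F J(2)[OF disj] finite_blocks[OF _ E(1)] finite_blocks[OF _ F'] finB A(1)
    by (simp add: block_colours_Un)
  ultimately have "pointed_colours col z ?P = p" using S(2) D(1) by (simp add: prod_eq_iff)
  moreover have "pointed_colours col z ?Q = q" using T by (simp add: pointed_colours_insert prod_eq_iff)
  moreover have "refines A ?P ?Q"
  proof -
    have "partition_on A ?P" using partition_on_insert_block[OF R sub] by simp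
    moreover have "partition_on A ?Q" using partition_on_insert_block[OF T(3,2)] T(1) by blast
    moreover have "\<exists>Y\<in>?Q. X \<subseteq> Y" if X: "X \<in> ?P" for X
    proof -
      consider "X = insert z S" | "X \<in> E" | "X \<in> F" using X by blast
      then show ?thesis
      proof cases
        case 1
        then show ?thesis using S(1) T(1) by blast
      next
        case 2
        then show ?thesis using E(1) by (auto simp: partition_on_def)
      next
        case 3
        then show ?thesis using F(1) by (auto simp: refines_def)
      qed
    qed
    ultimately show ?thesis by (simp add: refines_def)
  qed
  ultimately show ?thesis by blast
qed

subsection \<open>Hook shapes\<close>

lemma order_complex_image:
  assumes "\<And>p q. p \<in> A \<Longrightarrow> q \<in> A \<Longrightarrow> le' (h p) (h q) \<longleftrightarrow> le p q"
  shows "order_complex (h ` A) le' = image h ` order_complex A le"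
proof -
  have pp: "proper_part (h ` A) le' = h ` proper_part A le"
    using assms by (auto simp: proper_part_def)
  have sub: "proper_part A le \<subseteq> A" by (auto simp: proper_part_def)
  show ?thesis
  proof (intro set_eqI iffI)
    fix \<sigma> assume \<sigma>: "\<sigma> \<in> order_complex (h ` A) le'"
    then have "finite \<sigma>" "\<sigma> \<subseteq> h ` proper_part A le"
      by (auto simp: order_complex_eq chain_complex_def pp)
    then obtain \<tau> where \<tau>: "\<tau> \<subseteq> proper_part A le" "finite \<tau>" "\<sigma> = h ` \<tau>"
      by (meson finite_subset_image)
    have "\<forall>x\<in>\<sigma>. \<forall>y\<in>\<sigma>. le' x y \<or> le' y x"
      using \<sigma> by (simp add: order_complex_eq chain_complex_def)
    then have "\<forall>x\<in>\<tau>. \<forall>y\<in>\<tau>. le x y \<or> le y x"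
      using assms \<tau>(1) sub unfolding \<tau>(3) by (meson imageI subsetD)
    then show "\<sigma> \<in> image h ` order_complex A le"
      using \<tau> by (simp add: order_complex_eq chain_complex_def)
  next
    fix \<sigma> assume "\<sigma> \<in> image h ` order_complex A le"
    then obtain \<tau> where \<tau>: "\<tau> \<in> order_complex A le" "\<sigma> = h ` \<tau>" by blast
    then have "\<tau> \<subseteq> proper_part A le" "finite \<tau>" "\<forall>x\<in>\<tau>. \<forall>y\<in>\<tau>. le x y \<or> le y x"
      by (auto simp: order_complex_eq chain_complex_def)
    moreover then have "\<forall>x\<in>\<sigma>. \<forall>y\<in>\<sigma>. le' x y \<or> le' y x"
      using assms sub unfolding \<tau>(2) by (simp add: subset_iff)
    ultimately show "\<sigma> \<in> order_complex (h ` A) le'"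
      using \<tau>(2) by (auto simp: order_complex_eq chain_complex_def pp)
  qed
qed

section \<open>The Young subgroup of a hook and its orbits\<close>

text \<open>Points of the long part are interchangeable. Their common colour 0 cannot clash with
  that of a later point, which keeps its own positive number.\<close>

definition hook_colour :: "nat list \<Rightarrow> nat \<Rightarrow> nat" where
  "hook_colour ls j = (if j \<le> ls ! 0 then 0 else j)"

lemma sum_list_take_hook:
  "hook_shape ls \<Longrightarrow> i < length ls \<Longrightarrow> sum_list (take (Suc i) ls) = ls ! 0 + i"
proof (induction i)
  case 0
  then show ?case by (simp add: take_Suc_conv_app_nth)
next
  case (Suc i)
  then have "ls ! Suc i = 1" by (simp add: hook_shape_def)
  then show ?case using Suc by (simp add: take_Suc_conv_app_nth[of "Suc i"])
qed

lemma young_block_hook: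
  assumes "hook_shape ls" "i < length ls"
  shows "young_block ls i = (if i = 0 then {1..ls ! 0} else {ls ! 0 + i})"
proof (cases i)
  case 0
  then show ?thesis using sum_list_take_hook[OF assms] by (simp add: young_block_def)
next
  case (Suc j)
  then show ?thesis
    using sum_list_take_hook[OF assms] sum_list_take_hook[OF assms(1), of j] assms(2)
    by (simp add: young_block_def)
qed

lemma sum_list_hook: "hook_shape ls \<Longrightarrow> sum_list ls = ls ! 0 + (length ls - 1)"
  using sum_list_take_hook[of ls "length ls - 1"] by (auto simp: hook_shape_def)

text \<open>The blocks of a hook are exactly the colour classes. An injection that maps a finite
  class into itself maps it onto itself, so stabilising the blocks amounts to preserving
  colours.\<close>

lemma young_subgroup_hook:
  assumes "hook_shape ls"
  shows "young_subgroup ls = {\<pi>. \<pi> permutes {1..sum_list ls} \<and>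
    (\<forall>j\<in>{1..sum_list ls}. hook_colour ls (\<pi> j) = hook_colour ls j)}"
proof (intro set_eqI iffI)
  let ?A = "{1..sum_list ls}"
  note len = sum_list_hook[OF assms]
  have ne: "0 < length ls" using assms by (simp add: hook_shape_def)
  fix \<pi> assume "\<pi> \<in> young_subgroup ls"
  then have \<pi>: "\<pi> permutes ?A" and bl: "\<And>i. i < length ls \<Longrightarrow> \<pi> ` young_block ls i = young_block ls i"
    by (auto simp: young_subgroup_def)
  have "hook_colour ls (\<pi> j) = hook_colour ls j" if j: "j \<in> ?A" for j
  proof (cases "j \<le> ls ! 0")
    case True
    then have "\<pi> j \<in> \<pi> ` young_block ls 0" using j young_block_hook[OF assms ne] by simp
    then have "\<pi> j \<in> {1..ls ! 0}" using bl[OF ne] young_block_hook[OF assms ne] by simp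
    then show ?thesis using True by (simp add: hook_colour_def)
  next
    case False
    define i where "i = j - ls ! 0"
    have i: "i < length ls" "i \<noteq> 0" "j = ls ! 0 + i" using False j len ne by (auto simp: i_def)
    have "\<pi> ` {j} = {j}" using bl[OF i(1)] young_block_hook[OF assms i(1)] i by simp
    then show ?thesis by simp
  qed
  with \<pi> show "\<pi> \<in> {\<pi>. \<pi> permutes ?A \<and> (\<forall>j\<in>?A. hook_colour ls (\<pi> j) = hook_colour ls j)}" by simp
next
  let ?A = "{1..sum_list ls}"
  note len = sum_list_hook[OF assms]
  fix \<pi> assume "\<pi> \<in> {\<pi>. \<pi> permutes ?A \<and> (\<forall>j\<in>?A. hook_colour ls (\<pi> j) = hook_colour ls j)}"
  then have \<pi>: "\<pi> permutes ?A" and col: "\<And>j. j \<in> ?A \<Longrightarrow> hook_colour ls (\<pi> j) = hook_colour ls j" by auto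
  have in_A: "\<pi> j \<in> ?A" if "j \<in> ?A" for j using \<pi> that by (simp only: permutes_in_image)
  have "\<pi> ` young_block ls i = young_block ls i" if i: "i < length ls" for i
  proof (rule endo_inj_surj)
    show "inj_on \<pi> (young_block ls i)" using permutes_inj[OF \<pi>] by (rule inj_on_subset) simp
    show "\<pi> ` young_block ls i \<subseteq> young_block ls i"
    proof (rule image_subsetI)
      fix j assume j: "j \<in> young_block ls i"
      have "1 \<le> j \<and> j \<le> ls ! 0 + i"
        using j i young_block_hook[OF assms i] by (simp split: if_splits)
      moreover have "ls ! 0 + i \<le> sum_list ls" using len i by arith
      ultimately have jA: "j \<in> ?A" by simp
      show "\<pi> j \<in> young_block ls i"
        using j col[OF jA] in_A[OF jA] young_block_hook[OF assms i]
        by (auto simp: hook_colour_def split: if_splits)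
    qed
  qed (simp add: young_block_def)
  with \<pi> show "\<pi> \<in> young_subgroup ls" by (simp add: young_subgroup_def)
qed

lemma partition_on_permutes:
  assumes "partition_on A P" "\<pi> permutes A"
  shows "partition_on A (image \<pi> ` P)"
proof -
  have "inj_on \<pi> A" using assms(2) permutes_inj inj_on_subset by blast
  then have "partition_on (\<pi> ` A) (image \<pi> ` P - {{}})" using partition_on_inj_image assms(1) by blast
  moreover have "{} \<notin> image \<pi> ` P" using assms(1) by (auto simp: partition_on_def)
  ultimately show ?thesis using permutes_image[OF assms(2)] by simp
qed

lemma spherical_hook_quotient:
  assumes "hook_shape ls" "sum_list ls = n" "length ls \<ge> 2"
  shows "spherical (n - 2) (order_complex (quotient_carrier n ls) (quotient_le n))"
proof -
  define col where "col = hook_colour ls"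
  define A where "A = {1..n}"
  define Y where "Y = colours col (A - {n})"
  \<comment> \<open>A fibre of the invariant, which turns out to be a whole orbit.\<close>
  define h where "h p = {P. partition_on A P \<and> pointed_colours col n P = p}" for p
  have n: "n = ls ! 0 + (length ls - 1)" "ls ! 0 \<ge> 1" using sum_list_hook[OF assms(1)] assms
    by (auto simp: hook_shape_def)
  have A: "finite A" "n \<in> A" using n assms(3) by (auto simp: A_def)
  have G: "\<pi> \<in> young_subgroup ls \<longleftrightarrow> \<pi> permutes A \<and> (\<forall>x\<in>A. col (\<pi> x) = col x)" for \<pi>
    using young_subgroup_hook[OF assms(1)] assms(2) by (simp add: A_def col_def)
  \<comment> \<open>With at least two parts, \<open>n\<close> exceeds the first part, so no other
    point has its colour.\<close>
  have fix_n: "\<pi> n = n" if "\<pi> \<in> young_subgroup ls" for \<pi>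
  proof -
    have "col (\<pi> n) = col n" using that G A(2) by blast
    moreover have "col n = n" using n(1) assms(3) by (simp add: col_def hook_colour_def)
    ultimately show ?thesis using n assms(3) by (auto simp: col_def hook_colour_def split: if_splits)
  qed
  have orbit: "young_orbit ls P = h (pointed_colours col n P)" if P: "partition_on A P" for P
  proof (intro set_eqI iffI)
    fix P' assume "P' \<in> young_orbit ls P"
    then obtain \<pi> where \<pi>: "\<pi> \<in> young_subgroup ls" "P' = image \<pi> ` P"
      by (auto simp: young_orbit_def partition_act_def)
    have "inj_on \<pi> A" using G \<pi>(1) permutes_inj inj_on_subset by blast
    then have "pointed_colours col n P' = pointed_colours col n P"
      unfolding \<pi>(2) using fix_n[OF \<pi>(1)] G \<pi>(1) by (intro pointed_colours_image[OF P A(2)]) auto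
    moreover have "partition_on A P'" using \<pi> G P partition_on_permutes by blast
    ultimately show "P' \<in> h (pointed_colours col n P)" by (simp add: h_def)
  next
    fix P' assume "P' \<in> h (pointed_colours col n P)"
    then have "partition_on A P'" "pointed_colours col n P = pointed_colours col n P'" by (auto simp: h_def)
    then obtain \<pi> where "\<pi> permutes A" "\<forall>x\<in>A. col (\<pi> x) = col x" "P' = image \<pi> ` P"
      using pointed_colours_eq_permutes[OF A P, of P' col] by blast
    then show "P' \<in> young_orbit ls P" using G by (auto simp: young_orbit_def partition_act_def)
  qed
  have ex: "\<exists>P. partition_on A P \<and> pointed_colours col n P = p" if "p \<in> pparts Y" for p
    using ple_refines[OF A ple_refl, of p col] that by (auto simp: Y_def refines_def)
  have carrier: "quotient_carrier n ls = h ` pparts Y"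
  proof -
    have "quotient_carrier n ls = (\<lambda>P. h (pointed_colours col n P)) ` {P. partition_on A P}"
      unfolding quotient_carrier_def set_partitions_def A_def[symmetric]
      by (rule image_cong) (simp_all add: orbit)
    also have "\<dots> = h ` (pointed_colours col n ` {P. partition_on A P})" by (simp only: image_image)
    also have "pointed_colours col n ` {P. partition_on A P} = pparts Y"
    proof (intro set_eqI iffI)
      fix p assume "p \<in> pparts Y"
      then show "p \<in> pointed_colours col n ` {P. partition_on A P}" using ex by blast
    qed (use pointed_colours_in_pparts[OF A] in \<open>auto simp: Y_def\<close>)
    finally show ?thesis .
  qed
  have le: "quotient_le n (h p) (h q) \<longleftrightarrow> ple p q" if pq: "p \<in> pparts Y" "q \<in> pparts Y" for p q
  proof
    assume "quotient_le n (h p) (h q)"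
    then obtain P Q where "P \<in> h p" "Q \<in> h q" "refines A P Q" by (auto simp: quotient_le_def A_def)
    then show "ple p q" using ple_pointed_colours[OF A, of P Q col] by (simp add: h_def)
  next
    assume "ple p q"
    then obtain P Q where "refines A P Q" "pointed_colours col n P = p" "pointed_colours col n Q = q"
      using ple_refines[OF A _ pq[unfolded Y_def]] by blast
    then show "quotient_le n (h p) (h q)"
      unfolding quotient_le_def by (auto simp: h_def A_def refines_def)
  qed
  have inj: "inj_on h (pparts Y)"
  proof (rule inj_onI)
    fix p q assume pq: "p \<in> pparts Y" "q \<in> pparts Y" "h p = h q"
    obtain P where "P \<in> h p" using ex[OF pq(1)] by (auto simp: h_def)
    moreover then have "P \<in> h q" using pq(3) by simp
    ultimately show "p = q" by (simp add: h_def)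
  qed
  \<comment> \<open>Apart from \<open>n\<close> there are \<open>n - 1\<close> letters, so top faces
    have \<open>n - 2\<close> vertices.\<close>
  have "size Y = Suc (n - 2)" using n assms(3) A by (simp add: Y_def colours_def A_def)
  then have "spherical (n - 2) (order_complex (pparts Y) ple)" by (rule spherical_pparts)
  then have "spherical (n - 2) (image h ` order_complex (pparts Y) ple)"
  proof (rule spherical_image)
    have "\<Union>(order_complex (pparts Y) ple) \<subseteq> pparts Y"
      by (auto simp: order_complex_def proper_part_def)
    then show "inj_on h (\<Union>(order_complex (pparts Y) ple))" using inj by (rule inj_on_subset[rotated])
  qed
  then show ?thesis unfolding carrier by (subst order_complex_image) (use le in auto)
qed

lemma complex_quotient: "complex (order_complex (quotient_carrier n ls) (quotient_le n))"
proof -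
  have "set_partitions n \<subseteq> Pow (Pow {1..n})" by (auto simp: set_partitions_def partition_on_def)
  then have "finite (set_partitions n)" by (rule finite_subset) simp
  then have "finite (quotient_carrier n ls)" by (simp add: quotient_carrier_def)
  then have "finite (proper_part (quotient_carrier n ls) (quotient_le n))"
    by (rule finite_subset[rotated]) (simp add: proper_part_def)
  then show ?thesis unfolding order_complex_eq by (rule complex_chain_complex)
qed

section \<open>The shape with one row\<close>

text \<open>For \<open>\<lambda> = (n)\<close> every partition other than the discrete one lies above the orbit of the
  partition with a single nontrivial block, of size 2.\<close>

lemma collapsible_one_row:
  assumes "n \<ge> 3"
  shows "collapsible (order_complex (quotient_carrier n [n]) (quotient_le n))"
proof -
  let ?A = "{1..n}" and ?G = "young_subgroup [n]"
  let ?S = "proper_part (quotient_carrier n [n]) (quotient_le n)"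
  have G: "?G = {\<pi>. \<pi> permutes ?A}"
    using permutes_image by (auto simp: young_subgroup_def young_block_def)
  define D where "D = (\<lambda>j. {j}) ` ?A"
  define E where "E = insert {1, 2} ((\<lambda>j. {j}) ` {3..n})"
  have D: "partition_on ?A D" by (auto simp: D_def partition_on_def disjoint_def)
  have E: "partition_on ?A E" using assms by (auto simp: E_def partition_on_def disjoint_def)
  have T: "partition_on ?A {?A}" using assms by (intro partition_on_space) auto
  let ?v = "young_orbit [n] E"
  have self: "P \<in> young_orbit [n] P" for P
    using permutes_id[of ?A] by (auto simp: young_orbit_def partition_act_def G intro!: exI[of _ id])
  have carr: "young_orbit [n] P \<in> quotient_carrier n [n]" if "partition_on ?A P" for P
    using that by (auto simp: quotient_carrier_def set_partitions_def)
  have bot: "refines ?A D P" if "partition_on ?A P" for P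
    using that D by (fastforce simp: refines_def D_def partition_on_def)
  have above: "quotient_le n ?v (young_orbit [n] P)" if P: "partition_on ?A P" "P \<noteq> D" for P
  proof -
    have "\<exists>B\<in>P. \<exists>i\<in>B. \<exists>j\<in>B. i \<noteq> j"
    proof (rule ccontr)
      assume none: "\<not> ?thesis"
      have "refines ?A P D"
        unfolding refines_def
      proof (intro conjI ballI P D)
        fix B assume B: "B \<in> P"
        then have "B \<noteq> {}" using partition_onD3[OF P(1)] by auto
        then obtain i where i: "i \<in> B" by blast
        then have "B = {i}" using none B by blast
        moreover have "i \<in> ?A" using i B P by (auto simp: partition_on_def)
        ultimately show "\<exists>Y\<in>D. B \<subseteq> Y" by (auto simp: D_def)
      qed
      then show False using refines_asym[OF bot[OF P(1)]] P(2) by blast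
    qed
    then obtain B i j where B: "B \<in> P" "i \<in> B" "j \<in> B" "i \<noteq> j" by blast
    have ij: "i \<in> ?A" "j \<in> ?A" using B P(1) by (auto simp: partition_on_def)
    \<comment> \<open>\<open>\<rho>\<close> moves 1 to \<open>i\<close>; the second transposition
      moves the image of 2 to \<open>j\<close> and leaves \<open>i\<close> in place, since
      \<open>i\<close> is neither of the two points that it exchanges.\<close>
    define \<rho> where "\<rho> = Transposition.transpose 1 i"
    define \<pi> where "\<pi> = Transposition.transpose (\<rho> 2) j \<circ> \<rho>"
    have "\<rho> permutes ?A" unfolding \<rho>_def using ij assms by (intro permutes_swap_id) auto
    moreover then have "\<rho> 2 \<in> ?A" using assms by (simp only: permutes_in_image) simp
    ultimately have \<pi>: "\<pi> permutes ?A"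
      unfolding \<pi>_def using ij by (intro permutes_compose permutes_swap_id)
    have "\<rho> 1 = i" by (simp add: \<rho>_def)
    moreover have "\<rho> 2 \<noteq> \<rho> 1" using permutes_inj[OF \<open>\<rho> permutes ?A\<close>] by (metis injD numeral_One numeral_eq_iff semiring_norm(85))
    ultimately have im: "\<pi> 1 = i" "\<pi> 2 = j" using B(4) by (auto simp: \<pi>_def transpose_def)
    have E': "partition_on ?A (image \<pi> ` E)" using E \<pi> by (rule partition_on_permutes)
    have "refines ?A (image \<pi> ` E) P"
      unfolding refines_def
    proof (intro conjI ballI E' P)
      fix X assume "X \<in> image \<pi> ` E"
      then obtain Z where "Z \<in> E" "X = \<pi> ` Z" by blast
      then consider "X = {i, j}" | k where "k \<in> {3..n}" "X = {\<pi> k}"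
        using im by (auto simp: E_def)
      then show "\<exists>Y\<in>P. X \<subseteq> Y"
      proof cases
        case (2 k)
        then have "k \<in> ?A" by simp
        then have "\<pi> k \<in> ?A" using \<pi> by (simp only: permutes_in_image)
        then show ?thesis using P(1) 2 by (auto simp: partition_on_def)
      qed (use B in auto)
    qed
    moreover have "image \<pi> ` E \<in> ?v" using \<pi> by (auto simp: young_orbit_def partition_act_def G)
    ultimately show ?thesis using self unfolding quotient_le_def by blast
  qed
  \<comment> \<open>It is not the bottom, because a block of two points fits into no singleton, and
    not the top, because a block of at most two points cannot contain all \<open>n \<ge> 3\<close>
    points.\<close>
  have v: "?v \<in> ?S"
  proof -
    have orb: "\<exists>\<pi>. \<pi> permutes ?A \<and> X = image \<pi> ` P" if "X \<in> young_orbit [n] P" for X P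
      using that by (auto simp: young_orbit_def partition_act_def G)
    have "\<not> quotient_le n ?v (young_orbit [n] D)"
    proof
      assume "quotient_le n ?v (young_orbit [n] D)"
      then obtain \<pi> \<rho> where p: "\<pi> permutes ?A" "\<rho> permutes ?A" "refines ?A (image \<pi> ` E) (image \<rho> ` D)"
        using orb unfolding quotient_le_def by blast
      have "\<pi> ` {1, 2} \<in> image \<pi> ` E" by (auto simp: E_def)
      then obtain Y where "Y \<in> image \<rho> ` D" "\<pi> ` {1, 2} \<subseteq> Y" using p(3) unfolding refines_def by blast
      then obtain k where "\<pi> ` {1, 2} \<subseteq> {k}" by (auto simp: D_def)
      then have "\<pi> 1 = \<pi> 2" by simp
      then show False using permutes_inj[OF p(1)] by (metis injD numeral_One numeral_eq_iff semiring_norm(85))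
    qed
    moreover have "\<not> quotient_le n (young_orbit [n] {?A}) ?v"
    proof
      assume "quotient_le n (young_orbit [n] {?A}) ?v"
      then obtain \<pi> \<rho> where p: "\<pi> permutes ?A" "\<rho> permutes ?A" "refines ?A (image \<pi> ` {?A}) (image \<rho> ` E)"
        using orb unfolding quotient_le_def by blast
      then obtain X where X: "X \<in> E" "?A \<subseteq> \<rho> ` X"
        using permutes_image[OF p(1)] unfolding refines_def by auto
      have "finite X" "card X \<le> 2" using X(1) by (auto simp: E_def)
      then have "card ?A \<le> 2" using X(2) by (meson card_image_le card_mono finite_imageI le_trans)
      then show False using assms by simp
    qed
    ultimately show ?thesis using carr[OF D] carr[OF E] carr[OF T] unfolding proper_part_def by blast
  qed
  have "quotient_le n ?v x" if x: "x \<in> ?S" for x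
  proof -
    obtain P where P: "partition_on ?A P" "x = young_orbit [n] P"
      using x by (auto simp: proper_part_def quotient_carrier_def set_partitions_def)
    have "quotient_le n (young_orbit [n] D) y" if "y \<in> quotient_carrier n [n]" for y
      using that bot self by (fastforce simp: quotient_carrier_def set_partitions_def quotient_le_def)
    then have "P \<noteq> D" using x P(2) by (auto simp: proper_part_def)
    then show ?thesis using above P by blast
  qed
  then have "insert ?v \<sigma> \<in> order_complex (quotient_carrier n [n]) (quotient_le n)"
    if "\<sigma> \<in> order_complex (quotient_carrier n [n]) (quotient_le n)" for \<sigma>
    using that v by (auto simp: order_complex_eq chain_complex_def)
  then have "collapses (order_complex (quotient_carrier n [n]) (quotient_le n)) {{}, {?v}}"
    by (intro collapses_cone complex_quotient)
  then show ?thesis unfolding collapsible_def by blast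
qed

section \<open>Realization of collapses\<close>

definition carrier_face :: "('v \<Rightarrow> real) \<Rightarrow> 'v set" where
  "carrier_face a = {v. a v \<noteq> 0}"

definition bary_points :: "'v set set \<Rightarrow> ('v \<Rightarrow> real) set" where
  "bary_points K = {a. (\<forall>v. 0 \<le> a v) \<and> carrier_face a \<in> K \<and> (\<Sum>v\<in>carrier_face a. a v) = 1}"

text \<open>The closed simplex on \<open>\<sigma>\<close>, regardless of any complex; the support of
  a point tells in which open face it lies.\<close>

definition face_points :: "'v set \<Rightarrow> ('v \<Rightarrow> real) set" where
  "face_points \<sigma> = {a. (\<forall>v. 0 \<le> a v) \<and> (\<forall>v. v \<notin> \<sigma> \<longrightarrow> a v = 0) \<and> sum a \<sigma> = 1}"

lemma geometric_realization_eq: "geometric_realization K = top_of_set (bary_points K)"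
  by (simp add: geometric_realization_def bary_points_def carrier_face_def)

lemma carrier_face_subset: "a \<in> face_points \<sigma> \<Longrightarrow> carrier_face a \<subseteq> \<sigma>"
  by (auto simp: face_points_def carrier_face_def)

lemma sum_carrier_face: "finite \<sigma> \<Longrightarrow> carrier_face a \<subseteq> \<sigma> \<Longrightarrow> (\<Sum>v\<in>carrier_face a. a v) = sum a \<sigma>"
  by (rule sum.mono_neutral_left) (auto simp: carrier_face_def)

lemma face_points_bary_iff:
  assumes "finite \<sigma>" "a \<in> face_points \<sigma>"
  shows "a \<in> bary_points K \<longleftrightarrow> carrier_face a \<in> K"
  using sum_carrier_face[OF assms(1) carrier_face_subset[OF assms(2)]] assms(2)
  by (simp add: bary_points_def face_points_def)

lemma bary_points_carrier: "a \<in> bary_points K \<Longrightarrow> a \<in> face_points (carrier_face a)"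
  by (auto simp: bary_points_def face_points_def carrier_face_def)

lemma bary_points_face: "a \<in> bary_points K \<Longrightarrow> carrier_face a \<in> K"
  by (simp add: bary_points_def)

lemma face_points_mono:
  assumes "\<sigma> \<subseteq> \<tau>" "finite \<tau>" "a \<in> face_points \<sigma>" shows "a \<in> face_points \<tau>"
proof -
  have "sum a \<sigma> = sum a \<tau>" using assms by (intro sum.mono_neutral_left) (auto simp: face_points_def)
  then show ?thesis using assms by (auto simp: face_points_def)
qed

lemma face_points_subset_bary:
  assumes "complex K" "\<sigma> \<in> K" shows "face_points \<sigma> \<subseteq> bary_points K"
proof
  fix a assume a: "a \<in> face_points \<sigma>"
  then show "a \<in> bary_points K"
    using face_points_bary_iff[OF complex_finite_face[OF assms] a] complex_face[OF assms carrier_face_subset[OF a]]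
    by simp
qed

lemma bary_points_eq_Union:
  assumes "complex K" shows "bary_points K = (\<Union>\<sigma>\<in>K. face_points \<sigma>)"
  using face_points_subset_bary[OF assms] bary_points_carrier bary_points_face by blast

lemma closed_face_points: "closed (face_points \<sigma>)"
proof -
  have cont: "continuous_on UNIV (\<lambda>a::'a \<Rightarrow> real. a v)" for v by simp
  have "closed {a::'a \<Rightarrow> real. \<forall>v. 0 \<le> a v}"
    by (intro closed_Collect_all closed_Collect_le continuous_on_const cont)
  moreover have "closed {a::'a \<Rightarrow> real. \<forall>v. v \<notin> \<sigma> \<longrightarrow> a v = 0}"
    by (intro closed_Collect_all closed_Collect_imp closed_Collect_eq continuous_on_const cont) simp
  moreover have "closed {a::'a \<Rightarrow> real. sum a \<sigma> = 1}"
    by (intro closed_Collect_eq continuous_on_const continuous_on_sum cont)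
  moreover have "face_points \<sigma> = {a. \<forall>v. 0 \<le> a v} \<inter> {a. \<forall>v. v \<notin> \<sigma> \<longrightarrow> a v = 0} \<inter> {a. sum a \<sigma> = 1}"
    by (auto simp: face_points_def)
  ultimately show ?thesis by auto
qed

lemma compact_face_points:
  assumes "finite \<sigma>" shows "compact (face_points \<sigma>)"
proof -
  \<comment> \<open>Coordinates outside \<open>\<sigma>\<close> are pinned to 0, so the simplex lies
    in a product of compact sets even if the vertex type is infinite.\<close>
  let ?S = "\<lambda>v. if v \<in> \<sigma> then {0..1::real} else {0}"
  have "compactin (product_topology (\<lambda>v. euclidean) UNIV) (Pi\<^sub>E UNIV ?S)"
    unfolding compactin_PiE by auto
  then have "compact (Pi\<^sub>E UNIV ?S)" by (simp add: euclidean_product_topology)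
  then have "compact (Pi\<^sub>E UNIV ?S \<inter> face_points \<sigma>)" using closed_face_points by (rule compact_Int_closed)
  moreover have "face_points \<sigma> \<subseteq> Pi\<^sub>E UNIV ?S"
  proof
    fix a assume a: "a \<in> face_points \<sigma>"
    have "a v \<le> 1" if "v \<in> \<sigma>" for v
      using member_le_sum[OF that, of a] a assms by (auto simp: face_points_def)
    then show "a \<in> Pi\<^sub>E UNIV ?S" using a by (auto simp: face_points_def)
  qed
  ultimately show ?thesis by (simp add: Int_absorb1)
qed

lemma compact_bary_points: "complex K \<Longrightarrow> compact (bary_points K)"
  unfolding bary_points_eq_Union
  by (intro compact_UN complex_finite compact_face_points complex_finite_face)

lemma closed_bary_points: "complex K \<Longrightarrow> closed (bary_points K)"
  unfolding bary_points_eq_Union by (intro closed_UN complex_finite ballI closed_face_points)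

lemma continuous_on_Min_image:
  assumes "finite \<sigma>" "\<sigma> \<noteq> {}"
  shows "continuous_on S (\<lambda>a::'v \<Rightarrow> real. Min (a ` \<sigma>))"
  using assms
proof (induction rule: finite_ne_induct)
  case (singleton v)
  then show ?case by (simp add: continuous_on_subset[OF continuous_on_product_coordinates])
next
  case (insert v \<sigma>)
  have "continuous_on S (\<lambda>a::'v \<Rightarrow> real. min (a v) (Min (a ` \<sigma>)))"
    using insert.IH by (intro continuous_on_min continuous_on_subset[OF continuous_on_product_coordinates]) auto
  then show ?case using insert.hyps by simp
qed

lemma elementary_collapse_complex:
  assumes "complex K" "elementary_collapse K L" shows "complex L"
proof -
  obtain \<sigma> \<tau> where s: "\<sigma> \<noteq> {}" "\<sigma> \<subset> \<tau>" and m: "\<forall>\<rho>\<in>K. \<sigma> \<subset> \<rho> \<longrightarrow> \<rho> = \<tau>" and L: "L = K - {\<sigma>, \<tau>}"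
    using assms(2) unfolding elementary_collapse_def by (elim exE conjE)
  show ?thesis unfolding complex_def
  proof (intro conjI ballI allI impI)
    show "finite (\<Union>L)" using assms(1) unfolding complex_def L by (meson Diff_subset Union_mono finite_subset)
    show "{} \<in> L" using assms(1) s unfolding complex_def L by blast
    fix \<rho> \<rho>' assume r: "\<rho> \<in> L" "\<rho>' \<subseteq> \<rho>"
    then have "\<rho> \<in> K" "\<rho>' \<in> K" using complex_face[OF assms(1)] L by blast+
    \<comment> \<open>A face of \<open>L\<close> above \<open>\<sigma>\<close> or
      \<open>\<tau>\<close> would be a face of \<open>K\<close> properly above
      \<open>\<sigma>\<close>, hence \<open>\<tau>\<close> itself, which is not in
      \<open>L\<close>.\<close>
    moreover have "\<rho>' \<noteq> \<sigma>" "\<rho>' \<noteq> \<tau>" using m r s(2) L \<open>\<rho> \<in> K\<close> by blast+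
    ultimately show "\<rho>' \<in> L" using L by blast
  qed
qed

text \<open>The retraction pushes a point of the free face \<open>\<sigma>\<close>, or of its unique coface \<open>insert u \<sigma>\<close>,
  towards \<open>u\<close> until one of the coordinates in \<open>\<sigma>\<close> vanishes.\<close>

lemma elementary_collapse_homotopy_equivalent:
  assumes K: "complex K" and "elementary_collapse K L"
  shows "geometric_realization K homotopy_equivalent_space geometric_realization L"
proof -
  obtain \<sigma> \<tau> where s: "\<sigma> \<in> K" "\<tau> \<in> K" "\<sigma> \<noteq> {}" "\<sigma> \<subset> \<tau>" "card \<tau> = Suc (card \<sigma>)"
    and m: "\<forall>\<rho>\<in>K. \<sigma> \<subset> \<rho> \<longrightarrow> \<rho> = \<tau>" and L: "L = K - {\<sigma>, \<tau>}"
    using assms(2) unfolding elementary_collapse_def by (elim exE conjE)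
  have fin: "finite \<sigma>" "finite \<tau>" using complex_finite_face[OF K] s(1,2) by blast+
  have "card (\<tau> - \<sigma>) = 1" using s(4,5) fin card_Diff_subset[OF fin(1), of \<tau>] by auto
  then obtain u where u: "\<tau> - \<sigma> = {u}" by (rule card_1_singletonE)
  then have u\<tau>: "\<tau> = insert u \<sigma>" "u \<notin> \<sigma>" using s(4) by auto
  have L': "complex L" using elementary_collapse_complex[OF assms] .
  define \<mu> where "\<mu> a = Min (a ` \<sigma>)" for a :: "'a \<Rightarrow> real"
  \<comment> \<open>The amount \<open>t * \<mu> a\<close> taken from each vertex of
    \<open>\<sigma>\<close> is given to \<open>u\<close>, whence the factor
    \<open>card \<sigma>\<close>; the sum of the coordinates stays 1.\<close>
  define r where "r t a = (\<lambda>v. if v \<in> \<sigma> then a v - t * \<mu> a else if v = u then a v + t * card \<sigma> * \<mu> a else a v)"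
    for t and a :: "'a \<Rightarrow> real"
  have \<mu>_le: "\<mu> a \<le> a v" if "v \<in> \<sigma>" for a v using that fin by (simp add: \<mu>_def)
  have \<mu>_in: "\<exists>v\<in>\<sigma>. a v = \<mu> a" for a
  proof -
    have "Min (a ` \<sigma>) \<in> a ` \<sigma>" using fin s(3) by (intro Min_in) auto
    then show ?thesis unfolding \<mu>_def by force
  qed
  have \<mu>_nonneg: "\<mu> a \<ge> 0" if "a \<in> bary_points K" for a
  proof -
    obtain v where "a v = \<mu> a" using \<mu>_in by blast
    moreover have "0 \<le> a v" using that by (simp add: bary_points_def)
    ultimately show ?thesis by simp
  qed
  have r_id: "r t a = a" if "\<mu> a = 0" for t a using that by (auto simp: r_def)
  \<comment> \<open>A nonzero minimum on \<open>\<sigma>\<close> means that the support contains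
    \<open>\<sigma>\<close>, and the only faces that do are \<open>\<sigma>\<close> and
    \<open>\<tau>\<close>. Hence nothing moves on \<open>L\<close>.\<close>
  have carr: "carrier_face a = \<sigma> \<or> carrier_face a = \<tau>" if "a \<in> bary_points K" "\<mu> a \<noteq> 0" for a
  proof -
    have "\<mu> a > 0" using \<mu>_nonneg[OF that(1)] that(2) by simp
    then have "0 < a v" if "v \<in> \<sigma>" for v using \<mu>_le[OF that, of a] by simp
    then have "\<sigma> \<subseteq> carrier_face a" by (fastforce simp: carrier_face_def)
    then show ?thesis using m bary_points_face[OF that(1)] by blast
  qed
  have \<mu>_L: "\<mu> a = 0" if "a \<in> bary_points L" for a
  proof (rule ccontr)
    assume "\<mu> a \<noteq> 0"
    moreover have "a \<in> bary_points K" using that by (simp add: bary_points_def L)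
    ultimately show False using carr bary_points_face[OF that] L by blast
  qed
  have r_face: "r t a \<in> face_points \<tau>" if a: "a \<in> bary_points K" "\<mu> a \<noteq> 0" and t: "t \<in> {0..1}" for t a
  proof -
    have a\<tau>: "a \<in> face_points \<tau>"
      using carr[OF a] bary_points_carrier[OF a(1)] face_points_mono s(4) fin(2) by (metis psubset_imp_subset)
    have "t * \<mu> a \<le> 1 * \<mu> a" using t \<mu>_nonneg[OF a(1)] by (intro mult_right_mono) auto
    then have "t * \<mu> a \<le> a v" if "v \<in> \<sigma>" for v using \<mu>_le[OF that, of a] by simp
    moreover have "0 \<le> t * card \<sigma> * \<mu> a" using t \<mu>_nonneg[OF a(1)] by simp
    ultimately have "\<forall>v. 0 \<le> r t a v" using a\<tau> by (auto simp: r_def face_points_def)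
    moreover have "\<forall>v. v \<notin> \<tau> \<longrightarrow> r t a v = 0" using a\<tau> u\<tau> by (auto simp: r_def face_points_def)
    moreover have "sum (r t a) \<tau> = 1"
    proof -
      have "sum (r t a) \<sigma> = (\<Sum>v\<in>\<sigma>. a v - t * \<mu> a)" by (rule sum.cong) (auto simp: r_def)
      also have "\<dots> = sum a \<sigma> - t * card \<sigma> * \<mu> a" by (simp add: sum_subtractf)
      finally have "sum (r t a) \<sigma> = sum a \<sigma> - t * card \<sigma> * \<mu> a" .
      moreover have "r t a u = a u + t * card \<sigma> * \<mu> a" using u\<tau> by (simp add: r_def)
      moreover have "sum a \<tau> = 1" using a\<tau> by (simp add: face_points_def)
      ultimately show ?thesis using u\<tau> fin(1) by simp
    qed
    ultimately show ?thesis by (simp add: face_points_def)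
  qed
  have r_K: "r t a \<in> bary_points K" if "a \<in> bary_points K" "t \<in> {0..1}" for t a
    using that r_id r_face face_points_subset_bary[OF K s(2)] by (cases "\<mu> a = 0") auto
  \<comment> \<open>At time 1 the smallest coordinate in \<open>\<sigma>\<close> is used up, so the
    support no longer contains \<open>\<sigma>\<close>.\<close>
  have r_L: "r 1 a \<in> bary_points L" if a: "a \<in> bary_points K" for a
  proof -
    obtain v where v: "v \<in> \<sigma>" "a v = \<mu> a" using \<mu>_in by blast
    then have "r 1 a v = 0" by (simp add: r_def)
    then have "\<not> \<sigma> \<subseteq> carrier_face (r 1 a)" using v by (auto simp: carrier_face_def)
    then have "carrier_face (r 1 a) \<noteq> \<sigma>" "carrier_face (r 1 a) \<noteq> \<tau>" using s(4) by auto
    then show ?thesis using r_K[OF a, of 1] by (simp add: bary_points_def L)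
  qed
  have coord: "continuous_on S (\<lambda>p. snd p v)" for S :: "(real \<times> ('a \<Rightarrow> real)) set" and v
    by (rule continuous_on_product_then_coordinatewise) (intro continuous_intros)
  have "continuous_on S (\<lambda>p. \<mu> (snd p))" for S :: "(real \<times> ('a \<Rightarrow> real)) set"
    unfolding \<mu>_def
    by (rule continuous_on_compose2[OF continuous_on_Min_image[OF fin(1) s(3), of UNIV]]) (auto intro: continuous_intros)
  note \<mu>_cont = this
  have "continuous_on S (\<lambda>p. r (fst p) (snd p))" for S :: "(real \<times> ('a \<Rightarrow> real)) set"
  proof (rule continuous_on_coordinatewise_then_product)
    fix v
    consider "v \<in> \<sigma>" | "v = u" "v \<notin> \<sigma>" | "v \<notin> \<sigma>" "v \<noteq> u" by blast
    then show "continuous_on S (\<lambda>p. r (fst p) (snd p) v)"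
      by cases (auto simp: r_def intro!: continuous_intros coord \<mu>_cont)
  qed
  note r_cont = this
  have "continuous_on (bary_points K) (\<lambda>a. (1::real, a))" by (intro continuous_intros)
  from continuous_on_compose2[OF r_cont[of UNIV] this]
  have r1_cont: "continuous_on (bary_points K) (r 1)" by simp
  have "homotopic_with (\<lambda>x. True) (top_of_set (bary_points K)) (top_of_set (bary_points K)) id (r 1)"
    unfolding homotopic_with_def
  proof (intro exI conjI allI ballI)
    show "continuous_map (prod_topology (top_of_set {0..1}) (top_of_set (bary_points K)))
       (top_of_set (bary_points K)) (\<lambda>p. r (fst p) (snd p))"
      using r_cont r_K by auto
    show "r (fst (0, x)) (snd (0, x)) = id x" for x by (auto simp: r_def)
  qed auto
  then have "homotopic_with (\<lambda>x. True) (top_of_set (bary_points K)) (top_of_set (bary_points K)) (r 1) id"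
    by (rule homotopic_with_symD)
  moreover have "retraction_maps (top_of_set (bary_points K)) (top_of_set (bary_points L)) (r 1) id"
    unfolding retraction_maps_def using r1_cont r_L r_id[OF \<mu>_L]
    by (auto simp: bary_points_def L)
  ultimately show ?thesis unfolding geometric_realization_eq
    by (rule deformation_retract_imp_homotopy_equivalent_space)
qed

lemma contractible_collapses:
  assumes "complex K" "collapses K {{}, {w}}"
  shows "contractible_space (geometric_realization K)"
proof -
  have *: "complex L \<and> geometric_realization K homotopy_equivalent_space geometric_realization L"
    if "collapses K L" for L
    using that
  proof induction
    case base
    then show ?case using assms(1) by (simp add: homotopy_equivalent_space_refl)
  next
    case (step L L')
    then show ?case
      using elementary_collapse_complex elementary_collapse_homotopy_equivalent homotopy_eqv_trans by blast
  qed
  have "bary_points {{}, {w}} \<subseteq> {\<lambda>v. if v = w then 1 else 0}"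
  proof
    fix a assume a: "a \<in> bary_points {{}, {w}}"
    then have "carrier_face a = {w}" by (auto simp: bary_points_def)
    then have "a w = 1" "\<And>v. v \<noteq> w \<Longrightarrow> a v = 0"
      using a by (auto simp: bary_points_def carrier_face_def)
    then show "a \<in> {\<lambda>v. if v = w then 1 else 0}" by auto
  qed
  then have "contractible_space (geometric_realization {{}, {w}})"
    by (intro contractible_space_subset_singleton) (simp add: geometric_realization_eq)
  then show ?thesis using *[OF assms(2)] homotopy_equivalent_space_contractibility by blast
qed

section \<open>Quotient maps that are homotopy equivalences\<close>

text \<open>At time 1 the homotopy is constant on the fibres of \<open>f\<close> and factors through
  \<open>W\<close> as \<open>g\<close>. Then \<open>G\<close> itself joins the identity to
  \<open>g \<circ> f\<close>, and the map that it induces on \<open>W\<close> joins the identity to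
  \<open>f \<circ> g\<close>.\<close>

lemma homotopy_equivalent_quotient:
  fixes G :: "real \<times> 'a \<Rightarrow> 'a"
  assumes f: "quotient_map X W f"
    and G: "continuous_map (prod_topology (top_of_set {0..1}) X) X G"
    and G0: "\<And>x. x \<in> topspace X \<Longrightarrow> G (0, x) = x"
    and G1: "\<And>x y. x \<in> topspace X \<Longrightarrow> y \<in> topspace X \<Longrightarrow> f x = f y \<Longrightarrow> G (1, x) = G (1, y)"
    and Gf: "\<And>t x y. t \<in> {0..1} \<Longrightarrow> x \<in> topspace X \<Longrightarrow> y \<in> topspace X \<Longrightarrow> f x = f y \<Longrightarrow>
      f (G (t, x)) = f (G (t, y))"
  shows "X homotopy_equivalent_space W"
proof -
  let ?I = "top_of_set {0..1::real}"
  have "continuous_map X (prod_topology ?I X) (\<lambda>x. (1, x))"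
    by (auto simp: continuous_map_pairwise comp_def)
  then have "continuous_map X X (\<lambda>x. G (1, x))"
    using continuous_map_compose[OF _ G] by (simp add: comp_def)
  then obtain g where g: "continuous_map W X g" "\<And>x. x \<in> topspace X \<Longrightarrow> g (f x) = G (1, x)"
    by (rule quotient_map_lift_exists[OF f _ G1]) (simp_all add: that)
  have cf: "continuous_map X W f" using f by (rule quotient_imp_continuous_map)
  have surj: "f ` topspace X = topspace W" using f by (rule quotient_imp_surjective_map)
  \<comment> \<open>For \<open>G\<close> to descend, the product of \<open>f\<close> with the
    interval has to be a quotient map; this holds because the interval is locally compact.\<close>
  have q: "quotient_map (prod_topology ?I X) (prod_topology ?I W) (\<lambda>(t, x). (t, f x))"
  proof (rule quotient_map_prod_right[OF _ _ f])
    show "locally_compact_space ?I" by (intro compact_imp_locally_compact_space) (simp add: compact_space_subtopology)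
    show "Hausdorff_space ?I \<or> regular_space ?I" by (simp add: Hausdorff_space_subtopology)
  qed
  have "continuous_map (prod_topology ?I X) W (f \<circ> G)" using G cf by (rule continuous_map_compose)
  moreover have "(f \<circ> G) p = (f \<circ> G) p'"
    if "p \<in> topspace (prod_topology ?I X)" "p' \<in> topspace (prod_topology ?I X)"
      "(case p of (t, x) \<Rightarrow> (t, f x)) = (case p' of (t, x) \<Rightarrow> (t, f x))" for p p'
    using that Gf[of "fst p" "snd p" "snd p'"] by (cases p, cases p') auto
  ultimately obtain F where F: "continuous_map (prod_topology ?I W) W F"
    "\<And>p. p \<in> topspace (prod_topology ?I X) \<Longrightarrow> F (case p of (t, x) \<Rightarrow> (t, f x)) = (f \<circ> G) p"
    by (rule quotient_map_lift_exists[OF q]) (simp_all add: that)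
  have "homotopic_with (\<lambda>h. True) X X id (g \<circ> f)"
    by (subst homotopic_with) (use G G0 g in auto)
  moreover have "homotopic_with (\<lambda>h. True) W W id (f \<circ> g)"
  proof (subst homotopic_with)
    have F': "F (t, f x) = f (G (t, x))" if "t \<in> {0..1}" "x \<in> topspace X" for t x
      using F(2)[of "(t, x)"] that by simp
    show "\<exists>h. continuous_map (prod_topology ?I W) W h \<and> (\<forall>x\<in>topspace W. h (0, x) = id x) \<and>
        (\<forall>x\<in>topspace W. h (1, x) = (f \<circ> g) x) \<and> (\<forall>t\<in>{0..1}. True)"
      unfolding surj[symmetric] using F(1) F' G0 g(2) by (intro exI[of _ F]) auto
  qed simp
  ultimately have "homotopic_with (\<lambda>h. True) X X (g \<circ> f) id" "homotopic_with (\<lambda>h. True) W W (f \<circ> g) id"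
    by (simp_all only: homotopic_with_symD)
  then show ?thesis
    unfolding homotopy_equivalent_space_def using cf g(1) by (intro exI conjI)
qed

section \<open>The open simplex and the sphere\<close>

text \<open>Offset from the barycentre, all of whose coordinates are \<open>1 / (d + 1)\<close>. The
  offsets sum to 0 on the simplex, so those with index 1 to \<open>d\<close> are already coordinates
  of affine space, and index 0 is free to serve as the height on the sphere.\<close>

definition sx_off :: "nat \<Rightarrow> (nat \<Rightarrow> real) \<Rightarrow> nat \<Rightarrow> real" where
  "sx_off d b i = b i - 1 / (real d + 1)"

definition sx_sq :: "nat \<Rightarrow> (nat \<Rightarrow> real) \<Rightarrow> real" where
  "sx_sq d b = (\<Sum>i=1..d. (sx_off d b i)\<^sup>2)"

definition sx_min :: "nat \<Rightarrow> (nat \<Rightarrow> real) \<Rightarrow> real" where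
  "sx_min d b = Min (b ` {..d})"

text \<open>Inverse stereographic projection after the radial stretching \<open>sx_off d b / sx_min d b\<close>,
  which maps the open simplex onto affine space; the boundary is sent to the base point.\<close>

definition to_sphere :: "nat \<Rightarrow> (nat \<Rightarrow> real) \<Rightarrow> nat \<Rightarrow> real" where
  "to_sphere d b i =
     (if i = 0 then (sx_sq d b - (sx_min d b)\<^sup>2) / (sx_sq d b + (sx_min d b)\<^sup>2)
      else if i \<le> d then 2 * sx_off d b i * sx_min d b / (sx_sq d b + (sx_min d b)\<^sup>2) else 0)"

lemma topspace_nsphere: "topspace (nsphere d) = {x. (\<Sum>i\<le>d. (x i)\<^sup>2) = 1 \<and> (\<forall>i>d. x i = 0)}"
  by (simp add: nsphere)

lemma nsphere_eq: "nsphere d = top_of_set (topspace (nsphere d))"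
  by (simp add: nsphere euclidean_product_topology)

lemma sum_atMost_split: fixes d :: nat shows "(\<Sum>i\<le>d. g i) = g 0 + (\<Sum>i=1..d. g i :: real)"
proof -
  have "{..d} = insert 0 {1..d}" for d :: nat by auto
  then show ?thesis by simp
qed

lemma sx_min_le: "i \<le> d \<Longrightarrow> sx_min d b \<le> b i"
  by (simp add: sx_min_def)

lemma sx_min_in: "\<exists>i\<le>d. b i = sx_min d b"
proof -
  have "Min (b ` {..d}) \<in> b ` {..d}" by (intro Min_in) auto
  then show ?thesis unfolding sx_min_def by force
qed

lemma sum_sx_off: "b \<in> face_points {..d} \<Longrightarrow> (\<Sum>i\<le>d. sx_off d b i) = 0"
  by (simp add: sx_off_def sum_subtractf face_points_def)

lemma sx_sq_nonneg: "0 \<le> sx_sq d b"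
  by (simp add: sx_sq_def sum_nonneg)

text \<open>The sum of squares vanishes only at the barycentre, and there the least coordinate is
  positive.\<close>

lemma sx_denom_pos:
  assumes b: "b \<in> face_points {..d}"
  shows "0 < sx_sq d b + (sx_min d b)\<^sup>2"
proof (rule ccontr)
  assume "\<not> ?thesis"
  then have "sx_sq d b = 0" "sx_min d b = 0"
    using sx_sq_nonneg[of d b] zero_le_power2[of "sx_min d b"] by (smt (verit) power2_eq_iff zero_power2)+
  then have 1: "sx_off d b i = 0" if "1 \<le> i" "i \<le> d" for i
    using that by (simp add: sx_sq_def sum_nonneg_eq_0_iff)
  then have "sx_off d b 0 = 0" using sum_sx_off[OF b] by (simp add: sum_atMost_split)
  then have "sx_off d b i = 0" if "i \<le> d" for i using 1[of i] that by (cases "i = 0") auto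
  then have "b i > 0" if "i \<le> d" for i using that by (fastforce simp: sx_off_def)
  then show False using sx_min_in[of d b] \<open>sx_min d b = 0\<close> by force
qed

lemma to_sphere_in:
  assumes b: "b \<in> face_points {..d}"
  shows "to_sphere d b \<in> topspace (nsphere d)"
proof -
  let ?S = "sx_sq d b" and ?m = "sx_min d b"
  define N where "N = ?S + ?m\<^sup>2"
  have N: "N > 0" using sx_denom_pos[OF b] by (simp add: N_def)
  have "(\<Sum>i=1..d. (to_sphere d b i)\<^sup>2) = (\<Sum>i=1..d. (sx_off d b i)\<^sup>2 * (4 * ?m\<^sup>2 / N\<^sup>2))"
    by (intro sum.cong) (auto simp: to_sphere_def N_def power_divide power_mult_distrib)
  also have "\<dots> = ?S * (4 * ?m\<^sup>2 / N\<^sup>2)" unfolding sx_sq_def sum_distrib_right ..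
  finally have "(\<Sum>i\<le>d. (to_sphere d b i)\<^sup>2) = ((?S - ?m\<^sup>2) / N)\<^sup>2 + ?S * (4 * ?m\<^sup>2 / N\<^sup>2)"
    by (simp add: sum_atMost_split to_sphere_def N_def)
  also have "\<dots> = ((?S - ?m\<^sup>2)\<^sup>2 + 4 * ?S * ?m\<^sup>2) / N\<^sup>2" by (simp add: power_divide add_divide_distrib)
  also have "(?S - ?m\<^sup>2)\<^sup>2 + 4 * ?S * ?m\<^sup>2 = N\<^sup>2" by (simp add: N_def power2_eq_square algebra_simps)
  finally show ?thesis using N by (auto simp: topspace_nsphere to_sphere_def)
qed

lemma sphere_base_iff: "x \<in> topspace (nsphere d) \<Longrightarrow> x = sphere_base \<longleftrightarrow> x 0 = 1"
proof
  assume x: "x \<in> topspace (nsphere d)" "x 0 = 1"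
  then have "(\<Sum>i=1..d. (x i)\<^sup>2) = 0" by (simp add: topspace_nsphere sum_atMost_split)
  then have "x i = 0" if "1 \<le> i" "i \<le> d" for i using that by (simp add: sum_nonneg_eq_0_iff)
  then have "x i = 0" if "i \<noteq> 0" for i using x(1) that by (cases "i \<le> d") (auto simp: topspace_nsphere)
  then show "x = sphere_base" using x(2) by (auto simp: sphere_base_def)
qed (simp add: sphere_base_def)

lemma to_sphere_base_iff:
  assumes b: "b \<in> face_points {..d}"
  shows "to_sphere d b = sphere_base \<longleftrightarrow> sx_min d b = 0"
proof -
  have "to_sphere d b 0 = 1 \<longleftrightarrow> sx_sq d b - (sx_min d b)\<^sup>2 = sx_sq d b + (sx_min d b)\<^sup>2"
    using sx_denom_pos[OF b] by (simp add: to_sphere_def)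
  then show ?thesis unfolding sphere_base_iff[OF to_sphere_in[OF b]] by simp
qed

text \<open>The stretched offset determines its scale. At an index where \<open>b\<close> attains
  its minimum \<open>m\<close>, with stretched offset \<open>z\<close>, one has
  \<open>m * (1 - z) = 1 / (d + 1)\<close>, while for the minimum \<open>m'\<close> of
  \<open>b'\<close> only \<open>m' * (1 - z) \<le> 1 / (d + 1)\<close> is known; and
  \<open>1 - z\<close> is positive. Exchanging the roles gives equality.\<close>

lemma to_sphere_inj_aux:
  assumes b: "b \<in> face_points {..d}" "sx_min d b > 0" and b': "b' \<in> face_points {..d}" "sx_min d b' > 0"
    and eq: "\<And>i. i \<le> d \<Longrightarrow> sx_off d b i / sx_min d b = sx_off d b' i / sx_min d b'"
  shows "sx_min d b' \<le> sx_min d b"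
proof -
  let ?m = "sx_min d b" and ?m' = "sx_min d b'"
  obtain i where i: "i \<le> d" "b i = ?m" using sx_min_in by blast
  define z where "z = sx_off d b i / ?m"
  have "?m = 1 / (real d + 1) + ?m * z" using i(2) b(2) by (simp add: z_def sx_off_def)
  then have 1: "?m * (1 - z) = 1 / (real d + 1)" by (simp add: algebra_simps)
  have "z = sx_off d b' i / ?m'" using eq[OF i(1)] by (simp add: z_def)
  then have "b' i = 1 / (real d + 1) + ?m' * z" using b'(2) by (simp add: sx_off_def)
  then have "?m' \<le> 1 / (real d + 1) + ?m' * z" using sx_min_le[OF i(1), of b'] by simp
  then have 2: "?m' * (1 - z) \<le> 1 / (real d + 1)" by (simp add: algebra_simps)
  have "0 < ?m * (1 - z)" unfolding 1 by simp
  then have "0 < 1 - z" using b(2) by (simp add: zero_less_mult_iff)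
  moreover have "?m' * (1 - z) \<le> ?m * (1 - z)" using 1 2 by simp
  ultimately show ?thesis by simp
qed

lemma to_sphere_inj:
  assumes b: "b \<in> face_points {..d}" "sx_min d b > 0" and b': "b' \<in> face_points {..d}" "sx_min d b' > 0"
    and eq: "to_sphere d b = to_sphere d b'"
  shows "b = b'"
proof -
  \<comment> \<open>Stereographic projection from the base point recovers the stretched
    offset.\<close>
  have ratio: "sx_off d c i / sx_min d c = to_sphere d c i / (1 - to_sphere d c 0)"
    if c: "c \<in> face_points {..d}" "sx_min d c > 0" and i: "1 \<le> i" "i \<le> d" for c i
  proof -
    have "1 - to_sphere d c 0 = 2 * (sx_min d c)\<^sup>2 / (sx_sq d c + (sx_min d c)\<^sup>2)"
      using sx_denom_pos[OF c(1)] by (simp add: to_sphere_def field_simps)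
    then show ?thesis using sx_denom_pos[OF c(1)] c(2) i
      by (simp add: to_sphere_def power2_eq_square)
  qed
  have z: "sx_off d b i / sx_min d b = sx_off d b' i / sx_min d b'" if i: "i \<le> d" for i
  proof (cases "i = 0")
    case False
    then show ?thesis using ratio[OF b, of i] ratio[OF b', of i] i eq by simp
  next
    case True
    have z0: "sx_off d c 0 / sx_min d c = - (\<Sum>i=1..d. sx_off d c i / sx_min d c)"
      if "c \<in> face_points {..d}" for c
      using sum_sx_off[OF that] by (simp add: sum_atMost_split add_eq_0_iff2 flip: sum_divide_distrib)
    have "(\<Sum>i=1..d. sx_off d b i / sx_min d b) = (\<Sum>i=1..d. sx_off d b' i / sx_min d b')"
      using ratio[OF b] ratio[OF b'] eq by (intro sum.cong) auto
    then show ?thesis using z0[OF b(1)] z0[OF b'(1)] True by simp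
  qed
  have "sx_min d b = sx_min d b'"
    using to_sphere_inj_aux[OF b b' z] to_sphere_inj_aux[OF b' b z[symmetric]] by simp
  then have "sx_off d b i = sx_off d b' i" if "i \<le> d" for i using z[OF that] b(2) b'(2) by simp
  then have "b i = b' i" if "i \<le> d" for i using that by (simp add: sx_off_def)
  moreover have "b i = b' i" if "\<not> i \<le> d" for i using that b(1) b'(1) by (auto simp: face_points_def)
  ultimately show ?thesis by blast
qed

lemma to_sphere_surj:
  assumes x: "x \<in> topspace (nsphere d)" "x \<noteq> sphere_base"
  shows "\<exists>b\<in>face_points {..d}. sx_min d b > 0 \<and> to_sphere d b = x"
proof -
  have sq: "(x 0)\<^sup>2 + (\<Sum>i=1..d. (x i)\<^sup>2) = 1" using x(1) by (simp add: topspace_nsphere sum_atMost_split)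
  have "(x 0)\<^sup>2 \<le> 1" using sq sum_nonneg[of "{1..d}" "\<lambda>i. (x i)\<^sup>2"] by simp
  then have "x 0 \<le> 1" by (simp add: abs_square_le_1 abs_le_iff)
  then have x0: "x 0 < 1" using x sphere_base_iff[OF x(1)] by simp
  \<comment> \<open>Stereographic projection of \<open>x\<close>; the entry at 0 is chosen to make
    the sum vanish.\<close>
  define z where "z i = (if i = 0 then - (\<Sum>i=1..d. x i / (1 - x 0)) else x i / (1 - x 0))" for i
  have z0: "(\<Sum>i\<le>d. z i) = 0"
  proof -
    have "(\<Sum>i=1..d. z i) = (\<Sum>i=1..d. x i / (1 - x 0))" by (intro sum.cong) (auto simp: z_def)
    then show ?thesis by (simp add: sum_atMost_split) (simp add: z_def)
  qed
  define m where "m = sx_min d z"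
  have "m \<le> 0"
  proof (rule ccontr)
    assume "\<not> m \<le> 0"
    then have "0 < z i" if "i \<le> d" for i using sx_min_le[OF that, of z] by (simp add: m_def)
    then have "0 < (\<Sum>i\<le>d. z i)" by (intro sum_pos) auto
    then show False using z0 by simp
  qed
  \<comment> \<open>The solution of \<open>1 / (d + 1) + \<mu> * m = \<mu>\<close>: the point at
    offset \<open>\<mu> * z\<close> from the barycentre then has least coordinate
    \<open>\<mu>\<close>, so its stretched offset is \<open>z\<close>.\<close>
  define \<mu> where "\<mu> = 1 / ((real d + 1) * (1 - m))"
  have \<mu>: "\<mu> > 0" using \<open>m \<le> 0\<close> by (simp add: \<mu>_def)
  have \<mu>m: "1 / (real d + 1) + \<mu> * m = \<mu>"
  proof -
    have "\<mu> * (1 - m) = 1 / (real d + 1)" using \<open>m \<le> 0\<close> by (simp add: \<mu>_def)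
    then show ?thesis by (simp add: algebra_simps)
  qed
  define b where "b i = (if i \<le> d then 1 / (real d + 1) + \<mu> * z i else 0)" for i
  have off: "sx_off d b i = \<mu> * z i" if "i \<le> d" for i using that by (simp add: sx_off_def b_def)
  have ge: "\<mu> \<le> b i" if "i \<le> d" for i
  proof -
    have "\<mu> * m \<le> \<mu> * z i" using \<mu> sx_min_le[OF that, of z] by (simp add: m_def)
    then show ?thesis using \<mu>m that by (simp add: b_def)
  qed
  have min: "sx_min d b = \<mu>"
  proof (rule antisym)
    obtain i where "i \<le> d" "z i = m" using sx_min_in[of d z] by (auto simp: m_def)
    then have "b i = \<mu>" using \<mu>m by (simp add: b_def)
    then show "sx_min d b \<le> \<mu>" using sx_min_le[OF \<open>i \<le> d\<close>, of b] by simp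
    show "\<mu> \<le> sx_min d b" using ge sx_min_in[of d b] by force
  qed
  have b_face: "b \<in> face_points {..d}"
  proof -
    have "sum b {..d} = (\<Sum>i\<le>d. 1 / (real d + 1) + \<mu> * z i)" by (intro sum.cong) (auto simp: b_def)
    also have "\<dots> = 1 + \<mu> * (\<Sum>i\<le>d. z i)" by (simp add: sum.distrib sum_distrib_left)
    finally have "sum b {..d} = 1" using z0 by simp
    moreover have "0 \<le> b i" for i using ge[of i] \<mu> by (cases "i \<le> d") (auto simp: b_def)
    ultimately show ?thesis by (auto simp: face_points_def b_def)
  qed
  have Z: "(\<Sum>i=1..d. (z i)\<^sup>2) = (1 + x 0) / (1 - x 0)"
  proof -
    have "(\<Sum>i=1..d. (z i)\<^sup>2) = (\<Sum>i=1..d. (x i)\<^sup>2) / (1 - x 0)\<^sup>2"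
      unfolding sum_divide_distrib by (intro sum.cong) (auto simp: z_def power_divide)
    also have "(\<Sum>i=1..d. (x i)\<^sup>2) = (1 + x 0) * (1 - x 0)" using sq by (simp add: power2_eq_square algebra_simps)
    finally show ?thesis using x0 by (simp add: power2_eq_square)
  qed
  have "sx_sq d b = (\<Sum>i=1..d. \<mu>\<^sup>2 * (z i)\<^sup>2)"
    unfolding sx_sq_def by (intro sum.cong) (auto simp: off power_mult_distrib)
  then have S: "sx_sq d b = \<mu>\<^sup>2 * ((1 + x 0) / (1 - x 0))" unfolding sum_distrib_left[symmetric] Z .
  have N: "sx_sq d b + (sx_min d b)\<^sup>2 = 2 * \<mu>\<^sup>2 / (1 - x 0)"
    unfolding S min using x0 by (simp add: field_simps)
  have "to_sphere d b i = x i" for i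
  proof -
    consider "i = 0" | "1 \<le> i" "i \<le> d" | "i > d" by linarith
    then show ?thesis
    proof cases
      case 1
      have "sx_sq d b - (sx_min d b)\<^sup>2 = x 0 * (2 * \<mu>\<^sup>2 / (1 - x 0))"
        unfolding S min using x0 by (simp add: field_simps)
      then show ?thesis using 1 x0 \<mu> by (simp add: to_sphere_def N)
    next
      case 2
      then have "to_sphere d b i = 2 * (\<mu> * z i) * \<mu> / (2 * \<mu>\<^sup>2 / (1 - x 0))"
        unfolding to_sphere_def N by (simp add: off min)
      then show ?thesis using 2 x0 \<mu> by (simp add: z_def power2_eq_square)
    next
      case 3
      then show ?thesis using x(1) by (simp add: to_sphere_def topspace_nsphere)
    qed
  qed
  then show ?thesis using b_face min \<mu> by (intro bexI[of _ b]) auto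
qed

lemma continuous_on_to_sphere: "continuous_on (face_points {..d}) (to_sphere d)"
proof (rule continuous_on_coordinatewise_then_product)
  fix i
  have coord: "continuous_on S (\<lambda>b::nat \<Rightarrow> real. b j)" for S j
    by (rule continuous_on_subset[OF continuous_on_product_coordinates]) simp
  have min: "continuous_on S (sx_min d)" for S
    unfolding sx_min_def by (rule continuous_on_Min_image) auto
  have off: "continuous_on S (\<lambda>b. sx_off d b j)" for S j
    unfolding sx_off_def by (intro continuous_intros coord)
  have sq: "continuous_on S (sx_sq d)" for S
    unfolding sx_sq_def by (intro continuous_intros off)
  have "\<forall>b\<in>face_points {..d}. sx_sq d b + (sx_min d b)\<^sup>2 \<noteq> 0" using sx_denom_pos by fastforce
  then show "continuous_on (face_points {..d}) (\<lambda>b. to_sphere d b i)"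
    unfolding to_sphere_def by (cases "i = 0"; cases "i \<le> d") (auto intro!: continuous_intros min off sq)
qed

section \<open>The topology of the wedge\<close>

definition wedge_point :: "nat \<Rightarrow> (nat \<Rightarrow> real) \<Rightarrow> (nat \<times> (nat \<Rightarrow> real)) option" where
  "wedge_point i x = (if x = sphere_base then None else Some (i, x))"

lemma wedge_of_spheres_eq:
  "wedge_of_spheres m (int d) = quotient_topology (sum_topology (\<lambda>_. nsphere d) {..<m}) (\<lambda>(i, x). wedge_point i x)"
  by (simp add: wedge_of_spheres_def wedge_sum_def sphere_space_def wedge_point_def)

lemma topspace_wedge_of_spheres:
  "topspace (wedge_of_spheres m (int d)) = (\<lambda>(i, x). wedge_point i x) ` ({..<m} \<times> topspace (nsphere d))"
  by (simp add: wedge_of_spheres_eq comp_def)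

lemma continuous_wedge_point:
  assumes "i < m" shows "continuous_map (nsphere d) (wedge_of_spheres m (int d)) (wedge_point i)"
proof -
  have "continuous_map (nsphere d) (sum_topology (\<lambda>_. nsphere d) {..<m}) (\<lambda>x. (i, x))"
    using assms by (intro continuous_map_component_injection) simp
  moreover have "continuous_map (sum_topology (\<lambda>_. nsphere d) {..<m}) (wedge_of_spheres m (int d)) (\<lambda>(i, x). wedge_point i x)"
    unfolding wedge_of_spheres_eq by (rule quotient_imp_continuous_map[OF quotient_map_quotient_topology])
  ultimately show ?thesis using continuous_map_compose by (fastforce simp: comp_def)
qed

text \<open>A wedge of spheres embeds into the product of the spheres.\<close>

lemma Hausdorff_wedge_of_spheres: "Hausdorff_space (wedge_of_spheres m (int d))"
proof -
  let ?X = "sum_topology (\<lambda>_. nsphere d) {..<m}"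
  define E where "E p = (case p of None \<Rightarrow> (\<lambda>j. sphere_base)
     | Some (i, x) \<Rightarrow> (\<lambda>j. if j = i then x else sphere_base))" for p :: "(nat \<times> (nat \<Rightarrow> real)) option"
  let ?Y = "product_topology (\<lambda>j::nat. nsphere d) UNIV"
  have Eq: "E (wedge_point i x) = (\<lambda>j. if j = i then x else sphere_base)" for i x
    by (auto simp: E_def wedge_point_def)
  have base: "sphere_base \<in> topspace (nsphere d)" using in_topspace_nsphere by (simp add: sphere_base_def)
  have "continuous_map ?X ?Y (E \<circ> (\<lambda>(i, x). wedge_point i x))"
    unfolding continuous_map_def
  proof (intro conjI allI impI)
    show "E \<circ> (\<lambda>(i, x). wedge_point i x) \<in> topspace ?X \<rightarrow> topspace ?Y"
      using base by (auto simp: Eq)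
    fix U assume U: "openin ?Y U"
    have "openin (nsphere d) {x. (i, x) \<in> {p \<in> topspace ?X. (E \<circ> (\<lambda>(i, x). wedge_point i x)) p \<in> U}}"
      if "i < m" for i
    proof -
      have "continuous_map (nsphere d) ?Y (\<lambda>x j. if j = i then x else sphere_base)"
      proof (rule continuous_map_coordinatewise_then_product)
        show "continuous_map (nsphere d) (nsphere d) (\<lambda>x. if j = i then x else sphere_base)" for j
          using base by (cases "j = i") auto
      qed auto
      then have "openin (nsphere d) {x \<in> topspace (nsphere d). (\<lambda>j. if j = i then x else sphere_base) \<in> U}"
        using U by (rule openin_continuous_map_preimage)
      moreover have "{x. (i, x) \<in> {p \<in> topspace ?X. (E \<circ> (\<lambda>(i, x). wedge_point i x)) p \<in> U}} =
        {x \<in> topspace (nsphere d). (\<lambda>j. if j = i then x else sphere_base) \<in> U}"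
        using that by (auto simp: Eq)
      ultimately show ?thesis by simp
    qed
    then show "openin ?X {p \<in> topspace ?X. (E \<circ> (\<lambda>(i, x). wedge_point i x)) p \<in> U}"
      unfolding openin_sum_topology by auto
  qed
  then have cont: "continuous_map (wedge_of_spheres m (int d)) ?Y E"
    unfolding wedge_of_spheres_eq by (rule continuous_compose_quotient_map[OF quotient_map_quotient_topology])
  have inj: "inj_on E (topspace (wedge_of_spheres m (int d)))"
  proof (rule inj_onI)
    fix p q assume "p \<in> topspace (wedge_of_spheres m (int d))" "q \<in> topspace (wedge_of_spheres m (int d))"
      and eq: "E p = E q"
    then obtain i x j y where p: "p = wedge_point i x" "q = wedge_point j y"
      by (auto simp: topspace_wedge_of_spheres)
    have "(if k = i then x else sphere_base) = (if k = j then y else sphere_base)" for k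
      using eq unfolding p Eq by (rule fun_cong)
    from this[of i] this[of j] show "p = q"
      unfolding p wedge_point_def by (auto split: if_splits)
  qed
  have "Hausdorff_space ?Y"
    using Hausdorff_Euclidean_space by (simp add: nsphere_def Hausdorff_space_subtopology Hausdorff_space_product_topology)
  then show ?thesis using cont
    using inj by (rule Hausdorff_space_injective_preimage)
qed

section \<open>Attaching simplices to a contractible complex\<close>

lemma complex_remove_facets:
  assumes K: "complex K" and maximal: "\<And>\<tau> \<rho>. \<tau> \<in> T \<Longrightarrow> \<rho> \<in> K \<Longrightarrow> \<tau> \<subseteq> \<rho> \<Longrightarrow> \<rho> = \<tau>" and "{} \<notin> T"
  shows "complex (K - T)"
  unfolding complex_def
proof (intro conjI ballI allI impI)
  show "finite (\<Union>(K - T))"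
    using K unfolding complex_def by (meson Diff_subset Union_mono finite_subset)
  show "{} \<in> K - T" using K assms(3) unfolding complex_def by blast
  fix \<sigma> \<rho> assume s: "\<sigma> \<in> K - T" "\<rho> \<subseteq> \<sigma>"
  then have "\<rho> \<in> K" using complex_face[OF K] by blast
  moreover have "\<rho> \<notin> T" using maximal[of \<rho> \<sigma>] s by blast
  ultimately show "\<rho> \<in> K - T" by blast
qed

text \<open>The complex \<open>K - T\<close> enters through a contraction \<open>H\<close> to
  \<open>c\<close>, under which \<open>c\<close> itself may move. The facets in \<open>T\<close>
  have \<open>d + 1\<close> vertices, so each contributes a sphere of dimension
  \<open>d\<close>.\<close>

locale attached_simplices =
  fixes K T :: "'v set set" and d :: nat and H :: "real \<times> ('v \<Rightarrow> real) \<Rightarrow> 'v \<Rightarrow> real" and c :: "'v \<Rightarrow> real"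
  assumes K: "complex K" and T: "T \<subseteq> K" "\<And>\<tau>. \<tau> \<in> T \<Longrightarrow> card \<tau> = Suc d"
    and maximal: "\<And>\<tau> \<rho>. \<tau> \<in> T \<Longrightarrow> \<rho> \<in> K \<Longrightarrow> \<tau> \<subseteq> \<rho> \<Longrightarrow> \<rho> = \<tau>"
    and nonempty: "bary_points (K - T) \<noteq> {}"
    and H_cont: "continuous_on ({0..1} \<times> bary_points (K - T)) H"
    and H_in: "\<And>t a. t \<in> {0..1} \<Longrightarrow> a \<in> bary_points (K - T) \<Longrightarrow> H (t, a) \<in> bary_points (K - T)"
    and H_0: "\<And>a. H (0, a) = a" and H_1: "\<And>a. H (1, a) = c"
begin

lemma finite_T: "finite T"
  using complex_finite[OF K] T(1) finite_subset by blast

lemma finite_facet: "\<tau> \<in> T \<Longrightarrow> finite \<tau>"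
  using complex_finite_face[OF K] T(1) by blast

lemma facet_nonempty: "\<tau> \<in> T \<Longrightarrow> \<tau> \<noteq> {}"
  using T(2) by fastforce

lemma complex_rest: "complex (K - T)"
  using complex_remove_facets[OF K maximal] facet_nonempty by blast

definition low :: "'v set \<Rightarrow> ('v \<Rightarrow> real) \<Rightarrow> real" where
  "low \<tau> a = Min (a ` \<tau>)"

text \<open>Normalised to be 0 at the barycentre and 1 on the boundary; \<open>push\<close> with a
  factor \<open>k \<ge> 0\<close> multiplies it by \<open>k\<close>.\<close>

definition radius :: "'v set \<Rightarrow> ('v \<Rightarrow> real) \<Rightarrow> real" where
  "radius \<tau> a = 1 - (real d + 1) * low \<tau> a"

definition centre :: "'v set \<Rightarrow> 'v \<Rightarrow> real" where
  "centre \<tau> v = (if v \<in> \<tau> then 1 / (real d + 1) else 0)"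

definition push :: "'v set \<Rightarrow> real \<Rightarrow> ('v \<Rightarrow> real) \<Rightarrow> 'v \<Rightarrow> real" where
  "push \<tau> k a v = centre \<tau> v + k * (a v - centre \<tau> v)"

lemma low_le: "\<tau> \<in> T \<Longrightarrow> v \<in> \<tau> \<Longrightarrow> low \<tau> a \<le> a v"
  using finite_facet by (simp add: low_def)

lemma low_in: "\<tau> \<in> T \<Longrightarrow> \<exists>v\<in>\<tau>. a v = low \<tau> a"
proof -
  assume "\<tau> \<in> T"
  then have "Min (a ` \<tau>) \<in> a ` \<tau>" using finite_facet facet_nonempty by (intro Min_in) auto
  then show ?thesis unfolding low_def by force
qed

lemma low_nonneg: "\<tau> \<in> T \<Longrightarrow> a \<in> face_points \<tau> \<Longrightarrow> 0 \<le> low \<tau> a"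
  using low_in[of \<tau> a] by (metis (mono_tags, lifting) face_points_def mem_Collect_eq)

lemma radius_le_1: "\<tau> \<in> T \<Longrightarrow> a \<in> face_points \<tau> \<Longrightarrow> radius \<tau> a \<le> 1"
  using low_nonneg[of \<tau> a] by (simp add: radius_def)

lemma radius_nonneg:
  assumes "\<tau> \<in> T" "a \<in> face_points \<tau>" shows "0 \<le> radius \<tau> a"
proof -
  have "(\<Sum>v\<in>\<tau>. low \<tau> a) \<le> sum a \<tau>" using low_le[OF assms(1)] by (rule sum_mono)
  then have "(real d + 1) * low \<tau> a \<le> 1"
    using assms(2) T(2)[OF assms(1)] by (simp add: face_points_def add.commute)
  then show ?thesis by (simp add: radius_def)
qed

lemma carrier_facet_iff:
  assumes "\<tau> \<in> T" "a \<in> face_points \<tau>" shows "carrier_face a = \<tau> \<longleftrightarrow> 0 < low \<tau> a"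
proof
  assume "carrier_face a = \<tau>"
  moreover obtain v where "v \<in> \<tau>" "a v = low \<tau> a" using low_in[OF assms(1)] by blast
  ultimately show "0 < low \<tau> a" using low_nonneg[OF assms] by (force simp: carrier_face_def)
next
  assume "0 < low \<tau> a"
  then have "0 < a v" if "v \<in> \<tau>" for v using low_le[OF assms(1) that, of a] by simp
  then have "\<tau> \<subseteq> carrier_face a" by (fastforce simp: carrier_face_def)
  then show "carrier_face a = \<tau>" using carrier_face_subset[OF assms(2)] by blast
qed

lemma carrier_rest_iff:
  assumes "\<tau> \<in> T" "a \<in> face_points \<tau>" shows "carrier_face a \<in> K - T \<longleftrightarrow> carrier_face a \<noteq> \<tau>"
proof
  assume ne: "carrier_face a \<noteq> \<tau>"
  have sub: "carrier_face a \<subseteq> \<tau>" using carrier_face_subset[OF assms(2)] .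
  have "carrier_face a \<in> K" using complex_face[OF K _ sub] assms(1) T(1) by blast
  moreover have "carrier_face a \<notin> T" using maximal[of "carrier_face a" \<tau>] sub ne assms(1) T(1) by blast
  ultimately show "carrier_face a \<in> K - T" by blast
qed (use assms in auto)

lemma rest_iff:
  assumes "\<tau> \<in> T" "a \<in> face_points \<tau>" shows "a \<in> bary_points (K - T) \<longleftrightarrow> carrier_face a \<in> K - T"
  by (rule face_points_bary_iff[OF finite_facet[OF assms(1)] assms(2)])

lemma rest_radius:
  assumes "\<tau> \<in> T" "a \<in> face_points \<tau>" shows "carrier_face a \<in> K - T \<longleftrightarrow> radius \<tau> a = 1"
  using carrier_rest_iff[OF assms] carrier_facet_iff[OF assms] low_nonneg[OF assms]
  by (auto simp: radius_def)

lemma bary_points_split: "bary_points K = bary_points (K - T) \<union> (\<Union>\<tau>\<in>T. face_points \<tau>)"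
proof -
  have "K = (K - T) \<union> T" using T(1) by blast
  then show ?thesis
    unfolding bary_points_eq_Union[OF K] bary_points_eq_Union[OF complex_rest] by blast
qed

lemma push_nonneg:
  assumes "\<tau> \<in> T" "a \<in> face_points \<tau>" "0 \<le> k" "k * radius \<tau> a \<le> 1"
  shows "0 \<le> push \<tau> k a v"
proof (cases "v \<in> \<tau>")
  case True
  \<comment> \<open>The least offset from the barycentre is
    \<open>- radius \<tau> a / (real d + 1)\<close>.\<close>
  have "k * (- radius \<tau> a / (real d + 1)) \<le> k * (a v - 1 / (real d + 1))"
  proof (rule mult_left_mono[OF _ assms(3)])
    have "- radius \<tau> a / (real d + 1) = low \<tau> a - 1 / (real d + 1)" by (simp add: radius_def field_simps)
    then show "- radius \<tau> a / (real d + 1) \<le> a v - 1 / (real d + 1)" using low_le[OF assms(1) True, of a] by simp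
  qed
  moreover have "k * radius \<tau> a / (real d + 1) \<le> 1 / (real d + 1)" using assms(4) by (intro divide_right_mono) auto
  ultimately show ?thesis using True by (simp add: push_def centre_def)
next
  case False
  then show ?thesis using assms(2) by (simp add: push_def centre_def face_points_def)
qed

lemma push_face:
  assumes "\<tau> \<in> T" "a \<in> face_points \<tau>" "0 \<le> k" "k * radius \<tau> a \<le> 1"
  shows "push \<tau> k a \<in> face_points \<tau>"
proof -
  have c: "sum (centre \<tau>) \<tau> = 1" using T(2)[OF assms(1)] by (simp add: centre_def)
  have "sum (push \<tau> k a) \<tau> = sum (centre \<tau>) \<tau> + k * (sum a \<tau> - sum (centre \<tau>) \<tau>)"
    by (simp add: push_def sum.distrib sum_subtractf flip: sum_distrib_left)
  also have "\<dots> = 1" using c assms(2) by (simp add: face_points_def)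
  finally show ?thesis using push_nonneg[OF assms] assms(2)
    by (auto simp: face_points_def push_def centre_def)
qed

text \<open>When the radius is scaled to 1, the coordinate that attains the minimum becomes 0, so
  the support drops to a proper face of the facet, and that lies in \<open>K - T\<close>.\<close>

lemma push_rest:
  assumes "\<tau> \<in> T" "a \<in> face_points \<tau>" "0 \<le> k" "k * radius \<tau> a = 1"
  shows "push \<tau> k a \<in> bary_points (K - T)"
proof -
  have p: "push \<tau> k a \<in> face_points \<tau>" using assms by (intro push_face) auto
  obtain v where v: "v \<in> \<tau>" "a v = low \<tau> a" using low_in[OF assms(1)] by blast
  have "push \<tau> k a v = 1 / (real d + 1) + k * (low \<tau> a - 1 / (real d + 1))"
    using v by (simp add: push_def centre_def)
  also have "\<dots> = (1 - k * radius \<tau> a) / (real d + 1)" by (simp add: radius_def field_simps)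
  finally have "push \<tau> k a v = 0" using assms(4) by simp
  then have "carrier_face (push \<tau> k a) \<noteq> \<tau>" using v(1) by (auto simp: carrier_face_def)
  then show ?thesis using rest_iff[OF assms(1) p] carrier_rest_iff[OF assms(1) p] by simp
qed

lemma push_1: "push \<tau> 1 a = a"
  by (rule ext) (simp add: push_def)

section \<open>Extending the contraction over the simplices\<close>

text \<open>The contraction \<open>H\<close> of the rest is extended over the attached simplices: radii are
  multiplied by \<open>1 + t\<close>, and a point that has reached the boundary continues along \<open>H\<close>.\<close>

definition deform :: "real \<times> ('v \<Rightarrow> real) \<Rightarrow> 'v \<Rightarrow> real" where
  "deform p = (let t = fst p; a = snd p; \<tau> = carrier_face a in
     if \<tau> \<in> K - T then H (t, a)
     else if (1 + t) * radius \<tau> a \<le> 1 then push \<tau> (1 + t) a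
     else H ((1 + t) * radius \<tau> a - 1, push \<tau> (1 / radius \<tau> a) a))"

lemma deform_rest: "a \<in> bary_points (K - T) \<Longrightarrow> deform (t, a) = H (t, a)"
  using bary_points_face[of a "K - T"] by (simp add: deform_def Let_def)

text \<open>The cases in \<open>deform\<close> are separated by support and by a strict inequality,
  so they are not all closed. This formula and the one for the outer part remain valid on the
  bordering sets, which gives closed pieces that agree where they overlap.\<close>

lemma deform_inner:
  assumes "\<tau> \<in> T" "a \<in> face_points \<tau>" "t \<in> {0..1}" "(1 + t) * radius \<tau> a \<le> 1"
  shows "deform (t, a) = push \<tau> (1 + t) a"
proof (cases "carrier_face a \<in> K - T")
  case True
  \<comment> \<open>A boundary point has radius 1, so it belongs to the inner part only at time
    0.\<close>
  then have "t = 0" using rest_radius[OF assms(1,2)] assms(3,4) by simp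
  then show ?thesis using True by (simp add: deform_def H_0 push_1)
next
  case False
  then have "carrier_face a = \<tau>" using carrier_rest_iff[OF assms(1,2)] by blast
  then show ?thesis using False assms(4) by (simp add: deform_def Let_def del: Diff_iff)
qed

lemma deform_outer:
  assumes "\<tau> \<in> T" "a \<in> face_points \<tau>" "t \<in> {0..1}" "1 \<le> (1 + t) * radius \<tau> a"
  shows "deform (t, a) = H ((1 + t) * radius \<tau> a - 1, push \<tau> (1 / radius \<tau> a) a)"
proof (cases "carrier_face a \<in> K - T")
  case True
  then have "radius \<tau> a = 1" using rest_radius[OF assms(1,2)] by simp
  \<comment> \<open>For radius 1 the time along \<open>H\<close> is \<open>t\<close>, and the push
    is the identity.\<close>
  then show ?thesis using True by (simp add: deform_def push_1)
next
  case False
  then have c: "carrier_face a = \<tau>" using carrier_rest_iff[OF assms(1,2)] by blast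
  show ?thesis
  proof (cases "(1 + t) * radius \<tau> a = 1")
    case True
    then have "1 / radius \<tau> a = 1 + t" by (metis mult_zero_right nonzero_eq_divide_eq zero_neq_one)
    then show ?thesis using c False True by (simp add: deform_def Let_def H_0 del: Diff_iff)
  next
    case neq: False
    then show ?thesis using c False assms(4) by (simp add: deform_def Let_def del: Diff_iff)
  qed
qed

lemma outer_in:
  assumes "\<tau> \<in> T" "a \<in> face_points \<tau>" "t \<in> {0..1}" "1 \<le> (1 + t) * radius \<tau> a"
  shows "(1 + t) * radius \<tau> a - 1 \<in> {0..1}" "push \<tau> (1 / radius \<tau> a) a \<in> bary_points (K - T)"
    "radius \<tau> a \<noteq> 0"
proof -
  show r: "radius \<tau> a \<noteq> 0" using assms(4) by auto
  have "(1 + t) * radius \<tau> a \<le> 2 * 1"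
    using assms(3) radius_le_1[OF assms(1,2)] radius_nonneg[OF assms(1,2)] by (intro mult_mono) auto
  then show "(1 + t) * radius \<tau> a - 1 \<in> {0..1}" using assms(4) by simp
  show "push \<tau> (1 / radius \<tau> a) a \<in> bary_points (K - T)"
    using r radius_nonneg[OF assms(1,2)] by (intro push_rest[OF assms(1,2)]) auto
qed

lemma deform_in:
  assumes t: "t \<in> {0..1}" and a: "a \<in> bary_points K"
  shows "deform (t, a) \<in> bary_points K"
proof -
  have sub: "bary_points (K - T) \<subseteq> bary_points K" by (auto simp: bary_points_def)
  consider "a \<in> bary_points (K - T)" | \<tau> where "\<tau> \<in> T" "a \<in> face_points \<tau>"
    using a unfolding bary_points_split by blast
  then show ?thesis
  proof cases
    case 1
    then show ?thesis using H_in[OF t 1] sub by (auto simp: deform_rest)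
  next
    case (2 \<tau>)
    show ?thesis
    proof (cases "(1 + t) * radius \<tau> a \<le> 1")
      case True
      then have "push \<tau> (1 + t) a \<in> face_points \<tau>" using t by (intro push_face 2) auto
      then show ?thesis using deform_inner[OF 2 t True] 2(1) unfolding bary_points_split by auto
    next
      case False
      then have le: "1 \<le> (1 + t) * radius \<tau> a" by simp
      then show ?thesis using deform_outer[OF 2 t le] H_in[OF outer_in(1,2)[OF 2 t le]] sub by auto
    qed
  qed
qed

lemma continuous_on_deform: "continuous_on ({0..1} \<times> bary_points K) deform"
proof -
  have coord: "continuous_on S (\<lambda>p. snd p v)" for S :: "(real \<times> ('v \<Rightarrow> real)) set" and v
    by (rule continuous_on_product_then_coordinatewise) (intro continuous_intros)
  have rad: "continuous_on S (\<lambda>p. radius \<tau> (snd p))" if "\<tau> \<in> T" for S :: "(real \<times> ('v \<Rightarrow> real)) set" and \<tau>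
  proof -
    have "continuous_on S (\<lambda>p. low \<tau> (snd p))"
      unfolding low_def
      by (rule continuous_on_compose2[OF continuous_on_Min_image[OF finite_facet[OF that] facet_nonempty[OF that], of UNIV]])
        (auto intro: continuous_intros)
    then show ?thesis unfolding radius_def by (intro continuous_intros)
  qed
  \<comment> \<open>Together with the cylinder over the rest, these are finitely many closed sets
    that cover the cylinder over \<open>K\<close>.\<close>
  define A where "A \<tau> = ({0..1} \<times> face_points \<tau>) \<inter> {p. (1 + fst p) * radius \<tau> (snd p) \<le> 1}" for \<tau>
  define B where "B \<tau> = ({0..1} \<times> face_points \<tau>) \<inter> {p. 1 \<le> (1 + fst p) * radius \<tau> (snd p)}" for \<tau>
  have closed: "closed (A \<tau>)" "closed (B \<tau>)" if "\<tau> \<in> T" for \<tau>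
    unfolding A_def B_def
    by (intro closed_Int closed_Times closed_atLeastAtMost closed_face_points closed_Collect_le
        continuous_intros rad that)+
  have contA: "continuous_on (A \<tau>) deform" if \<tau>: "\<tau> \<in> T" for \<tau>
  proof -
    have "continuous_on (A \<tau>) (\<lambda>p. push \<tau> (1 + fst p) (snd p))"
      by (rule continuous_on_coordinatewise_then_product) (unfold push_def, intro continuous_intros coord)
    moreover have "deform p = push \<tau> (1 + fst p) (snd p)" if "p \<in> A \<tau>" for p
      using that deform_inner[OF \<tau>, of "snd p" "fst p"] by (auto simp: A_def)
    ultimately show ?thesis by (simp cong: continuous_on_cong)
  qed
  have contB: "continuous_on (B \<tau>) deform" if \<tau>: "\<tau> \<in> T" for \<tau>
  proof -
    let ?q = "\<lambda>p. ((1 + fst p) * radius \<tau> (snd p) - 1, push \<tau> (1 / radius \<tau> (snd p)) (snd p))"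
    have B: "fst p \<in> {0..1}" "snd p \<in> face_points \<tau>" "1 \<le> (1 + fst p) * radius \<tau> (snd p)" if "p \<in> B \<tau>" for p
      using that by (auto simp: B_def)
    have "continuous_on (B \<tau>) (\<lambda>p. push \<tau> (1 / radius \<tau> (snd p)) (snd p))"
    proof (rule continuous_on_coordinatewise_then_product)
      \<comment> \<open>The factor \<open>1 + t\<close> is at most 2, so the radius stays away from
        0 here and its inverse is continuous.\<close>
      have "\<forall>p\<in>B \<tau>. radius \<tau> (snd p) \<noteq> 0" using outer_in(3)[OF \<tau>] B by blast
      then show "continuous_on (B \<tau>) (\<lambda>p. push \<tau> (1 / radius \<tau> (snd p)) (snd p) v)" for v
        unfolding push_def by (intro continuous_intros coord rad \<tau>) auto
    qed
    then have q: "continuous_on (B \<tau>) ?q"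
      by (rule continuous_on_Pair[rotated]) (intro continuous_intros rad \<tau>)
    have im: "?q ` B \<tau> \<subseteq> {0..1} \<times> bary_points (K - T)"
      using outer_in(1,2)[OF \<tau>] B by (fastforce simp del: atLeastAtMost_iff)
    have "continuous_on (B \<tau>) (\<lambda>p. H (?q p))"
      using continuous_on_compose2[OF H_cont q im] .
    moreover have "deform p = H (?q p)" if "p \<in> B \<tau>" for p
      using deform_outer[OF \<tau> B(2)[OF that] B(1)[OF that] B(3)[OF that]] by simp
    ultimately show ?thesis by (simp cong: continuous_on_cong)
  qed
  have "continuous_on (A \<tau> \<union> B \<tau>) deform" if "\<tau> \<in> T" for \<tau>
    using closed contA contB that by (intro continuous_on_closed_Un) auto
  then have T': "continuous_on (\<Union>\<tau>\<in>T. A \<tau> \<union> B \<tau>) deform"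
    using closed by (intro continuous_on_closed_Union finite_T) auto
  have C: "continuous_on ({0..1} \<times> bary_points (K - T)) deform"
  proof -
    have "deform p = H p" if "p \<in> {0..1} \<times> bary_points (K - T)" for p
      using that deform_rest[of "snd p" "fst p"] by auto
    then show ?thesis using H_cont by (simp cong: continuous_on_cong)
  qed
  have "{0..1} \<times> bary_points K = {0..1} \<times> bary_points (K - T) \<union> (\<Union>\<tau>\<in>T. A \<tau> \<union> B \<tau>)"
    unfolding bary_points_split A_def B_def by auto
  moreover have "closed (\<Union>\<tau>\<in>T. A \<tau> \<union> B \<tau>)" using closed finite_T by (intro closed_UN ballI closed_Un) auto
  moreover have "closed ({0..1::real} \<times> bary_points (K - T))"
    by (intro closed_Times closed_atLeastAtMost closed_bary_points complex_rest)
  ultimately show ?thesis using continuous_on_closed_Un[OF _ _ C T'] by simp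
qed

section \<open>The quotient map onto the wedge\<close>

text \<open>The numbering is arbitrary: the least coordinate, and with it the boundary, does not
  depend on it.\<close>

definition vertex :: "'v set \<Rightarrow> nat \<Rightarrow> 'v" where
  "vertex \<tau> = (SOME e. bij_betw e {..d} \<tau>)"

definition coords :: "'v set \<Rightarrow> ('v \<Rightarrow> real) \<Rightarrow> nat \<Rightarrow> real" where
  "coords \<tau> a i = (if i \<le> d then a (vertex \<tau> i) else 0)"

lemma bij_vertex:
  assumes "\<tau> \<in> T" shows "bij_betw (vertex \<tau>) {..d} \<tau>"
proof -
  have "\<exists>e. bij_betw e {..d} \<tau>"
    using finite_facet[OF assms] T(2)[OF assms] by (intro finite_same_card_bij) auto
  then show ?thesis unfolding vertex_def by (rule someI_ex)
qed

lemma coords_face: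
  assumes "\<tau> \<in> T" "a \<in> face_points \<tau>" shows "coords \<tau> a \<in> face_points {..d}"
proof -
  have "sum (coords \<tau> a) {..d} = (\<Sum>i\<le>d. a (vertex \<tau> i))" by (intro sum.cong) (auto simp: coords_def)
  also have "\<dots> = sum a \<tau>" by (rule sum.reindex_bij_betw[OF bij_vertex[OF assms(1)]])
  finally show ?thesis using assms(2) by (auto simp: face_points_def coords_def)
qed

lemma coords_min: 
  assumes "\<tau> \<in> T" shows "sx_min d (coords \<tau> a) = low \<tau> a"
proof -
  have "coords \<tau> a ` {..d} = a ` vertex \<tau> ` {..d}" by (auto simp: coords_def)
  then show ?thesis using bij_vertex[OF assms] by (simp add: sx_min_def low_def bij_betw_def)
qed

lemma coords_inj:
  assumes "\<tau> \<in> T" "a \<in> face_points \<tau>" "a' \<in> face_points \<tau>" "coords \<tau> a = coords \<tau> a'"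
  shows "a = a'"
proof
  fix v show "a v = a' v"
  proof (cases "v \<in> \<tau>")
    case True
    then obtain i where "i \<le> d" "v = vertex \<tau> i" using bij_vertex[OF assms(1)] by (auto simp: bij_betw_def)
    then show ?thesis using fun_cong[OF assms(4), of i] by (simp add: coords_def)
  qed (use assms in \<open>auto simp: face_points_def\<close>)
qed

lemma coords_surj:
  assumes "\<tau> \<in> T" "b \<in> face_points {..d}" shows "\<exists>a\<in>face_points \<tau>. coords \<tau> a = b"
proof -
  let ?e = "vertex \<tau>" and ?i = "inv_into {..d} (vertex \<tau>)"
  note e = bij_vertex[OF assms(1)]
  define a where "a v = (if v \<in> \<tau> then b (?i v) else 0)" for v
  have ae: "a (?e i) = b i" if "i \<le> d" for i
    using e that bij_betw_inv_into_left[OF e] by (auto simp: a_def bij_betw_def)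
  have "sum a \<tau> = (\<Sum>i\<le>d. a (?e i))" by (rule sum.reindex_bij_betw[OF e, symmetric])
  also have "\<dots> = 1" using ae assms(2) by (simp add: face_points_def)
  finally have "a \<in> face_points \<tau>" using assms(2) by (auto simp: face_points_def a_def)
  moreover have "coords \<tau> a = b" using ae assms(2) by (auto simp: coords_def face_points_def)
  ultimately show ?thesis by blast
qed

definition facet_index :: "'v set \<Rightarrow> nat" where
  "facet_index = (SOME h. bij_betw h T {..<card T})"

lemma bij_facet_index: "bij_betw facet_index T {..<card T}"
proof -
  have "\<exists>h. bij_betw h T {..<card T}" using finite_T by (intro finite_same_card_bij) auto
  then show ?thesis unfolding facet_index_def by (rule someI_ex)
qed

definition cell :: "'v set \<Rightarrow> ('v \<Rightarrow> real) \<Rightarrow> (nat \<times> (nat \<Rightarrow> real)) option" where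
  "cell \<tau> a = wedge_point (facet_index \<tau>) (to_sphere d (coords \<tau> a))"

text \<open>Crushes \<open>K - T\<close> to the wedge point. Outside the rest the facet of a point
  is its support, so no facet has to be chosen.\<close>

definition collapse_rest :: "('v \<Rightarrow> real) \<Rightarrow> (nat \<times> (nat \<Rightarrow> real)) option" where
  "collapse_rest a = (if carrier_face a \<in> K - T then None else cell (carrier_face a) a)"

lemma cell_None_iff:
  assumes "\<tau> \<in> T" "a \<in> face_points \<tau>" shows "cell \<tau> a = None \<longleftrightarrow> carrier_face a \<in> K - T"
proof -
  have "cell \<tau> a = None \<longleftrightarrow> low \<tau> a = 0"
    using to_sphere_base_iff[OF coords_face[OF assms]] coords_min[OF assms(1)]
    by (simp add: cell_def wedge_point_def)
  then show ?thesis
    using carrier_rest_iff[OF assms] carrier_facet_iff[OF assms] low_nonneg[OF assms] by auto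
qed

lemma collapse_rest_None_iff:
  assumes "a \<in> bary_points K" shows "collapse_rest a = None \<longleftrightarrow> carrier_face a \<in> K - T"
proof (cases "carrier_face a \<in> K - T")
  case False
  then have "carrier_face a \<in> T" using bary_points_face[OF assms] by blast
  then show ?thesis
    using cell_None_iff[OF _ bary_points_carrier[OF assms]] False by (simp add: collapse_rest_def)
qed (simp add: collapse_rest_def)

text \<open>On the boundary of a facet both maps give the base point. Therefore
  \<open>collapse_rest\<close> is continuous on closed facets and can be pasted.\<close>

lemma collapse_rest_face:
  assumes "\<tau> \<in> T" "a \<in> face_points \<tau>" shows "collapse_rest a = cell \<tau> a"
proof (cases "carrier_face a \<in> K - T")
  case True
  then show ?thesis using cell_None_iff[OF assms] by (simp add: collapse_rest_def)
next
  case False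
  then have "carrier_face a = \<tau>" using carrier_rest_iff[OF assms] by blast
  then show ?thesis using False by (simp add: collapse_rest_def del: Diff_iff)
qed

lemma continuous_cell:
  assumes "\<tau> \<in> T"
  shows "continuous_map (top_of_set (face_points \<tau>)) (wedge_of_spheres (card T) (int d)) (cell \<tau>)"
proof -
  have "continuous_on (face_points \<tau>) (coords \<tau>)"
  proof (rule continuous_on_coordinatewise_then_product)
    fix i
    show "continuous_on (face_points \<tau>) (\<lambda>a. coords \<tau> a i)"
      by (cases "i \<le> d") (auto simp: coords_def intro: continuous_on_subset[OF continuous_on_product_coordinates])
  qed
  then have "continuous_on (face_points \<tau>) (\<lambda>a. to_sphere d (coords \<tau> a))"
    by (rule continuous_on_compose2[OF continuous_on_to_sphere]) (use coords_face[OF assms] in auto)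
  moreover have "to_sphere d (coords \<tau> a) \<in> topspace (nsphere d)" if "a \<in> face_points \<tau>" for a
    by (intro to_sphere_in coords_face assms that)
  ultimately have "continuous_map (top_of_set (face_points \<tau>)) (nsphere d) (\<lambda>a. to_sphere d (coords \<tau> a))"
    by (subst nsphere_eq) auto
  moreover have "facet_index \<tau> < card T" using bij_facet_index assms by (auto simp: bij_betw_def)
  ultimately have "continuous_map (top_of_set (face_points \<tau>)) (wedge_of_spheres (card T) (int d))
      (wedge_point (facet_index \<tau>) \<circ> (\<lambda>a. to_sphere d (coords \<tau> a)))"
    using continuous_map_compose continuous_wedge_point by blast
  then show ?thesis by (simp add: cell_def[abs_def] comp_def)
qed

lemma None_in_wedge: "T \<noteq> {} \<Longrightarrow> None \<in> topspace (wedge_of_spheres (card T) (int d))"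
proof -
  assume "T \<noteq> {}"
  then have "0 < card T" using finite_T by (simp add: card_gt_0_iff)
  moreover have "sphere_base \<in> topspace (nsphere d)" using in_topspace_nsphere by (simp add: sphere_base_def)
  ultimately show ?thesis
    unfolding topspace_wedge_of_spheres by (intro image_eqI[of _ _ "(0, sphere_base)"]) (auto simp: wedge_point_def)
qed

lemma continuous_collapse_rest:
  assumes "T \<noteq> {}"
  shows "continuous_map (top_of_set (bary_points K)) (wedge_of_spheres (card T) (int d)) collapse_rest"
proof (rule pasting_lemma_closed[where I = "insert None (Some ` T)"
      and T = "\<lambda>i. case i of None \<Rightarrow> bary_points (K - T) | Some \<tau> \<Rightarrow> face_points \<tau>"
      and f = "\<lambda>_. collapse_rest"])
  \<comment> \<open>The closed cover consists of the rest, indexed by \<open>None\<close>, and the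
    closed facets.\<close>
  let ?P = "\<lambda>i. case i of None \<Rightarrow> bary_points (K - T) | Some \<tau> \<Rightarrow> face_points \<tau>"
  show "finite (insert None (Some ` T))" using finite_T by simp
  have sub: "?P i \<subseteq> bary_points K" if "i \<in> insert None (Some ` T)" for i
    using that unfolding bary_points_split by auto
  show "closedin (top_of_set (bary_points K)) (?P i)" if "i \<in> insert None (Some ` T)" for i
    using closed_face_points closed_bary_points[OF complex_rest] sub[OF that]
    by (intro closed_subset) (auto split: option.split)
  show "continuous_map (subtopology (top_of_set (bary_points K)) (?P i)) (wedge_of_spheres (card T) (int d)) collapse_rest"
    if i: "i \<in> insert None (Some ` T)" for i
  proof -
    have "subtopology (top_of_set (bary_points K)) (?P i) = top_of_set (?P i)"
      using sub[OF i] by (simp add: subtopology_subtopology Int_absorb1)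
    moreover have "continuous_map (top_of_set (?P i)) (wedge_of_spheres (card T) (int d)) collapse_rest"
    proof (cases i)
      case None
      have c: "continuous_map (top_of_set (bary_points (K - T))) (wedge_of_spheres (card T) (int d)) (\<lambda>_. None)"
        using None_in_wedge[OF assms] by simp
      have "collapse_rest a = None" if "a \<in> bary_points (K - T)" for a
        using bary_points_face[OF that] by (simp add: collapse_rest_def)
      then show ?thesis using continuous_map_eq[OF c, of collapse_rest] None by simp
    next
      case (Some \<tau>)
      then have "\<tau> \<in> T" using i by auto
      then show ?thesis
        using continuous_map_eq[OF continuous_cell, of \<tau> collapse_rest] collapse_rest_face[of \<tau>] Some by simp
    qed
    ultimately show ?thesis by simp
  qed
  show "\<exists>j. j \<in> insert None (Some ` T) \<and> x \<in> ?P j \<and> collapse_rest x = collapse_rest x"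
    if "x \<in> topspace (top_of_set (bary_points K))" for x
  proof -
    have "x \<in> bary_points (K - T) \<or> (\<exists>\<tau>\<in>T. x \<in> face_points \<tau>)"
      using that by (simp add: bary_points_split)
    then show ?thesis
    proof (elim disjE bexE)
      assume "x \<in> bary_points (K - T)"
      then show ?thesis by (intro exI[of _ None]) simp
    next
      fix \<tau> assume "\<tau> \<in> T" "x \<in> face_points \<tau>"
      then show ?thesis by (intro exI[of _ "Some \<tau>"]) simp
    qed
  qed
qed simp

lemma collapse_rest_surj:
  assumes "T \<noteq> {}"
  shows "collapse_rest ` bary_points K = topspace (wedge_of_spheres (card T) (int d))"
proof (intro subset_antisym subsetI)
  show "p \<in> topspace (wedge_of_spheres (card T) (int d))" if "p \<in> collapse_rest ` bary_points K" for p
    using that continuous_map_image_subset_topspace[OF continuous_collapse_rest[OF assms]] by auto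
next
  fix p assume "p \<in> topspace (wedge_of_spheres (card T) (int d))"
  then obtain i x where p: "p = wedge_point i x" "i < card T" "x \<in> topspace (nsphere d)"
    unfolding topspace_wedge_of_spheres by auto
  show "p \<in> collapse_rest ` bary_points K"
  proof (cases "x = sphere_base")
    case True
    \<comment> \<open>The base point is hit from the rest; in dimension 0 a facet has no boundary
      and misses it.\<close>
    obtain a where a: "a \<in> bary_points (K - T)" using nonempty by blast
    then have "collapse_rest a = None" using bary_points_face[OF a] by (simp add: collapse_rest_def)
    moreover have "a \<in> bary_points K" using a unfolding bary_points_split by blast
    ultimately show ?thesis using True p(1) by (force simp: wedge_point_def)
  next
    case False
    have "i \<in> facet_index ` T" using bij_facet_index p(2) by (simp add: bij_betw_def)
    then obtain \<tau> where \<tau>: "\<tau> \<in> T" "facet_index \<tau> = i" by blast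
    obtain b where b: "b \<in> face_points {..d}" "to_sphere d b = x" using to_sphere_surj[OF p(3) False] by blast
    obtain a where a: "a \<in> face_points \<tau>" "coords \<tau> a = b" using coords_surj[OF \<tau>(1) b(1)] by blast
    have "collapse_rest a = p" using collapse_rest_face[OF \<tau>(1) a(1)] a b \<tau> p(1) by (simp add: cell_def)
    moreover have "a \<in> bary_points K" using a(1) \<tau>(1) unfolding bary_points_split by blast
    ultimately show ?thesis by blast
  qed
qed

text \<open>Outside the rest, the index in the wedge names the facet, and the map to the sphere is
  injective on its interior. So only the rest is identified to a point.\<close>

lemma collapse_rest_eqD:
  assumes "a \<in> bary_points K" "a' \<in> bary_points K" "collapse_rest a = collapse_rest a'"
  shows "a = a' \<or> a \<in> bary_points (K - T) \<and> a' \<in> bary_points (K - T)"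
proof (cases "carrier_face a \<in> K - T")
  case True
  then have "carrier_face a' \<in> K - T" using assms collapse_rest_None_iff by metis
  then show ?thesis using True assms(1,2) by (simp add: bary_points_def)
next
  case False
  then have F': "carrier_face a' \<notin> K - T" using assms collapse_rest_None_iff by metis
  let ?\<tau> = "carrier_face a" and ?\<tau>' = "carrier_face a'"
  have \<tau>: "?\<tau> \<in> T" "?\<tau>' \<in> T" using False F' bary_points_face assms(1,2) by blast+
  note f = bary_points_carrier[OF assms(1)] bary_points_carrier[OF assms(2)]
  have "cell ?\<tau> a = cell ?\<tau>' a'" using assms(3) False F' by (simp only: collapse_rest_def if_False)
  moreover have "cell ?\<tau> a \<noteq> None" "cell ?\<tau>' a' \<noteq> None"
    using cell_None_iff[OF \<tau>(1) f(1)] cell_None_iff[OF \<tau>(2) f(2)] False F' by blast+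
  ultimately have eq: "facet_index ?\<tau> = facet_index ?\<tau>'"
      "to_sphere d (coords ?\<tau> a) = to_sphere d (coords ?\<tau>' a')"
    by (auto simp: cell_def wedge_point_def split: if_splits)
  then have same: "?\<tau>' = ?\<tau>" using bij_facet_index \<tau> by (metis bij_betw_def inj_onD)
  have f': "a' \<in> face_points ?\<tau>" using f(2) same by simp
  have "coords ?\<tau> a = coords ?\<tau> a'"
  proof (rule to_sphere_inj)
    show "0 < sx_min d (coords ?\<tau> a)" using carrier_facet_iff[OF \<tau>(1) f(1)] coords_min[OF \<tau>(1)] by simp
    show "0 < sx_min d (coords ?\<tau> a')" using carrier_facet_iff[OF \<tau>(1) f'] coords_min[OF \<tau>(1)] same by simp
  qed (use coords_face[OF \<tau>(1)] f(1) f' eq(2) same in auto)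
  then show ?thesis using coords_inj[OF \<tau>(1) f(1) f'] by blast
qed

text \<open>\<open>deform\<close> moves the rest inside itself and brings it to the single point
  \<open>c\<close> at time 1; these are the two fibre conditions for crushing the rest.\<close>

theorem homotopy_equivalent_wedge:
  assumes "T \<noteq> {}"
  shows "geometric_realization K homotopy_equivalent_space wedge_of_spheres (card T) (int d)"
  unfolding geometric_realization_eq
proof (rule homotopy_equivalent_quotient[where f = collapse_rest and G = deform])
  \<comment> \<open>A continuous surjection from a compact space onto a Hausdorff space is a
    quotient map.\<close>
  show "quotient_map (top_of_set (bary_points K)) (wedge_of_spheres (card T) (int d)) collapse_rest"
    using continuous_collapse_rest[OF assms] compact_bary_points[OF K] Hausdorff_wedge_of_spheres
      collapse_rest_surj[OF assms]
    by (intro continuous_imp_quotient_map) (auto simp: compact_space_subtopology)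
  show "continuous_map (prod_topology (top_of_set {0..1}) (top_of_set (bary_points K))) (top_of_set (bary_points K)) deform"
    using continuous_on_deform deform_in by auto
  show "deform (0, a) = a" if a: "a \<in> topspace (top_of_set (bary_points K))" for a
  proof -
    have "a \<in> bary_points K" using a by simp
    then consider "a \<in> bary_points (K - T)" | \<tau> where "\<tau> \<in> T" "a \<in> face_points \<tau>"
      unfolding bary_points_split by blast
    then show ?thesis
    proof cases
      case (2 \<tau>)
      then show ?thesis using deform_inner[OF 2, of 0] radius_le_1[OF 2] by (simp add: push_1)
    qed (simp add: deform_rest H_0)
  qed
  fix a a' assume a: "a \<in> topspace (top_of_set (bary_points K))" "a' \<in> topspace (top_of_set (bary_points K))"
    "collapse_rest a = collapse_rest a'"
  then consider "a = a'" | "a \<in> bary_points (K - T)" "a' \<in> bary_points (K - T)"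
    using collapse_rest_eqD[of a a'] by auto
  note cases = this
  show "deform (1, a) = deform (1, a')"
    using cases by cases (simp_all add: deform_rest H_1)
  show "collapse_rest (deform (t, a)) = collapse_rest (deform (t, a'))" if t: "t \<in> {0..1}" for t
    using cases
  proof cases
    case 2
    have "collapse_rest x = None" if "x \<in> bary_points (K - T)" for x
      using bary_points_face[OF that] by (simp add: collapse_rest_def)
    then show ?thesis using H_in[OF t] 2 by (simp add: deform_rest)
  qed simp
qed

end

theorem homotopy_equivalent_wedge_of_spheres:
  assumes K: "complex K" and T: "T \<subseteq> K" "T \<noteq> {}" "\<And>\<tau>. \<tau> \<in> T \<Longrightarrow> card \<tau> = Suc d"
    and maximal: "\<And>\<tau> \<rho>. \<tau> \<in> T \<Longrightarrow> \<rho> \<in> K \<Longrightarrow> \<tau> \<subseteq> \<rho> \<Longrightarrow> \<rho> = \<tau>"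
    and col: "collapses (K - T) {{}, {w}}"
  shows "geometric_realization K homotopy_equivalent_space wedge_of_spheres (card T) (int d)"
proof -
  have "{w} \<in> K - T"
  proof -
    have "L \<subseteq> K - T" if "collapses (K - T) L" for L
      using that by induction (auto dest: elementary_collapse_subset)
    then show ?thesis using col by blast
  qed
  have L: "complex (K - T)"
    using complex_remove_facets[OF K maximal] T(3) by force
  have ne: "bary_points (K - T) \<noteq> {}"
  proof -
    have "(\<lambda>v. if v = w then 1 else 0) \<in> face_points {w}" by (simp add: face_points_def)
    then show ?thesis using face_points_subset_bary[OF L \<open>{w} \<in> K - T\<close>] by blast
  qed
  obtain c where "homotopic_with (\<lambda>x. True) (top_of_set (bary_points (K - T))) (top_of_set (bary_points (K - T))) id (\<lambda>x. c)"
    using contractible_collapses[OF L col] unfolding contractible_space_def geometric_realization_eq by blast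
  then obtain H where H: "continuous_map (prod_topology (top_of_set {0..1::real}) (top_of_set (bary_points (K - T))))
      (top_of_set (bary_points (K - T))) H" "\<And>a. H (0, a) = a" "\<And>a. H (1, a) = c"
    unfolding homotopic_with_def id_apply by blast
  interpret attached_simplices K T d H c
  proof
    show "continuous_on ({0..1} \<times> bary_points (K - T)) H" using H(1) by simp
    show "H (t, a) \<in> bary_points (K - T)" if "t \<in> {0..1}" "a \<in> bary_points (K - T)" for t a
      using H(1) that by auto
  qed (use K T maximal ne H in auto)
  show ?thesis by (rule homotopy_equivalent_wedge[OF \<open>T \<noteq> {}\<close>])
qed

section \<open>The quotient of the partition lattice for a hook\<close>

lemma spherical_homotopy_equivalent:
  assumes "complex K" "spherical (Suc d) K"
  shows "\<exists>m\<ge>1. geometric_realization K homotopy_equivalent_space wedge_of_spheres m (int d)"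
proof -
  obtain T w where T: "T \<subseteq> K" "T \<noteq> {}"
    and *: "\<forall>\<tau>\<in>T. card \<tau> = Suc d \<and> (\<forall>\<rho>\<in>K. \<tau> \<subseteq> \<rho> \<longrightarrow> \<rho> = \<tau>)"
    and col: "collapses (K - T) {{}, {w}}"
    using assms(2) unfolding spherical_def by auto
  have "finite T" using T(1) complex_finite[OF assms(1)] by (rule finite_subset)
  then have "card T \<ge> 1" using T(2) by (simp add: Suc_le_eq card_gt_0_iff)
  moreover have "geometric_realization K homotopy_equivalent_space wedge_of_spheres (card T) (int d)"
    using * col by (intro homotopy_equivalent_wedge_of_spheres assms(1) T) auto
  ultimately show ?thesis by blast
qed

text \<open>There are only the discrete and the one-block partition, and their orbits are the bottom
  and the top.\<close>

lemma order_complex_quotient_2: "order_complex (quotient_carrier 2 ls) (quotient_le 2) = {{}}"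
proof -
  let ?A = "{1..2::nat}"
  define D where "D = {{1}, {2::nat}}"
  have cases: "P = D \<or> P = {?A}" if part: "partition_on ?A P" for P
  proof -
    have A: "?A = {1, 2}" by auto
    obtain B where B: "B \<in> P" "1 \<in> B" using part unfolding A partition_on_def by blast
    obtain C where C: "C \<in> P" "2 \<in> C" using part unfolding A partition_on_def by blast
    have "X = B \<or> X = C" if "X \<in> P" for X
    proof -
      have "X \<noteq> {}" "X \<subseteq> {1, 2}" using part \<open>X \<in> P\<close> unfolding A by (auto simp: partition_on_def)
      then have "1 \<in> X \<or> 2 \<in> X" by blast
      then show ?thesis
        using B C part \<open>X \<in> P\<close> by (auto simp: partition_on_def disjoint_def)
    qed
    then have P: "P = {B, C}" using B C by blast
    have sub: "B \<subseteq> {1, 2}" "C \<subseteq> {1, 2}" using part B(1) C(1) unfolding A by (auto simp: partition_on_def)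
    show ?thesis
    proof (cases "B = C")
      case True
      then show ?thesis using P B(2) C(2) sub A by auto
    next
      case False
      then have "B \<inter> C = {}" using part B(1) C(1) by (auto simp: partition_on_def disjoint_def)
      then have "B = {1}" "C = {2}" using B(2) C(2) sub by auto
      then show ?thesis using P by (simp add: D_def)
    qed
  qed
  have "refines ?A D P" if "partition_on ?A P" for P
  proof -
    have "?A = {1, 2}" by auto
    then have "partition_on ?A D" by (auto simp: D_def partition_on_def disjoint_def)
    moreover have "\<exists>Y\<in>P. X \<subseteq> Y" if "X \<in> D" for X
      using that \<open>partition_on ?A P\<close> by (auto simp: D_def partition_on_def)
    ultimately show ?thesis using that by (simp add: refines_def)
  qed
  moreover have "refines ?A P {?A}" if "partition_on ?A P" for P
    using that partition_on_space[of ?A] by (auto simp: refines_def partition_on_def)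
  moreover have self: "P \<in> young_orbit ls P" for P
    by (auto simp: young_orbit_def partition_act_def young_subgroup_def permutes_id intro!: exI[of _ id])
  ultimately have le: "quotient_le 2 (young_orbit ls D) (young_orbit ls P)"
    "quotient_le 2 (young_orbit ls P) (young_orbit ls {?A})" if "partition_on ?A P" for P
    using that unfolding quotient_le_def by blast+
  have "proper_part (quotient_carrier 2 ls) (quotient_le 2) = {}"
    using cases le by (fastforce simp: proper_part_def quotient_carrier_def set_partitions_def)
  then show ?thesis by (auto simp: order_complex_eq chain_complex_def)
qed

theorem theorem5p1:
  fixes n :: nat and ls :: "nat list"
  assumes "n \<ge> 2" and "number_partition n ls" and "hook_shape ls"
  shows "collapsible (order_complex (quotient_carrier n ls) (quotient_le n)) \<or>
    (\<exists>m\<ge>1. geometric_realization (order_complex (quotient_carrier n ls) (quotient_le n))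
       homotopy_equivalent_space wedge_of_spheres m (int n - 3))"
proof (cases "n = 2")
  case True
  \<comment> \<open>In dimension -1 both spaces are empty. This case stands apart because the
    passage from \<open>spherical (Suc d)\<close> to wedges concerns spheres of dimension
    \<open>d \<ge> 0\<close>.\<close>
  have "geometric_realization {{}} = (trivial_topology :: ((nat set set set \<Rightarrow> real) topology))"
  proof -
    have "bary_points {{}} = ({} :: (nat set set set \<Rightarrow> real) set)" by (auto simp: bary_points_def)
    then show ?thesis by (simp add: geometric_realization_eq)
  qed
  moreover have "wedge_of_spheres 1 (int n - 3) = trivial_topology"
    using True by (simp add: wedge_of_spheres_def wedge_sum_def sphere_space_def flip: null_topspace_iff_trivial)
  ultimately show ?thesis
    unfolding True order_complex_quotient_2 using True
    by (intro disjI2 exI[of _ 1]) (simp add: homeomorphic_imp_homotopy_equivalent_space homeomorphic_empty_space_eq)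
next
  case False
  then have n: "n \<ge> 3" using assms(1) by simp
  have sum: "sum_list ls = n" using assms(2) by (simp add: number_partition_def)
  show ?thesis
  proof (cases "length ls \<ge> 2")
    case True
    have "spherical (Suc (n - 3)) (order_complex (quotient_carrier n ls) (quotient_le n))"
    proof -
      \<comment> \<open>Top faces have \<open>n - 2\<close> vertices and the spheres dimension
        \<open>n - 3\<close>; the subtraction is not truncated since
        \<open>n \<ge> 3\<close>.\<close>
      have "n - 2 = Suc (n - 3)" using n by simp
      then show ?thesis using spherical_hook_quotient[OF assms(3) sum True] by simp
    qed
    moreover have "int (n - 3) = int n - 3" using n by simp
    ultimately show ?thesis using spherical_homotopy_equivalent[OF complex_quotient] by metis
  next
    case False
    moreover have "ls \<noteq> []" using assms(3) by (simp add: hook_shape_def)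
    ultimately obtain a where "ls = [a]" by (cases ls; cases "tl ls") auto
    then have "ls = [n]" using sum by simp
    then show ?thesis using collapsible_one_row[OF n] by simp
  qed
qed

end
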